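(* Let $0<\alpha<1$, $\beta\ge\alpha$, $T>0$, $h>0$, $y_0\in\mathbb{R}^n$, $\varphi:[-h,0)\to\mathbb{R}^n$, the control sets $U(t)\subset\mathbb{R}^r$ ($t\in[0,T]$), $f$, $f_0$ and $\Phi$ be the data of the optimal control problem $(P)$ described in the context, and assume that conditions (C1), (C2), (C3), (C4) listed there hold. Suppose that the admissible process $(u,y)$ is optimal for $(P)$, and let $\Psi$ be a solution of the conjugate problem (the adjoint integral equation given in the context) along this optimal process. Then for almost every $t\in[0,T]$, $$\max_{v\in U}H\big(t,y(t),y(t-h),v,\Psi(t)\big)=H\big(t,y(t),y(t-h),u(t),\Psi(t)\big),$$ where $U=U(t)$ is the control set at time $t$ and $H$ is the Hamiltonian defined in the context.
   Context: Function class. $AC^{\alpha}_{\infty}([0,T],\mathbb{R}^n)$ is the set of $y:[0,T]\to\mathbb{R}^n$ of the form $y(t)=y(0)+\frac{1}{\Gamma(\alpha)}\int_0^t(t-\tau)^{\alpha-1}g(\tau)\,d\tau$, $t\in[0,T]$, with some $g\in L^\infty([0,T],\mathbb{R}^n)$; the Caputo derivative of such $y$ is ${}^{C}D^{\alpha}_{0+}y=g$ (a.e.). Problem $(P)$. Let $f:[0,T]\times\mathbb{R}^n\times\mathbb{R}^n\times\mathbb{R}^r\to\mathbb{R}^n$, $f_0:[0,T]\times\mathbb{R}^n\times\mathbb{R}^n\times\mathbb{R}^r\to\mathbb{R}$, $\Phi:\mathbb{R}^n\to\mathbb{R}$; let $U(t)\subset\mathbb{R}^r$, $t\in[0,T]$,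 be the control sets, $y_0\in\mathbb{R}^n$ a fixed initial value, and $\varphi:[-h,0)\to\mathbb{R}^n$ a given initial function. A control is a measurable and bounded function $u$ on $[0,T]$ with $u(t)\in U(t)$. An admissible process (pair) $(u,y)$ consists of such a control $u$ and a function $y:[-h,T]\to\mathbb{R}^n$ with $y|_{[0,T]}\in AC^\alpha_\infty([0,T],\mathbb{R}^n)$ and $$({}^{C}D^{\alpha}_{0+}y)(t)=f(t,y(t),y(t-h),u(t))\ \text{ for a.e. } t\in[0,T],\qquad y(0)=y_0,\qquad y(t)=\varphi(t)\ \text{ for } -h\le t<0 .$$ The cost is $$J(u)=\Phi(y(T))+\frac{1}{\Gamma(\beta)}\int_0^T(T-t)^{\beta-1}f_0(t,y(t),y(t-h),u(t))\,dt ,$$ and $(u,y)$ is optimal if $J(u)=\inf J(v)$, the infimum being over all controls $v(\cdot)$ with $v(t)\in U(t)$. Assumptions. Write the arguments of $d\in\{f,f_0\}$ as $(t,y,y',u)$, where $y'$ is the slot of the delayed state (the prime is not a derivative). (C1) There is $L>0$ such that, for $d=f$ and $d=f_0$, all $t\in[0,T]$, $y_1,y_2,y_1',y_2'\in\mathbb{R}^n$, $u_1,u_2\in\mathbb{R}^r$: $\|d(t,y_1,y_1',u_1)-d(t,y_2,y_2',u_2)\|\le L(\|y_1-y_2\|+\|y_1'-y_2'\|+\|u_1-u_2\|)$ and $\|d(t,0,0,0)\|\le L$. (C2) $d=f,f_0$ are continuously differentiable in $(y,y',u)$ and measurable in $t$, and there is $L_1>0$ such that for all such arguments each of the partial derivatives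 $d_y,d_{y'},d_u$ (denoted $d_\bullet$) satisfies $\|d_\bullet(t,y_1,y_1',u_1)-d_\bullet(t,y_2,y_2',u_2)\|\le L_1(\|y_1-y_2\|+\|y_1'-y_2'\|+\|u_1-u_2\|)$ and $\|d_\bullet(t,0,0,0)\|\le L_1$. (C3) $\Phi$ is continuously differentiable and uniformly bounded. (C4) The set $\{U(t): t\in[0,T]\}$ is compact; the values $U(t)$ are nonempty compact subsets of $\mathbb{R}^r$. Hamiltonian. For $y,y_h,\psi\in\mathbb{R}^n$, $u\in\mathbb{R}^r$, $$H(t,y,y_h,u,\psi)=\psi^{\top}f(t,y,y_h,u)-\frac{\Gamma(\alpha)}{\Gamma(\beta)}(T-t)^{\beta-\alpha}f_0(t,y,y_h,u).$$ $H_y$ and $H_{y_h}$ denote its gradients in $y$ and $y_h$. Conjugate problem along $(u,y)$. A solution is a function $\Psi:[0,T+h]\to\mathbb{R}^n$ with $\Psi(t)=0$ for $t\in(T,T+h]$, and for $t\in[0,T]$ $$\Psi(t)=-\nabla\Phi(y(T))+\frac{(T-t)^{1-\alpha}}{\Gamma(\alpha)}\int_t^T(T-\tau)^{\alpha-1}(\tau-t)^{\alpha-1}H_y(\tau,y(\tau),y(\tau-h),u(\tau),\Psi(\tau))\,d\tau$$ $$\qquad+\frac{(T-t)^{1-\alpha}}{\Gamma(\alpha)}\int_{t+h}^T(T-\tau)^{\alpha-1}(\tau-t-h)^{\alpha-1}H_{y_h}(\tau,y(\tau),y(\tau-h),u(\tau),\Psi(\tau))\,d\tau,$$ where the second integral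 is taken to be $0$ when $t+h>T$.
   Formalization: The formal theorem additionally assumes that t ↦ U(t) is a (Lebesgue) measurable set-valued map and that the initial function φ is Lebesgue measurable; without either assumption the statement fails. *)

theory Defs
  imports "HOL-Analysis.Analysis"
begin

section \<open>Riemann--Liouville integral form of the Caputo derivative\<close>

definition Linfty :: "real \<Rightarrow> (real \<Rightarrow> real^'n) \<Rightarrow> bool" where
  "Linfty T g \<longleftrightarrow>
     g \<in> borel_measurable (lebesgue_on {0..T}) \<and>
     (\<exists>C. AE t in lebesgue_on {0..T}. norm (g t) \<le> C)"

text \<open>The Caputo derivative of a function in \<open>AC_infty\<close> is only determined almost
  everywhere, so it is a relation: the function \<open>g\<close> is a version of the derivative of \<open>y\<close> on
  \<open>[0,T]\<close>.  Here and below \<open>0 powr a = 0\<close> in HOL, which changes the singular kernels at a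
  single point only.\<close>

definition has_caputo_derivative ::
  "real \<Rightarrow> real \<Rightarrow> (real \<Rightarrow> real^'n) \<Rightarrow> (real \<Rightarrow> real^'n) \<Rightarrow> bool" where
  "has_caputo_derivative \<alpha> T y g \<longleftrightarrow>
     Linfty T g \<and>
     (\<forall>t\<in>{0..T}. y t = y 0 + (1 / Gamma \<alpha>) *\<^sub>R
        set_lebesgue_integral lebesgue {0..t} (\<lambda>\<tau>. (t - \<tau>) powr (\<alpha> - 1) *\<^sub>R g \<tau>))"

definition AC_infty :: "real \<Rightarrow> real \<Rightarrow> (real \<Rightarrow> real^'n) set" where
  "AC_infty \<alpha> T = {y. \<exists>g. has_caputo_derivative \<alpha> T y g}"


section \<open>Differentiability\<close>

definition continuously_differentiable ::
  "('a::real_normed_vector \<Rightarrow> 'b::real_normed_vector) \<Rightarrow> bool" where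
  "continuously_differentiable g \<longleftrightarrow>
     (\<exists>g'. (\<forall>x. (g has_derivative blinfun_apply (g' x)) (at x)) \<and> continuous_on UNIV g')"

definition gradient :: "('a::real_inner \<Rightarrow> real) \<Rightarrow> 'a \<Rightarrow> 'a" where
  "gradient g x = (THE D. GDERIV g x :> D)"


section \<open>Set-valued maps\<close>

definition compact_sets :: "'a::metric_space set set" where
  "compact_sets = {K. compact K \<and> K \<noteq> {}}"

text \<open>The value \<open>0\<close> off the nonempty compact sets only serves the locale
  \<open>Metric_space\<close>, which requires nonnegativity on the whole type.\<close>

definition hausdorff_dist :: "'a::metric_space set \<Rightarrow> 'a set \<Rightarrow> real" where
  "hausdorff_dist A B =
     (if A \<in> compact_sets \<and> B \<in> compact_sets
      then max (SUP a\<in>A. infdist a B) (SUP b\<in>B. infdist b A) else 0)"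

lemma bdd_above_infdist_compact:
  assumes "compact A"
  shows "bdd_above ((\<lambda>a. infdist a B) ` A)"
  using assms
  by (intro bounded_imp_bdd_above compact_imp_bounded compact_continuous_image)
     (auto intro!: continuous_intros)

lemma hausdorff_dist_le_iff:
  assumes "A \<in> compact_sets" "B \<in> compact_sets"
  shows "hausdorff_dist A B \<le> e \<longleftrightarrow>
    (\<forall>a\<in>A. infdist a B \<le> e) \<and> (\<forall>b\<in>B. infdist b A \<le> e)"
  using assms unfolding hausdorff_dist_def compact_sets_def
  by (auto simp: cSUP_le_iff bdd_above_infdist_compact)

lemma infdist_le_hausdorff_dist:
  assumes "A \<in> compact_sets" "B \<in> compact_sets" "a \<in> A"
  shows "infdist a B \<le> hausdorff_dist A B"
  using hausdorff_dist_le_iff[OF assms(1,2)] assms(3) by blast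

lemma hausdorff_dist_commute: "hausdorff_dist A B = hausdorff_dist B A"
  by (auto simp: hausdorff_dist_def max.commute)

lemma hausdorff_dist_nonneg:
  assumes "A \<in> compact_sets" "B \<in> compact_sets"
  shows "0 \<le> hausdorff_dist A B"
proof -
  obtain a where "a \<in> A" using assms(1) by (auto simp: compact_sets_def)
  then show ?thesis
    using infdist_le_hausdorff_dist[OF assms] infdist_nonneg order_trans by blast
qed

lemma infdist_hausdorff_triangle:
  fixes A B :: "'a::heine_borel set"
  assumes "A \<in> compact_sets" "B \<in> compact_sets"
  shows "infdist x B \<le> infdist x A + hausdorff_dist A B"
proof -
  have A: "compact A" "A \<noteq> {}" using assms(1) by (auto simp: compact_sets_def)
  obtain a where a: "a \<in> A" "infdist x A = dist x a"
    using infdist_attains_inf[OF compact_imp_closed[OF A(1)] A(2), of x] by blast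
  have "infdist x B \<le> infdist a B + dist x a" by (rule infdist_triangle)
  then show ?thesis using infdist_le_hausdorff_dist[OF assms a(1)] a(2) by linarith
qed

lemma Metric_space_hausdorff:
  "Metric_space (compact_sets :: 'a::heine_borel set set) hausdorff_dist"
proof -
  have eq: "A = B" if AB: "A \<in> compact_sets" "B \<in> compact_sets" and 0: "hausdorff_dist A B = 0"
    for A B :: "'a set"
  proof -
    have c: "closed A" "closed B" "A \<noteq> {}" "B \<noteq> {}"
      using AB by (auto simp: compact_sets_def compact_imp_closed)
    have *: "\<forall>a\<in>A. infdist a B = 0" "\<forall>b\<in>B. infdist b A = 0"
      using hausdorff_dist_le_iff[OF AB, of 0] 0 by (auto intro!: antisym infdist_nonneg)
    have "A \<subseteq> B" using * c in_closed_iff_infdist_zero[of B] by blast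
    moreover have "B \<subseteq> A" using * c in_closed_iff_infdist_zero[of A] by blast
    ultimately show ?thesis by blast
  qed
  have tri: "hausdorff_dist A C \<le> hausdorff_dist A B + hausdorff_dist B C"
    if *: "A \<in> compact_sets" "B \<in> compact_sets" "C \<in> compact_sets" for A B C :: "'a set"
  proof -
    have "infdist a C \<le> hausdorff_dist A B + hausdorff_dist B C" if "a \<in> A" for a
      using infdist_hausdorff_triangle[OF *(2,3), of a]
        infdist_le_hausdorff_dist[OF *(1,2) that] by linarith
    moreover have "infdist c A \<le> hausdorff_dist A B + hausdorff_dist B C" if "c \<in> C" for c
      using infdist_hausdorff_triangle[OF *(2,1), of c]
        infdist_le_hausdorff_dist[OF *(3,2) that]
      by (simp add: hausdorff_dist_commute)
    ultimately show ?thesis using hausdorff_dist_le_iff[OF *(1,3)] by blast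
  qed
  have zero: "hausdorff_dist A A = 0" if "A \<in> compact_sets" for A :: "'a set"
    using that hausdorff_dist_le_iff[OF that that, of 0] hausdorff_dist_nonneg[OF that that]
    by auto
  have nn: "0 \<le> hausdorff_dist A B" for A B :: "'a set"
    using hausdorff_dist_nonneg[of A B] by (auto simp: hausdorff_dist_def)
  show ?thesis
    by unfold_locales (use eq tri zero nn hausdorff_dist_commute in auto)
qed

text \<open>Compactness of a family of nonempty compact sets is compactness in the hyperspace with
  the Hausdorff metric.\<close>

definition compact_family :: "'a::heine_borel set set \<Rightarrow> bool" where
  "compact_family \<F> \<longleftrightarrow> compactin (Metric_space.mtopology compact_sets hausdorff_dist) \<F>"

text \<open>Left implicit in the conditions on the control sets, but needed for the maximum principle:
  compactness of the family alone does not provide measurable selections through the points of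
  \<open>U t\<close> (take \<open>{0, 1}\<close> on a non-measurable set and \<open>{0, 2}\<close> off it).\<close>

definition measurable_multifunction :: "real \<Rightarrow> (real \<Rightarrow> (real^'r) set) \<Rightarrow> bool" where
  "measurable_multifunction T U \<longleftrightarrow>
     (\<forall>V. open V \<longrightarrow> {t\<in>{0..T}. U t \<inter> V \<noteq> {}} \<in> sets lebesgue)"


section \<open>Processes, cost and optimality\<close>

text \<open>Functions on a time interval are total functions on \<open>real\<close>; values outside the stated
  interval are never used.  The arguments of \<open>f\<close> and \<open>f0\<close> are time, state, delayed state and
  control.\<close>

definition is_control :: "real \<Rightarrow> (real \<Rightarrow> (real^'r) set) \<Rightarrow> (real \<Rightarrow> real^'r) \<Rightarrow> bool" where
  "is_control T U u \<longleftrightarrow>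
     u \<in> borel_measurable (lebesgue_on {0..T}) \<and> bounded (u ` {0..T}) \<and> (\<forall>t\<in>{0..T}. u t \<in> U t)"

definition admissible_process ::
  "real \<Rightarrow> real \<Rightarrow> real \<Rightarrow> (real \<Rightarrow> real^'n \<Rightarrow> real^'n \<Rightarrow> real^'r \<Rightarrow> real^'n) \<Rightarrow>
   (real \<Rightarrow> (real^'r) set) \<Rightarrow> real^'n \<Rightarrow> (real \<Rightarrow> real^'n) \<Rightarrow>
   (real \<Rightarrow> real^'r) \<Rightarrow> (real \<Rightarrow> real^'n) \<Rightarrow> bool" where
  "admissible_process \<alpha> T h f U y0 \<phi> u y \<longleftrightarrow>
     is_control T U u \<and>
     y \<in> AC_infty \<alpha> T \<and>
     (\<exists>g. has_caputo_derivative \<alpha> T y g \<and>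
          (AE t in lebesgue_on {0..T}. g t = f t (y t) (y (t - h)) (u t))) \<and>
     y 0 = y0 \<and>
     (\<forall>t\<in>{-h..<0}. y t = \<phi> t)"

definition running_cost ::
  "real \<Rightarrow> real \<Rightarrow> real \<Rightarrow> (real \<Rightarrow> real^'n \<Rightarrow> real^'n \<Rightarrow> real^'r \<Rightarrow> real) \<Rightarrow>
   (real \<Rightarrow> real^'r) \<Rightarrow> (real \<Rightarrow> real^'n) \<Rightarrow> real \<Rightarrow> real" where
  "running_cost \<beta> T h f0 u y t = (T - t) powr (\<beta> - 1) * f0 t (y t) (y (t - h)) (u t)"

definition cost ::
  "real \<Rightarrow> real \<Rightarrow> real \<Rightarrow> (real \<Rightarrow> real^'n \<Rightarrow> real^'n \<Rightarrow> real^'r \<Rightarrow> real) \<Rightarrow> (real^'n \<Rightarrow> real) \<Rightarrow>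
   (real \<Rightarrow> real^'r) \<Rightarrow> (real \<Rightarrow> real^'n) \<Rightarrow> real" where
  "cost \<beta> T h f0 \<Phi> u y =
     \<Phi> (y T) + 1 / Gamma \<beta> * set_lebesgue_integral lebesgue {0..T} (running_cost \<beta> T h f0 u y)"

text \<open>The processes whose cost integral exists.  (A non-integrable integrand would silently
  have integral \<open>0\<close>.)  The infimum is taken in the extended reals, so that it is meaningful
  without assuming a lower bound.\<close>

definition costed_processes ::
  "real \<Rightarrow> real \<Rightarrow> real \<Rightarrow> real \<Rightarrow> (real \<Rightarrow> real^'n \<Rightarrow> real^'n \<Rightarrow> real^'r \<Rightarrow> real^'n) \<Rightarrow>
   (real \<Rightarrow> real^'n \<Rightarrow> real^'n \<Rightarrow> real^'r \<Rightarrow> real) \<Rightarrow>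
   (real \<Rightarrow> (real^'r) set) \<Rightarrow> real^'n \<Rightarrow> (real \<Rightarrow> real^'n) \<Rightarrow>
   ((real \<Rightarrow> real^'r) \<times> (real \<Rightarrow> real^'n)) set" where
  "costed_processes \<alpha> \<beta> T h f f0 U y0 \<phi> =
     {(v, z). admissible_process \<alpha> T h f U y0 \<phi> v z \<and>
              set_integrable lebesgue {0..T} (running_cost \<beta> T h f0 v z)}"

definition optimal_process ::
  "real \<Rightarrow> real \<Rightarrow> real \<Rightarrow> real \<Rightarrow> (real \<Rightarrow> real^'n \<Rightarrow> real^'n \<Rightarrow> real^'r \<Rightarrow> real^'n) \<Rightarrow>
   (real \<Rightarrow> real^'n \<Rightarrow> real^'n \<Rightarrow> real^'r \<Rightarrow> real) \<Rightarrow> (real^'n \<Rightarrow> real) \<Rightarrow>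
   (real \<Rightarrow> (real^'r) set) \<Rightarrow> real^'n \<Rightarrow> (real \<Rightarrow> real^'n) \<Rightarrow>
   (real \<Rightarrow> real^'r) \<Rightarrow> (real \<Rightarrow> real^'n) \<Rightarrow> bool" where
  "optimal_process \<alpha> \<beta> T h f f0 \<Phi> U y0 \<phi> u y \<longleftrightarrow>
     (u, y) \<in> costed_processes \<alpha> \<beta> T h f f0 U y0 \<phi> \<and>
     ereal (cost \<beta> T h f0 \<Phi> u y) =
       (INF (v, z)\<in>costed_processes \<alpha> \<beta> T h f f0 U y0 \<phi>. ereal (cost \<beta> T h f0 \<Phi> v z))"


section \<open>Standing assumptions\<close>

definition lipschitz_with_growth ::
  "real \<Rightarrow> real \<Rightarrow> (real \<Rightarrow> real^'n \<Rightarrow> real^'n \<Rightarrow> real^'r \<Rightarrow> 'c::real_normed_vector) \<Rightarrow> bool" where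
  "lipschitz_with_growth T L d \<longleftrightarrow>
     (\<forall>t\<in>{0..T}.
        (\<forall>y1 y2 y1' y2' u1 u2. norm (d t y1 y1' u1 - d t y2 y2' u2)
            \<le> L * (norm (y1 - y2) + norm (y1' - y2') + norm (u1 - u2))) \<and>
        norm (d t 0 0 0) \<le> L)"

definition cond_C1 ::
  "real \<Rightarrow> (real \<Rightarrow> real^'n \<Rightarrow> real^'n \<Rightarrow> real^'r \<Rightarrow> real^'n) \<Rightarrow>
   (real \<Rightarrow> real^'n \<Rightarrow> real^'n \<Rightarrow> real^'r \<Rightarrow> real) \<Rightarrow> bool" where
  "cond_C1 T f f0 \<longleftrightarrow> (\<exists>L>0. lipschitz_with_growth T L f \<and> lipschitz_with_growth T L f0)"

definition deriv_state ::
  "(real \<Rightarrow> 'x \<Rightarrow> 'y \<Rightarrow> 'u \<Rightarrow> 'c) \<Rightarrow> real \<Rightarrow> 'x \<Rightarrow> 'y \<Rightarrow> 'u \<Rightarrow>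
   'x::real_normed_vector \<Rightarrow> 'c::real_normed_vector" where
  "deriv_state d t y y' u = frechet_derivative (\<lambda>x. d t x y' u) (at y)"

definition deriv_delayed ::
  "(real \<Rightarrow> 'x \<Rightarrow> 'y \<Rightarrow> 'u \<Rightarrow> 'c) \<Rightarrow> real \<Rightarrow> 'x \<Rightarrow> 'y \<Rightarrow> 'u \<Rightarrow>
   'y::real_normed_vector \<Rightarrow> 'c::real_normed_vector" where
  "deriv_delayed d t y y' u = frechet_derivative (\<lambda>x. d t y x u) (at y')"

definition deriv_control ::
  "(real \<Rightarrow> 'x \<Rightarrow> 'y \<Rightarrow> 'u \<Rightarrow> 'c) \<Rightarrow> real \<Rightarrow> 'x \<Rightarrow> 'y \<Rightarrow> 'u \<Rightarrow>
   'u::real_normed_vector \<Rightarrow> 'c::real_normed_vector" where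
  "deriv_control d t y y' u = frechet_derivative (\<lambda>x. d t y y' x) (at u)"

text \<open>The same two bounds for a partial derivative, in the operator norm.\<close>

definition partial_lipschitz_with_growth ::
  "real \<Rightarrow> real \<Rightarrow>
   (real \<Rightarrow> real^'n \<Rightarrow> real^'n \<Rightarrow> real^'r \<Rightarrow> 'a::real_normed_vector \<Rightarrow> 'c::real_normed_vector) \<Rightarrow> bool" where
  "partial_lipschitz_with_growth T L D \<longleftrightarrow>
     (\<forall>t\<in>{0..T}.
        (\<forall>y1 y2 y1' y2' u1 u2. onorm (\<lambda>k. D t y1 y1' u1 k - D t y2 y2' u2 k)
            \<le> L * (norm (y1 - y2) + norm (y1' - y2') + norm (u1 - u2))) \<and>
        onorm (D t 0 0 0) \<le> L)"

definition smooth_data ::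
  "real \<Rightarrow> real \<Rightarrow> (real \<Rightarrow> real^'n \<Rightarrow> real^'n \<Rightarrow> real^'r \<Rightarrow> 'c::real_normed_vector) \<Rightarrow> bool" where
  "smooth_data T L d \<longleftrightarrow>
     (\<forall>t\<in>{0..T}. continuously_differentiable (\<lambda>(y, y', u). d t y y' u)) \<and>
     (\<forall>y y' u. (\<lambda>t. d t y y' u) \<in> borel_measurable (lebesgue_on {0..T})) \<and>
     partial_lipschitz_with_growth T L (deriv_state d) \<and>
     partial_lipschitz_with_growth T L (deriv_delayed d) \<and>
     partial_lipschitz_with_growth T L (deriv_control d)"

definition cond_C2 ::
  "real \<Rightarrow> (real \<Rightarrow> real^'n \<Rightarrow> real^'n \<Rightarrow> real^'r \<Rightarrow> real^'n) \<Rightarrow>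
   (real \<Rightarrow> real^'n \<Rightarrow> real^'n \<Rightarrow> real^'r \<Rightarrow> real) \<Rightarrow> bool" where
  "cond_C2 T f f0 \<longleftrightarrow> (\<exists>L1>0. smooth_data T L1 f \<and> smooth_data T L1 f0)"

definition cond_C3 :: "(real^'n \<Rightarrow> real) \<Rightarrow> bool" where
  "cond_C3 \<Phi> \<longleftrightarrow> continuously_differentiable \<Phi> \<and> bounded (range \<Phi>)"

definition cond_C4 :: "real \<Rightarrow> (real \<Rightarrow> (real^'r) set) \<Rightarrow> bool" where
  "cond_C4 T U \<longleftrightarrow> (\<forall>t\<in>{0..T}. U t \<noteq> {} \<and> compact (U t)) \<and> compact_family (U ` {0..T})"


section \<open>Hamiltonian and conjugate problem\<close>

definition Hamiltonian ::
  "real \<Rightarrow> real \<Rightarrow> real \<Rightarrow> (real \<Rightarrow> real^'n \<Rightarrow> real^'n \<Rightarrow> real^'r \<Rightarrow> real^'n) \<Rightarrow>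
   (real \<Rightarrow> real^'n \<Rightarrow> real^'n \<Rightarrow> real^'r \<Rightarrow> real) \<Rightarrow>
   real \<Rightarrow> real^'n \<Rightarrow> real^'n \<Rightarrow> real^'r \<Rightarrow> real^'n \<Rightarrow> real" where
  "Hamiltonian \<alpha> \<beta> T f f0 t y yh u \<psi> =
     \<psi> \<bullet> f t y yh u - Gamma \<alpha> / Gamma \<beta> * (T - t) powr (\<beta> - \<alpha>) * f0 t y yh u"

definition H_y ::
  "real \<Rightarrow> real \<Rightarrow> real \<Rightarrow> (real \<Rightarrow> real^'n \<Rightarrow> real^'n \<Rightarrow> real^'r \<Rightarrow> real^'n) \<Rightarrow>
   (real \<Rightarrow> real^'n \<Rightarrow> real^'n \<Rightarrow> real^'r \<Rightarrow> real) \<Rightarrow>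
   real \<Rightarrow> real^'n \<Rightarrow> real^'n \<Rightarrow> real^'r \<Rightarrow> real^'n \<Rightarrow> real^'n" where
  "H_y \<alpha> \<beta> T f f0 t y yh u \<psi> = gradient (\<lambda>x. Hamiltonian \<alpha> \<beta> T f f0 t x yh u \<psi>) y"

definition H_yh ::
  "real \<Rightarrow> real \<Rightarrow> real \<Rightarrow> (real \<Rightarrow> real^'n \<Rightarrow> real^'n \<Rightarrow> real^'r \<Rightarrow> real^'n) \<Rightarrow>
   (real \<Rightarrow> real^'n \<Rightarrow> real^'n \<Rightarrow> real^'r \<Rightarrow> real) \<Rightarrow>
   real \<Rightarrow> real^'n \<Rightarrow> real^'n \<Rightarrow> real^'r \<Rightarrow> real^'n \<Rightarrow> real^'n" where
  "H_yh \<alpha> \<beta> T f f0 t y yh u \<psi> = gradient (\<lambda>x. Hamiltonian \<alpha> \<beta> T f f0 t y x u \<psi>) yh"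

text \<open>Being a solution includes the existence of the two integrals.  For \<open>t + h > T\<close> the set
  \<open>{t + h..T}\<close> is empty and the second integral is \<open>0\<close>.\<close>

definition conjugate_solution ::
  "real \<Rightarrow> real \<Rightarrow> real \<Rightarrow> real \<Rightarrow> (real \<Rightarrow> real^'n \<Rightarrow> real^'n \<Rightarrow> real^'r \<Rightarrow> real^'n) \<Rightarrow>
   (real \<Rightarrow> real^'n \<Rightarrow> real^'n \<Rightarrow> real^'r \<Rightarrow> real) \<Rightarrow> (real^'n \<Rightarrow> real) \<Rightarrow>
   (real \<Rightarrow> real^'r) \<Rightarrow> (real \<Rightarrow> real^'n) \<Rightarrow> (real \<Rightarrow> real^'n) \<Rightarrow> bool" where
  "conjugate_solution \<alpha> \<beta> T h f f0 \<Phi> u y \<Psi> \<longleftrightarrow>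
     (\<forall>t\<in>{T<..T+h}. \<Psi> t = 0) \<and>
     (\<forall>t\<in>{0..T}.
        let K1 = (\<lambda>\<tau>. ((T - \<tau>) powr (\<alpha> - 1) * (\<tau> - t) powr (\<alpha> - 1)) *\<^sub>R
                    H_y \<alpha> \<beta> T f f0 \<tau> (y \<tau>) (y (\<tau> - h)) (u \<tau>) (\<Psi> \<tau>));
            K2 = (\<lambda>\<tau>. ((T - \<tau>) powr (\<alpha> - 1) * (\<tau> - t - h) powr (\<alpha> - 1)) *\<^sub>R
                    H_yh \<alpha> \<beta> T f f0 \<tau> (y \<tau>) (y (\<tau> - h)) (u \<tau>) (\<Psi> \<tau>))
        in set_integrable lebesgue {t..T} K1 \<and>
           set_integrable lebesgue {t+h..T} K2 \<and>
           \<Psi> t = - gradient \<Phi> (y T)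
             + ((T - t) powr (1 - \<alpha>) / Gamma \<alpha>) *\<^sub>R set_lebesgue_integral lebesgue {t..T} K1
             + ((T - t) powr (1 - \<alpha>) / Gamma \<alpha>) *\<^sub>R set_lebesgue_integral lebesgue {t+h..T} K2)"

end

theory Submission
  imports Defs
begin

text \<open>
  Fix a control \<open>v\<close> and switch from the optimal \<open>u\<close> to \<open>v\<close> on a set \<open>E\<close> that carries the fraction
  \<open>\<epsilon>\<close> of the integrals of finitely many prescribed integrable functions.  Prescribing, besides the
  gain in the Hamiltonian, translates of the kernel of the fractional integral makes the fractional
  integral of \<open>indicator E\<close> uniformly \<open>O(\<epsilon>)\<close>, so that the state moves by \<open>\<delta> = O(\<epsilon>)\<close> in the
  supremum norm (short intervals would only give \<open>\<epsilon>\<^sup>\<alpha>\<close>).  The costate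
  \<open>(T - t)\<^sup>\<alpha>\<^sup>-\<^sup>1 \<Psi>(t) / \<Gamma>(\<alpha>)\<close> is merely integrable, which suffices: by the adjoint equation and
  Fubini, the terms of the cost difference linear in \<open>\<delta>\<close> cancel, and optimality yields
  \<open>\<epsilon> \<integral> gain \<le> o(\<epsilon>)\<close>.  Hence no control has positive integrated gain, and measurable selections
  near the points of a countable dense set turn this into the pointwise maximum condition.
\<close>

section \<open>Sets carrying a fixed fraction of given integrals\<close>

text \<open>No convexity of the control sets is assumed, so controls can only be switched, not
  averaged. The remainder of the linearisation is quadratic in \<delta>: a shift of order
  \<epsilon>^\<alpha> would leave \<epsilon>^(2\<alpha>), which is not o(\<epsilon>) for \<alpha>
  \<le> 1/2. Hence the scattered switching set. Exact fractions would amount to Lyapunov's convexity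
  theorem. A tolerance \<epsilon>^2 in the prescribed integrals is enough, and approximation by
  simple functions provides it. The linearisation is taken at the old control. Besides the square of
  \<delta> it therefore leaves a cross term of \<delta> with the change of control on
  \<open>E\<close>, multiplied by a costate that need not be bounded. Prescribing the integral of an
  integrable majorant as well makes this term O(\<epsilon>^2). The integrability that Fubini
  requires is contained in the adjoint equation at t = 0, so neither boundedness nor continuity of
  \<Psi> has to be established.\<close>

lemma exists_subset_measure_fraction:
  fixes A :: "real set"
  assumes A: "A \<in> sets lebesgue" "A \<subseteq> {a..b}" and e: "0 \<le> e" "e \<le> 1"
  shows "\<exists>B\<in>sets lebesgue. B \<subseteq> A \<and> measure lebesgue B = e * measure lebesgue A"
proof (cases "a \<le> b")
  case False
  then have "A = {}" using A by auto
  then show ?thesis by auto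
next
  case True
  let ?m = "\<lambda>t. measure lebesgue (A \<inter> {..t})"
  have lm: "A \<inter> X \<in> lmeasurable" if "X \<in> sets lebesgue" for X
    by (rule fmeasurableI2[of "{a..b}"]) (use A that in auto)
  have mono: "?m s \<le> ?m t" if "s \<le> t" for s t
    using that A by (intro measure_mono_fmeasurable lm) (auto intro: fmeasurableD)
  \<comment> \<open>With monotonicity this makes the truncated measure 1-Lipschitz in
    \<open>t\<close>, so the intermediate value theorem yields every fraction.\<close>
  have incr: "?m t \<le> ?m s + (t - s)" if "s \<le> t" for s t
  proof -
    have "?m t \<le> measure lebesgue ((A \<inter> {..s}) \<union> {s..t})"
      using that A by (intro measure_mono_fmeasurable fmeasurable.Un lm) (auto intro: fmeasurableD)
    also have "\<dots> \<le> ?m s + measure lebesgue {s..t}"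
      using A by (intro measure_Un_le) auto
    finally show ?thesis using that by simp
  qed
  have lip: "dist (?m t) (?m s) \<le> dist t s" for s t
    using mono[of s t] mono[of t s] incr[of s t] incr[of t s]
    by (cases "s \<le> t") (auto simp: dist_real_def)
  \<comment> \<open>Starting at \<open>a - 1\<close> instead of \<open>a\<close> makes the
    truncation empty, so the initial value is 0 at once.\<close>
  have cont: "continuous_on {a - 1..b} ?m"
    unfolding continuous_on_iff using lip by (meson le_less_trans)
  have "A \<inter> {..a - 1} = {}" "A \<inter> {..b} = A" using A by auto
  then have "?m (a - 1) \<le> e * measure lebesgue A" "e * measure lebesgue A \<le> ?m b"
    using e by (auto simp: mult_left_le_one_le)
  then obtain t where "?m t = e * measure lebesgue A"
    using IVT'[of ?m "a - 1" "e * measure lebesgue A" b] cont True by auto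
  then show ?thesis using A by (intro bexI[of _ "A \<inter> {..t}"]) auto
qed

text \<open>Bochner integrability is by definition the existence of such approximants; the work lies
  in passing from the extended to the real integral.\<close>

lemma simple_L1_approximation:
  fixes g :: "'a \<Rightarrow> real"
  assumes g: "integrable M g" and e: "0 < e"
  shows "\<exists>s. simple_function M s \<and> integrable M s \<and> (LINT x|M. \<bar>g x - s x\<bar>) < e"
proof -
  obtain x where "has_bochner_integral M g x" using g by (auto simp: integrable.simps)
  then obtain s where s: "\<And>i. Bochner_Integration.simple_bochner_integrable M (s i)"
    and lim: "(\<lambda>i. \<integral>\<^sup>+x. norm (g x - s i x) \<partial>M) \<longlonglongrightarrow> 0"
    by (rule has_bochner_integral.cases) blast
  from lim have "eventually (\<lambda>i. (\<integral>\<^sup>+x. norm (g x - s i x) \<partial>M) < ennreal e) sequentially"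
    by (rule order_tendstoD) (use e in simp)
  then obtain i where i: "(\<integral>\<^sup>+x. norm (g x - s i x) \<partial>M) < ennreal e"
    by (auto simp: eventually_sequentially)
  have sf: "simple_function M (s i)" and si: "integrable M (s i)"
    using s[of i] has_bochner_integral_simple_bochner_integrable[OF s[of i]]
    by (auto elim: simple_bochner_integrable.cases simp: integrable.simps)
  have "integrable M (\<lambda>x. \<bar>g x - s i x\<bar>)" using g si by auto
  then have "ennreal (LINT x|M. \<bar>g x - s i x\<bar>) < ennreal e"
    using i by (subst nn_integral_eq_integral[symmetric]) auto
  then show ?thesis using sf si e by (auto simp: ennreal_less_iff intro!: exI[of _ "s i"])
qed

text \<open>An approximate Lyapunov theorem. Where all simple approximants are constant, a piece
  with the fraction \<open>e\<close> of the measure has exactly the fraction \<open>e\<close> of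
  each of their integrals. Gluing such pieces over the finitely many level sets costs only the two
  L1 errors of at most \<open>\<eta> / 2\<close>, the second of them multiplied by
  \<open>e \<le> 1\<close>.\<close>

lemma exists_proportional_subset:
  fixes F :: "(real \<Rightarrow> real) set"
  assumes F: "finite F" "\<And>g. g \<in> F \<Longrightarrow> integrable lebesgue g"
    and e: "0 \<le> e" "e \<le> 1" and \<eta>: "0 < \<eta>"
  shows "\<exists>E\<in>sets lebesgue. E \<subseteq> {a..b} \<and>
     (\<forall>g\<in>F. \<bar>(LINT x|lebesgue. indicator E x * g x) - e * (LINT x|lebesgue. indicator {a..b} x * g x)\<bar> \<le> \<eta>)"
proof -
  have "\<forall>g\<in>F. \<exists>s. simple_function lebesgue s \<and> integrable lebesgue s \<and>
      (LINT x|lebesgue. \<bar>g x - s x\<bar>) < \<eta> / 2"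
    using F \<eta> by (intro ballI simple_L1_approximation) auto
  then obtain s where s: "\<And>g. g \<in> F \<Longrightarrow> simple_function lebesgue (s g)"
      "\<And>g. g \<in> F \<Longrightarrow> integrable lebesgue (s g)"
      "\<And>g. g \<in> F \<Longrightarrow> (LINT x|lebesgue. \<bar>g x - s g x\<bar>) < \<eta> / 2"
    by metis
  \<comment> \<open>The joint values attained on the interval. \<open>restrict\<close> places them
    in a finite extensional product and makes vectors that agree on \<open>F\<close> equal, so
    distinct members of \<open>V\<close> have disjoint level sets.\<close>
  define V where "V = (\<lambda>x. restrict (\<lambda>g. s g x) F) ` {a..b}"
  define A where "A w = {x\<in>{a..b}. \<forall>g\<in>F. s g x = w g}" for w
  have "V \<subseteq> (\<Pi>\<^sub>E g\<in>F. range (s g))" by (auto simp: V_def)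
  moreover have "finite (\<Pi>\<^sub>E g\<in>F. range (s g))"
    using F s(1) by (intro finite_PiE) (auto simp: simple_function_def)
  ultimately have finV: "finite V" by (rule finite_subset)
  have Am: "A w \<in> sets lebesgue" for w
  proof -
    have "{x \<in> space lebesgue. s g x = w g} \<in> sets lebesgue" if "g \<in> F" for g
    proof -
      have [measurable]: "s g \<in> borel_measurable lebesgue"
        using s(1)[OF that] by (rule borel_measurable_simple_function)
      show ?thesis by measurable
    qed
    note Cg = this
    have "A w = {a..b} \<inter> {x\<in>space lebesgue. \<forall>g\<in>F. s g x = w g}"
      by (auto simp: A_def)
    also have "\<dots> \<in> sets lebesgue"
      using F(1) by (intro sets.Int sets.sets_Collect_finite_All) (simp, erule Cg)
    finally show ?thesis .
  qed
  have Aab: "A w \<subseteq> {a..b}" for w by (auto simp: A_def)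
  have "\<forall>w. \<exists>B\<in>sets lebesgue. B \<subseteq> A w \<and> measure lebesgue B = e * measure lebesgue (A w)"
    by (intro allI exists_subset_measure_fraction[OF Am Aab e])
  then obtain B where B: "\<And>w. B w \<in> sets lebesgue" "\<And>w. B w \<subseteq> A w"
      "\<And>w. measure lebesgue (B w) = e * measure lebesgue (A w)" by metis
  define E where "E = (\<Union>w\<in>V. B w)"
  have E: "E \<in> sets lebesgue" "E \<subseteq> {a..b}"
  proof -
    show "E \<subseteq> {a..b}" using B(2) Aab unfolding E_def by blast
  qed (use finV B(1) in \<open>auto simp: E_def\<close>)
  have Adisj: "w = w'" if "x \<in> A w" "x \<in> A w'" "w \<in> V" "w' \<in> V" for x w w'
  proof
    fix g show "w g = w' g"
      using that by (cases "g \<in> F") (auto simp: A_def V_def)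
  qed
  have Acov: "\<exists>w\<in>V. x \<in> A w" if "x \<in> {a..b}" for x
    using that by (auto simp: A_def V_def)
  \<comment> \<open>Stated for arbitrary parts of the level sets, because it is applied both to the
    chosen pieces \<open>B\<close> and to the full level sets \<open>A\<close>.\<close>
  have sum_ind: "indicator (\<Union>w\<in>V. X w) x * s g x = (\<Sum>w\<in>V. w g * indicator (X w) x)"
    if X: "\<And>w. X w \<subseteq> A w" and g: "g \<in> F" for X x g
  proof (cases "x \<in> (\<Union>w\<in>V. X w)")
    case True
    then obtain w where w: "w \<in> V" "x \<in> X w" by auto
    have "(\<Sum>w\<in>V. w g * indicator (X w) x) = (\<Sum>w'\<in>V. if w' = w then w g else 0)"
    proof (intro sum.cong refl)
      fix w' assume "w' \<in> V"
      then have "x \<in> X w' \<longleftrightarrow> w' = w" using w X[of w] X[of w'] Adisj[of x w' w] by blast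
      then show "w' g * indicator (X w') x = (if w' = w then w g else 0)"
        by (auto simp: indicator_def)
    qed
    also have "\<dots> = s g x" using finV w X g by (auto simp: A_def subset_iff)
    finally show ?thesis using True by simp
  next
    case False
    then have "(\<Sum>w\<in>V. w g * indicator (X w) x) = 0" by (intro sum.neutral) auto
    then show ?thesis using False by simp
  qed
  have Xlm: "X \<in> lmeasurable" if "X \<in> sets lebesgue" "X \<subseteq> A w" for X w
    by (rule fmeasurableI2[of "{a..b}"]) (use that in \<open>auto simp: A_def\<close>)
  have int_ind: "(LINT x|lebesgue. indicator (\<Union>w\<in>V. X w) x * s g x) = (\<Sum>w\<in>V. w g * measure lebesgue (X w))"
    if X: "\<And>w. X w \<in> sets lebesgue" "\<And>w. X w \<subseteq> A w" and g: "g \<in> F" for X g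
  proof -
    have "integrable lebesgue (indicator (X w) :: real \<Rightarrow> real)" for w
      using Xlm[OF X, of w] by (intro integrable_real_indicator) (auto simp: fmeasurable_def simp del: emeasure_completion)
    then show ?thesis
      unfolding sum_ind[OF X(2) g] by (subst Bochner_Integration.integral_sum) auto
  qed
  have UA: "(\<Union>w\<in>V. A w) = {a..b}" using Acov by (auto simp: A_def)
  have "\<bar>(LINT x|lebesgue. indicator E x * g x) - e * (LINT x|lebesgue. indicator {a..b} x * g x)\<bar> \<le> \<eta>"
    if g: "g \<in> F" for g
  proof -
    have [measurable]: "g \<in> borel_measurable lebesgue" "s g \<in> borel_measurable lebesgue"
      using F(2)[OF g] s(2)[OF g] by auto
    have eq: "(LINT x|lebesgue. indicator E x * s g x) = e * (LINT x|lebesgue. indicator {a..b} x * s g x)"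
      unfolding E_def int_ind[OF B(1,2) g] int_ind[OF Am order_refl g, unfolded UA]
      by (simp add: B(3) sum_distrib_left mult_ac)
    have ii: "integrable lebesgue (\<lambda>x. indicator X x * k x)"
      if "X \<in> sets lebesgue" "integrable lebesgue k" for X and k :: "real \<Rightarrow> real"
      using integrable_mult_indicator[OF that] by simp
    have close: "\<bar>(LINT x|lebesgue. indicator X x * g x) - (LINT x|lebesgue. indicator X x * s g x)\<bar> \<le> \<eta> / 2"
      if X: "X \<in> sets lebesgue" for X
    proof -
      have "(LINT x|lebesgue. indicator X x * g x) - (LINT x|lebesgue. indicator X x * s g x)
        = (LINT x|lebesgue. indicator X x * (g x - s g x))"
        using ii[OF X F(2)[OF g]] ii[OF X s(2)[OF g]]
        by (subst Bochner_Integration.integral_diff[symmetric]) (auto simp: algebra_simps)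
      also have "\<bar>\<dots>\<bar> \<le> (LINT x|lebesgue. \<bar>indicator X x * (g x - s g x)\<bar>)"
        by (rule integral_abs_bound)
      also have "\<dots> \<le> (LINT x|lebesgue. \<bar>g x - s g x\<bar>)"
        using F(2)[OF g] s(2)[OF g] X
        by (intro integral_mono integrable_abs ii) (auto simp: indicator_def)
      finally show ?thesis using s(3)[OF g] by simp
    qed
    have ab: "{a..b} \<in> sets lebesgue" by simp
    let ?d = "(LINT x|lebesgue. indicator {a..b} x * g x) - (LINT x|lebesgue. indicator {a..b} x * s g x)"
    have "\<bar>e * ?d\<bar> \<le> 1 * (\<eta> / 2)"
      unfolding abs_mult using e close[OF ab] by (intro mult_mono) auto
    then have "\<bar>e * (LINT x|lebesgue. indicator {a..b} x * g x) - e * (LINT x|lebesgue. indicator {a..b} x * s g x)\<bar> \<le> \<eta> / 2"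
      by (simp add: algebra_simps)
    then show ?thesis using close[OF E(1)] eq by linarith
  qed
  then show ?thesis using E by auto
qed

section \<open>The Riemann--Liouville kernel\<close>

text \<open>Allows Fubini to be applied to completed Lebesgue measure itself; the data of the
  problem are Lebesgue but not necessarily Borel measurable in time.\<close>

lemma sigma_finite_lebesgue: "sigma_finite_measure (lebesgue :: 'a::euclidean_space measure)"
proof
  show "\<exists>A::'a set set. countable A \<and> A \<subseteq> sets lebesgue \<and> \<Union> A = space lebesgue \<and>
      (\<forall>a\<in>A. emeasure lebesgue a \<noteq> \<infinity>)"
    using UN_box_eq_UNIV
    by (intro exI[of _ "range (\<lambda>n::nat. box (- (real n *\<^sub>R One)) (real n *\<^sub>R One))"])
       (auto simp: emeasure_lborel_box_eq)
qed

interpretation leb: sigma_finite_measure "lebesgue :: 'a::euclidean_space measure"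
  by (rule sigma_finite_lebesgue)

interpretation leb_pair: pair_sigma_finite "lebesgue :: 'a::euclidean_space measure"
  "lebesgue :: 'b::euclidean_space measure" ..

text \<open>The extension by 0 turns fractional integrals into convolutions over the whole line,
  without a domain of integration that depends on \<open>t\<close>.\<close>

definition rl_kernel :: "real \<Rightarrow> real \<Rightarrow> real" where
  "rl_kernel a s = (if 0 < s then s powr (a - 1) else 0)"

lemma rl_kernel_measurable [measurable]: "rl_kernel a \<in> borel_measurable borel"
  unfolding rl_kernel_def[abs_def] by measurable

lemma rl_kernel_nonneg [simp]: "0 \<le> rl_kernel a s"
  by (simp add: rl_kernel_def)

lemma rl_kernel_antimono: "a \<le> 1 \<Longrightarrow> 0 < r \<Longrightarrow> r \<le> s \<Longrightarrow> rl_kernel a s \<le> rl_kernel a r"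
  by (simp add: rl_kernel_def powr_mono2')

lemma has_bochner_integral_rl_kernel:
  assumes "0 < a" "0 \<le> b"
  shows "has_bochner_integral lebesgue (\<lambda>s. rl_kernel a s * indicator {..b} s) (b powr a / a)"
proof -
  have *: "((\<lambda>s. s powr (a - 1)) has_integral (b powr a / a)) {0..b}"
    using has_integral_powr_from_0[of "a - 1" b] assms by simp
  then have ai: "(\<lambda>s. s powr (a - 1)) absolutely_integrable_on {0..b}"
    by (intro nonnegative_absolutely_integrable_1) auto
  have "(LINT s:{0..b}|lebesgue. s powr (a - 1)) = b powr a / a"
    using set_lebesgue_integral_eq_integral(2)[OF ai] * by (simp add: integral_unique)
  moreover have "(\<lambda>s. rl_kernel a s * indicator {..b} s) = (\<lambda>s. indicator {0..b} s *\<^sub>R s powr (a - 1))"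
    by (auto simp: rl_kernel_def indicator_def fun_eq_iff)
  ultimately show ?thesis
    using ai by (simp add: has_bochner_integral_iff set_lebesgue_integral_def set_integrable_def)
qed

text \<open>The substitution \<tau> = t - r. The maximum lets one formula cover \<open>t < s\<close>
  too, where the integrand vanishes.\<close>

lemma has_bochner_integral_rl_kernel_reflect:
  assumes "0 < a"
  shows "has_bochner_integral lebesgue (\<lambda>\<tau>. rl_kernel a (t - \<tau>) * indicator {s..} \<tau>)
     (max 0 (t - s) powr a / a)"
proof (cases "s \<le> t")
  case True
  have "has_bochner_integral lebesgue (\<lambda>r. rl_kernel a r * indicator {..t - s} r) ((t - s) powr a / a)"
    using assms True by (intro has_bochner_integral_rl_kernel) auto
  from iffD1[OF has_bochner_integral_lebesgue_real_affine_iff[of "-1" _ _ t] this]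
  have "has_bochner_integral lebesgue
      (\<lambda>x. rl_kernel a (t - x) * indicator {..t - s} (t - x)) ((t - s) powr a / a)" by simp
  moreover have "(\<lambda>x. rl_kernel a (t - x) * indicator {..t - s} (t - x)) =
      (\<lambda>x. rl_kernel a (t - x) * indicator {s..} x)"
    by (auto simp: indicator_def fun_eq_iff)
  ultimately show ?thesis using True by (simp add: max_def)
next
  case False
  then have "(\<lambda>\<tau>. rl_kernel a (t - \<tau>) * indicator {s..} \<tau>) = (\<lambda>_. 0)"
    by (auto simp: rl_kernel_def indicator_def fun_eq_iff)
  then show ?thesis using False by (simp add: max_def has_bochner_integral_zero)
qed

lemma rl_kernel_shift_measurable [measurable]:
  "(\<lambda>\<tau>. rl_kernel a (t - \<tau>)) \<in> borel_measurable lebesgue"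
  by (rule measurable_completion) measurable

text \<open>A cut-off on the left is enough, since the kernel vanishes to the right of
  \<open>t\<close>. The bound is only almost everywhere because a Caputo derivative is only
  essentially bounded.\<close>

lemma integrable_rl_kernel_AE_bounded:
  fixes g :: "real \<Rightarrow> 'b::{banach,second_countable_topology}"
  assumes a: "0 < a" and g: "g \<in> borel_measurable lebesgue" "AE \<tau> in lebesgue. norm (g \<tau>) \<le> B * indicator {s..} \<tau>"
  shows "integrable lebesgue (\<lambda>\<tau>. rl_kernel a (t - \<tau>) *\<^sub>R g \<tau>)"
proof (rule Bochner_Integration.integrable_bound)
  show "integrable lebesgue (\<lambda>\<tau>. B * (rl_kernel a (t - \<tau>) * indicator {s..} \<tau>))"
    using has_bochner_integral_rl_kernel_reflect[OF a, of t s]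
    by (intro integrable_mult_right) (auto simp: has_bochner_integral_iff)
  show "(\<lambda>\<tau>. rl_kernel a (t - \<tau>) *\<^sub>R g \<tau>) \<in> borel_measurable lebesgue"
    using g(1) by measurable
  show "AE \<tau> in lebesgue. norm (rl_kernel a (t - \<tau>) *\<^sub>R g \<tau>) \<le> norm (B * (rl_kernel a (t - \<tau>) * indicator {s..} \<tau>))"
    using g(2)
  proof eventually_elim
    case (elim \<tau>)
    have "rl_kernel a (t - \<tau>) * norm (g \<tau>) \<le> rl_kernel a (t - \<tau>) * (B * indicator {s..} \<tau>)"
      by (intro mult_left_mono elim) simp
    also have "\<dots> = B * (rl_kernel a (t - \<tau>) * indicator {s..} \<tau>)" by simp
    also have "\<dots> \<le> norm (B * (rl_kernel a (t - \<tau>) * indicator {s..} \<tau>))"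
      by (simp only: real_norm_def abs_ge_self)
    finally show ?case by simp
  qed
qed


lemma integrable_rl_kernel_bounded:
  fixes g :: "real \<Rightarrow> 'b::{banach,second_countable_topology}"
  assumes "0 < a" "g \<in> borel_measurable lebesgue"
    and "\<And>\<tau>. norm (g \<tau>) \<le> B * indicator {s..} \<tau>"
  shows "integrable lebesgue (\<lambda>\<tau>. rl_kernel a (t - \<tau>) *\<^sub>R g \<tau>)"
  using assms by (intro integrable_rl_kernel_AE_bounded[where B=B and s=s]) auto

lemma set_integral_eq_rl_convolution:
  fixes g :: "real \<Rightarrow> 'b::{banach,second_countable_topology}"
  assumes "t \<le> T"
  shows "set_lebesgue_integral lebesgue {0..t} (\<lambda>\<tau>. (t - \<tau>) powr (a - 1) *\<^sub>R g \<tau>)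
    = (LINT \<tau>|lebesgue. rl_kernel a (t - \<tau>) *\<^sub>R (indicator {0..T} \<tau> *\<^sub>R g \<tau>))"
proof -
  \<comment> \<open>Equality holds at every point: at \<tau> = t both sides vanish, because
    \<open>0 powr (a - 1) = 0\<close>.\<close>
  have "indicator {0..t} \<tau> *\<^sub>R (t - \<tau>) powr (a - 1) *\<^sub>R g \<tau> = rl_kernel a (t - \<tau>) *\<^sub>R (indicator {0..T} \<tau> *\<^sub>R g \<tau>)" for \<tau>
    using assms by (cases "\<tau> = t") (auto simp: rl_kernel_def indicator_def)
  then show ?thesis
    unfolding set_lebesgue_integral_def by (intro Bochner_Integration.integral_cong refl)
qed

text \<open>The Bielecki weight. After the substitution s = t - \<tau>, the quotient by exp(l t) is
  at most the integral of the truncated kernel against exp(- l s), which tends to 0 as l grows, by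
  dominated convergence.\<close>

lemma rl_kernel_exp_weight:
  assumes "0 < a" "0 < T" "0 < \<kappa>"
  shows "\<exists>l>0. \<forall>t\<le>T. (LINT \<tau>|lebesgue. rl_kernel a (t - \<tau>) * (indicator {0..T} \<tau> * exp (l * \<tau>)))
            \<le> \<kappa> * exp (l * t)"
proof -
  \<comment> \<open>From \<tau> \<ge> 0 and t \<le> T it follows that t - \<tau> \<le> T, so
    truncating at \<open>T\<close> loses nothing and makes the kernel integrable.\<close>
  let ?K = "\<lambda>s. rl_kernel a s * indicator {..T} s"
  have intK: "integrable lebesgue ?K"
    using has_bochner_integral_rl_kernel[of a T] assms by (simp add: has_bochner_integral_iff)
  have [measurable]: "rl_kernel a \<in> borel_measurable lebesgue"
    by (rule measurable_completion) measurable
  have [measurable]: "(\<lambda>s. exp (- real n * s)) \<in> borel_measurable lebesgue" for n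
    by (rule measurable_completion) measurable
  have lim: "(\<lambda>n. LINT s|lebesgue. ?K s * exp (- real n * s)) \<longlonglongrightarrow> (LINT s|(lebesgue::real measure). 0)"
  proof (rule integral_dominated_convergence[where w="?K"])
    show "AE s in lebesgue. (\<lambda>n. ?K s * exp (- real n * s)) \<longlonglongrightarrow> 0"
    proof (intro always_eventually allI)
      fix s show "(\<lambda>n. ?K s * exp (- real n * s)) \<longlonglongrightarrow> 0"
      proof (cases "0 < s")
        case True
        have "(\<lambda>n. exp (- s) ^ n) \<longlonglongrightarrow> 0"
          by (rule LIMSEQ_realpow_zero) (use True in auto)
        then have "(\<lambda>n. exp (- real n * s)) \<longlonglongrightarrow> 0"
          by (simp add: exp_of_nat_mult[symmetric])
        then show ?thesis by (rule tendsto_mult_right_zero)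
      qed (simp add: rl_kernel_def)
    qed
    show "AE s in lebesgue. norm (?K s * exp (- real n * s)) \<le> ?K s" for n
      by (intro always_eventually allI) (auto simp: rl_kernel_def indicator_def)
  qed (use intK in measurable)
  then have "eventually (\<lambda>n. (LINT s|lebesgue. ?K s * exp (- real n * s)) < \<kappa>) sequentially"
    using assms by (intro order_tendstoD) auto
  then obtain n0 where "\<And>n. n \<ge> n0 \<Longrightarrow> (LINT s|lebesgue. ?K s * exp (- real n * s)) < \<kappa>"
    by (auto simp: eventually_sequentially)
  then obtain n where n: "(LINT s|lebesgue. ?K s * exp (- real n * s)) < \<kappa>" "n > 0"
    by (metis less_Suc_eq le_eq_less_or_eq gr0I lessI not_less0 zero_less_Suc)
  show ?thesis
  proof (intro exI[of _ "real n"] conjI allI impI)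
    fix t assume t: "t \<le> T"
    have i1: "integrable lebesgue (\<lambda>s. ?K s * exp (- real n * s))"
    proof (rule Bochner_Integration.integrable_bound[OF intK])
      show "(\<lambda>s. ?K s * exp (- real n * s)) \<in> borel_measurable lebesgue"
        by (rule measurable_completion) measurable
      show "AE s in lebesgue. norm (?K s * exp (- real n * s)) \<le> norm (?K s)"
        by (auto simp: rl_kernel_def indicator_def)
    qed
    have i2: "integrable lebesgue (\<lambda>s. exp (real n * t) * (rl_kernel a s * exp (- real n * s) * indicator {0..T} (t - s)))"
    proof (rule integrable_mult_right, rule Bochner_Integration.integrable_bound[OF i1])
      show "(\<lambda>s. rl_kernel a s * exp (- real n * s) * indicator {0..T} (t - s)) \<in> borel_measurable lebesgue"
        by (rule measurable_completion) measurable
    qed (use t in \<open>auto simp: rl_kernel_def indicator_def\<close>)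
    have "(LINT \<tau>|lebesgue. rl_kernel a (t - \<tau>) * (indicator {0..T} \<tau> * exp (real n * \<tau>)))
      = (LINT s|lebesgue. exp (real n * t) * (rl_kernel a s * exp (- real n * s) * indicator {0..T} (t - s)))"
      by (subst lebesgue_integral_real_affine[of "-1" _ t])
         (auto simp: algebra_simps exp_diff exp_minus field_simps)
    also have "\<dots> \<le> (LINT s|lebesgue. exp (real n * t) * (?K s * exp (- real n * s)))"
      using t by (intro integral_mono i2 integrable_mult_right i1)
         (auto simp: rl_kernel_def indicator_def)
    also have "\<dots> = exp (real n * t) * (LINT s|lebesgue. ?K s * exp (- real n * s))" by simp
    also have "\<dots> \<le> exp (real n * t) * \<kappa>"
      using n by (intro mult_left_mono) auto
    finally show "(LINT \<tau>|lebesgue. rl_kernel a (t - \<tau>) * (indicator {0..T} \<tau> * exp (real n * \<tau>)))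
       \<le> \<kappa> * exp (real n * t)" by (simp add: mult.commute)
  qed (use n in simp)
qed

text \<open>The constant has three sources: the kernel over the whole interval integrates to at most
  \<open>T powr a / a\<close>, the tolerance of the prescribed integrals adds one \<open>e\<close>,
  and the discretisation in \<open>t\<close> another.\<close>

lemma exists_spread_set:
  fixes F :: "(real \<Rightarrow> real) set"
  assumes a: "0 < a" "a < 1" and T: "0 < T"
    and F: "finite F" "\<And>g. g \<in> F \<Longrightarrow> integrable lebesgue g"
    and e: "0 < e" "e \<le> 1" and \<eta>: "0 < \<eta>"
  shows "\<exists>E\<in>sets lebesgue. E \<subseteq> {0..T} \<and>
     (\<forall>g\<in>F. \<bar>(LINT x|lebesgue. indicator E x * g x) - e * (LINT x|lebesgue. indicator {0..T} x * g x)\<bar> \<le> \<eta>) \<and>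
     (\<forall>t\<le>T. (LINT \<tau>|lebesgue. rl_kernel a (t - \<tau>) * indicator E \<tau>) \<le> (T powr a / a + 2) * e)"
proof -
  \<comment> \<open>The grid is chosen so fine that the singular part of the kernel over one cell
    integrates to less than \<open>e\<close>.\<close>
  have "(\<lambda>n. (T / real (Suc n)) powr a / a) \<longlonglongrightarrow> 0 powr a / a"
    using a T by (intro tendsto_intros tendsto_powr' LIMSEQ_Suc[OF lim_const_over_n]) auto
  then have "eventually (\<lambda>n. (T / real (Suc n)) powr a / a < e) sequentially"
    by (rule order_tendstoD) (use e in simp)
  then obtain n where n: "(T / real (Suc n)) powr a / a < e"
    by (auto simp: eventually_sequentially)
  text \<open>As the kernel is decreasing, the convolution exceeds its value at the preceding grid point by
    at most \<open>d powr a / a\<close>, so finitely many prescribed integrals control it for all \<open>t\<close>.\<close>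
  define d where "d = T / real (Suc n)"
  have d: "0 < d" using T by (simp add: d_def)
  define k where "k j = (\<lambda>\<tau>. rl_kernel a (real j * d - \<tau>) * indicator {0..} \<tau>)" for j :: nat
  have kint: "integrable lebesgue (k j)" "integral\<^sup>L lebesgue (k j) = max 0 (real j * d) powr a / a" for j
    using has_bochner_integral_rl_kernel_reflect[OF a(1), of "real j * d" 0]
    by (auto simp: k_def has_bochner_integral_iff)
  have "\<exists>E\<in>sets lebesgue. E \<subseteq> {0..T} \<and>
     (\<forall>g\<in>F \<union> k ` {..Suc n}. \<bar>(LINT x|lebesgue. indicator E x * g x)
        - e * (LINT x|lebesgue. indicator {0..T} x * g x)\<bar> \<le> min \<eta> e)"
    using F e \<eta> kint by (intro exists_proportional_subset) auto
  then obtain E where E: "E \<in> sets lebesgue" "E \<subseteq> {0..T}"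
    and Eg: "\<And>g. g \<in> F \<union> k ` {..Suc n} \<Longrightarrow> \<bar>(LINT x|lebesgue. indicator E x * g x)
        - e * (LINT x|lebesgue. indicator {0..T} x * g x)\<bar> \<le> min \<eta> e"
    by blast
  note [measurable] = E(1)
  have kE: "(LINT \<tau>|lebesgue. indicator E \<tau> * k j \<tau>) \<le> (T powr a / a + 1) * e" if "j \<le> Suc n" for j
  proof -
    have "real j * d \<le> real (Suc n) * d" using that d by (intro mult_right_mono) auto
    then have jd: "real j * d \<le> T" by (simp add: d_def)
    have "(LINT \<tau>|lebesgue. indicator {0..T} \<tau> * k j \<tau>) \<le> integral\<^sup>L lebesgue (k j)"
    proof (intro integral_mono kint)
      show "integrable lebesgue (\<lambda>\<tau>. indicator {0..T} \<tau> * k j \<tau>)"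
        using integrable_mult_indicator[OF _ kint(1), of "{0..T}" j] by simp
    qed (auto simp: k_def indicator_def)
    also have "\<dots> \<le> T powr a / a"
      using jd T a d by (auto simp: kint intro!: divide_right_mono powr_mono2)
    finally have "e * (LINT \<tau>|lebesgue. indicator {0..T} \<tau> * k j \<tau>) \<le> e * (T powr a / a)"
      using e by (intro mult_left_mono) auto
    moreover have "(LINT \<tau>|lebesgue. indicator E \<tau> * k j \<tau>) - e * (LINT x|lebesgue. indicator {0..T} x * k j x) \<le> e"
      using Eg[of "k j"] that by (auto simp: abs_le_iff)
    ultimately show ?thesis by (simp add: algebra_simps)
  qed
  have "(LINT \<tau>|lebesgue. rl_kernel a (t - \<tau>) * indicator E \<tau>) \<le> (T powr a / a + 2) * e"
    if t: "t \<le> T" for t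
  proof (cases "t < 0")
    case True
    then have "(\<lambda>\<tau>. rl_kernel a (t - \<tau>) * indicator E \<tau>) = (\<lambda>_. 0)"
      using E(2) by (auto simp: rl_kernel_def indicator_def fun_eq_iff)
    then show ?thesis using e T a by (simp add: add_nonneg_nonneg)
  next
    case False
    \<comment> \<open>For \<open>t = T\<close> this index is \<open>Suc n\<close>, which is why the
      prescribed kernels run up to \<open>Suc n\<close> inclusive.\<close>
    define j where "j = nat \<lfloor>t / d\<rfloor>"
    have td: "0 \<le> t / d" using False d by simp
    have j1: "real j \<le> t / d" "t / d < real j + 1"
      unfolding j_def using td by linarith+
    then have j2: "real j * d \<le> t" "t \<le> real j * d + d"
      using d by (auto simp: field_simps)
    have "t / d \<le> T / d" using t d by (intro divide_right_mono) auto
    also have "\<dots> = real (Suc n)" using T by (simp add: d_def)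
    finally have "t / d \<le> real (Suc n)" .
    then have j: "j \<le> Suc n" using j1 by linarith
    let ?R = "\<lambda>\<tau>. rl_kernel a (t - \<tau>) * indicator {real j * d..} \<tau>"
    have R: "integrable lebesgue ?R" "integral\<^sup>L lebesgue ?R = (t - real j * d) powr a / a"
      using has_bochner_integral_rl_kernel_reflect[OF a(1), of t "real j * d"] j2
      by (auto simp: has_bochner_integral_iff)
    have kEi: "integrable lebesgue (\<lambda>\<tau>. indicator E \<tau> * k j \<tau>)"
      using integrable_mult_indicator[OF E(1) kint(1)] by simp
    have "integrable lebesgue (\<lambda>\<tau>. rl_kernel a (t - \<tau>) *\<^sub>R (indicator E \<tau> :: real))"
      using E by (intro integrable_rl_kernel_bounded[where B=1 and s=0] a) (auto simp: indicator_def)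
    then have "(LINT \<tau>|lebesgue. rl_kernel a (t - \<tau>) * indicator E \<tau>)
      \<le> (LINT \<tau>|lebesgue. indicator E \<tau> * k j \<tau> + ?R \<tau>)"
    proof (intro integral_mono Bochner_Integration.integrable_add kEi R)
      fix \<tau> :: real
      show "rl_kernel a (t - \<tau>) * indicator E \<tau> \<le> indicator E \<tau> * k j \<tau> + ?R \<tau>"
      proof (cases "\<tau> < real j * d \<and> \<tau> \<in> E")
        case True
        then have "rl_kernel a (t - \<tau>) \<le> rl_kernel a (real j * d - \<tau>)"
          using j2 a by (intro rl_kernel_antimono) auto
        then show ?thesis using True E by (auto simp: k_def)
      qed (auto simp: k_def indicator_def)
    qed simp
    also have "\<dots> = (LINT \<tau>|lebesgue. indicator E \<tau> * k j \<tau>) + (t - real j * d) powr a / a"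
      using kEi R by simp
    also have "\<dots> \<le> (T powr a / a + 1) * e + d powr a / a"
      using kE[OF j] j2 a by (intro add_mono divide_right_mono powr_mono2) auto
    also have "\<dots> \<le> (T powr a / a + 2) * e" using n by (simp add: d_def algebra_simps)
    finally show ?thesis .
  qed
  then show ?thesis using E Eg by (intro bexI[of _ E]) auto
qed

section \<open>A fractional integral equation with delay\<close>

text \<open>The kernel is Borel, so it suffices to regard the two coordinates on the product of
  completed measures as Borel-measurable real functions.\<close>

lemma rl_kernel_prod_measurable [measurable]:
  "(\<lambda>(t, \<tau>). rl_kernel a (t - \<tau>)) \<in> borel_measurable (lebesgue \<Otimes>\<^sub>M lebesgue)"
proof -
  have [measurable]: "fst \<in> borel_measurable (lebesgue \<Otimes>\<^sub>M (lebesgue :: real measure))"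
     "snd \<in> borel_measurable ((lebesgue :: real measure) \<Otimes>\<^sub>M lebesgue)"
    using measurable_compose[OF measurable_fst measurable_completion[of "\<lambda>x. x" lborel borel]]
      measurable_compose[OF measurable_snd measurable_completion[of "\<lambda>x. x" lborel borel]] by auto
  show ?thesis unfolding split_beta' by measurable
qed

lemma rl_convolution_measurable [measurable]:
  fixes g :: "real \<Rightarrow> 'b::{banach,second_countable_topology}"
  assumes [measurable]: "g \<in> borel_measurable lebesgue"
  shows "(\<lambda>t. LINT \<tau>|lebesgue. rl_kernel a (t - \<tau>) *\<^sub>R g \<tau>) \<in> borel_measurable lebesgue"
proof -
  have [measurable]: "(\<lambda>(t, \<tau>). rl_kernel a (t - \<tau>) *\<^sub>R g \<tau>) \<in> borel_measurable (lebesgue \<Otimes>\<^sub>M lebesgue)"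
    using rl_kernel_prod_measurable[of a] unfolding split_beta' by measurable
  show ?thesis by (rule leb.borel_measurable_lebesgue_integral) measurable
qed

text \<open>This is what leaves the initial value and the initial function untouched when the state
  is perturbed.\<close>

lemma rl_convolution_nonpos:
  assumes "\<And>\<tau>. \<tau> < 0 \<Longrightarrow> g \<tau> = 0" "t \<le> 0"
  shows "(LINT \<tau>|lebesgue. rl_kernel a (t - \<tau>) *\<^sub>R g \<tau>) = 0"
proof -
  have "rl_kernel a (t - \<tau>) *\<^sub>R g \<tau> = 0" for \<tau>
    using assms by (cases "\<tau> < 0") (auto simp: rl_kernel_def)
  then have "(LINT \<tau>|lebesgue. rl_kernel a (t - \<tau>) *\<^sub>R g \<tau>) = (LINT \<tau>|(lebesgue::real measure). 0)"
    by (intro Bochner_Integration.integral_cong refl)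
  then show ?thesis by simp
qed

text \<open>Composition does not preserve Lebesgue measurability in general; it does so for
  translations, which pull Lebesgue sets back to Lebesgue sets.\<close>

lemma measurable_shift_lebesgue:
  fixes d :: "real \<Rightarrow> 'b::real_normed_vector"
  assumes "d \<in> borel_measurable lebesgue"
  shows "(\<lambda>t. d (t - h)) \<in> borel_measurable lebesgue"
proof -
  have "(\<lambda>t::real. - h + (\<Sum>j\<in>Basis. (1 * (t \<bullet> j)) *\<^sub>R j)) \<in> lebesgue \<rightarrow>\<^sub>M lebesgue"
    by (rule lebesgue_affine_measurable) auto
  then have "(\<lambda>t::real. t - h) \<in> lebesgue \<rightarrow>\<^sub>M lebesgue" by simp
  from measurable_compose[OF this assms] show ?thesis .
qed

text \<open>Picard iteration; by \<open>weight\<close> the iteration map contracts by \<open>1/2\<close> in the norm with weight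
  \<open>exp (- l t)\<close>.\<close>

lemma fractional_delay_equation:
  fixes G :: "real \<Rightarrow> 'a::euclidean_space \<Rightarrow> 'a \<Rightarrow> 'a"
  assumes a: "0 < a" and T: "0 < T" and h: "0 < h" and L: "0 < L" and l: "0 < l" and c: "0 \<le> c"
    and weight: "\<And>t. t \<le> T \<Longrightarrow> (LINT \<tau>|lebesgue. rl_kernel a (t - \<tau>) * (indicator {0..T} \<tau> * exp (l * \<tau>)))
            \<le> Gamma a / (4 * L) * exp (l * t)"
    and lip: "\<And>t x x' z z'. t \<in> {0..T} \<Longrightarrow> norm (G t x x' - G t z z') \<le> L * (norm (x - z) + norm (x' - z'))"
    and meas: "\<And>d1 d2. d1 \<in> borel_measurable lebesgue \<Longrightarrow> d2 \<in> borel_measurable lebesgue \<Longrightarrow>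
        (\<lambda>t. indicator {0..T} t *\<^sub>R G t (d1 t) (d2 t)) \<in> borel_measurable lebesgue"
    and E: "E \<in> sets lebesgue" "E \<subseteq> {0..T}"
    and base: "\<And>t. t \<in> {0..T} \<Longrightarrow> norm (G t 0 0) \<le> c * indicator E t"
    and K: "\<And>t. t \<le> T \<Longrightarrow> (LINT \<tau>|lebesgue. rl_kernel a (t - \<tau>) * indicator E \<tau>) \<le> K"
  shows "\<exists>d. d \<in> borel_measurable lebesgue \<and>
     (\<forall>t\<le>T. d t = (1 / Gamma a) *\<^sub>R
        (LINT \<tau>|lebesgue. rl_kernel a (t - \<tau>) *\<^sub>R (indicator {0..T} \<tau> *\<^sub>R G \<tau> (d \<tau>) (d (\<tau> - h))))) \<and>
     (\<forall>t\<le>T. norm (d t) \<le> 2 * c * K / Gamma a * exp (l * T))"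
proof -
  have Ga: "0 < Gamma a" using a by (rule Gamma_real_pos)
  have K0: "0 \<le> K"
    by (rule order_trans[OF _ K[of 0]]) (use T in \<open>auto intro!: integral_nonneg\<close>)
  define X where "X d \<tau> = indicator {0..T} \<tau> *\<^sub>R G \<tau> (d \<tau>) (d (\<tau> - h))" for d \<tau>
  define N where "N d t = (1 / Gamma a) *\<^sub>R (LINT \<tau>|lebesgue. rl_kernel a (t - \<tau>) *\<^sub>R X d \<tau>)" for d t
  \<comment> \<open>Twice the bound for the first iterate: as the map contracts by 1/2, the ball of
    radius \<open>M\<close> in the weighted norm is mapped into itself.\<close>
  define M where "M = 2 * c * K / Gamma a"
  have M0: "0 \<le> M" using c K0 Ga by (simp add: M_def)
  define good where "good d \<longleftrightarrow> d \<in> borel_measurable lebesgue \<and> (\<forall>t\<le>T. norm (d t) \<le> M * exp (l * t))" for d :: "real \<Rightarrow> 'a"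
  have Xm: "X d \<in> borel_measurable lebesgue" if "good d" for d
    unfolding X_def using that by (intro meas measurable_shift_lebesgue) (auto simp: good_def)
  \<comment> \<open>A crude unweighted bound, serving integrability and domination only; it does not
    enter the final estimate.\<close>
  define B where "B = L * (2 * M * exp (l * T)) + c"
  have Xb: "norm (X d \<tau>) \<le> B * indicator {0..} \<tau>" if "good d" for d \<tau>
  proof (cases "\<tau> \<in> {0..T}")
    case True
    have e: "norm (d s) \<le> M * exp (l * T)" if "s \<le> T" for s
      using \<open>good d\<close> that M0 l unfolding good_def
      by (meson order_trans mult_left_mono exp_le_cancel_iff less_imp_le)
    have "norm (G \<tau> (d \<tau>) (d (\<tau> - h))) \<le> norm (G \<tau> (d \<tau>) (d (\<tau> - h)) - G \<tau> 0 0) + norm (G \<tau> 0 0)"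
      using norm_triangle_sub by (simp add: add.commute)
    also have "\<dots> \<le> L * (norm (d \<tau>) + norm (d (\<tau> - h))) + c"
      using lip[OF True, of "d \<tau>" "d (\<tau> - h)" 0 0] base[OF True] c
      by (cases "\<tau> \<in> E"; intro add_mono; simp)
    also have "\<dots> \<le> B"
      unfolding B_def using e[of \<tau>] e[of "\<tau> - h"] True h L
      by (intro add_mono mult_left_mono) auto
    finally show ?thesis using True by (simp add: X_def)
  qed (auto simp: X_def indicator_def B_def c L M0 less_imp_le)
  have Xi: "integrable lebesgue (\<lambda>\<tau>. rl_kernel a (t - \<tau>) *\<^sub>R X d \<tau>)" if "good d" for d t
    using integrable_rl_kernel_bounded[OF a Xm[OF that] Xb[OF that]] .
  \<comment> \<open>The delayed argument is no worse than the present one, as the weight increases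
    in time. The two arguments give the factor \<open>2 * L\<close>, which \<open>weight\<close>
    reduces to 1/2.\<close>
  have contr: "norm (N d t - N d' t) \<le> b / 2 * exp (l * t)"
    if g: "good d" "good d'" and b: "\<And>t. t \<le> T \<Longrightarrow> norm (d t - d' t) \<le> b * exp (l * t)" and t: "t \<le> T" for d d' b t
  proof -
    have b0: "0 \<le> b" using order_trans[OF norm_ge_zero b[of 0]] T by simp
    have i2: "integrable lebesgue (\<lambda>\<tau>. rl_kernel a (t - \<tau>) *\<^sub>R (indicator {0..T} \<tau> * exp (l * \<tau>)))"
    proof (rule integrable_rl_kernel_bounded[OF a, where B="exp (l * T)" and s=0])
      show "(\<lambda>\<tau>. indicator {0..T} \<tau> * exp (l * \<tau>)) \<in> borel_measurable lebesgue"
        by (rule measurable_completion) measurable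
    qed (use l in \<open>auto simp: indicator_def\<close>)
    have Xd: "norm (X d \<tau> - X d' \<tau>) \<le> 2 * L * b * (indicator {0..T} \<tau> * exp (l * \<tau>))" for \<tau>
    proof (cases "\<tau> \<in> {0..T}")
      case True
      have "norm (X d \<tau> - X d' \<tau>) \<le> L * (norm (d \<tau> - d' \<tau>) + norm (d (\<tau> - h) - d' (\<tau> - h)))"
        using lip[OF True] True by (simp add: X_def)
      also have "\<dots> \<le> L * (b * exp (l * \<tau>) + b * exp (l * (\<tau> - h)))"
        using L b True h by (intro mult_left_mono add_mono) auto
      also have "\<dots> \<le> L * (b * exp (l * \<tau>) + b * exp (l * \<tau>))"
        using L b0 l h by (intro mult_left_mono add_mono) auto
      finally show ?thesis using True by (simp add: algebra_simps)
    qed (simp add: X_def)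
    have "N d t - N d' t = (1 / Gamma a) *\<^sub>R (LINT \<tau>|lebesgue. rl_kernel a (t - \<tau>) *\<^sub>R (X d \<tau> - X d' \<tau>))"
      unfolding N_def scaleR_diff_right[symmetric] using Xi[OF g(1), of t] Xi[OF g(2), of t]
      by (simp add: scaleR_diff_right)
    also have "norm \<dots> = (1 / Gamma a) * norm (LINT \<tau>|lebesgue. rl_kernel a (t - \<tau>) *\<^sub>R (X d \<tau> - X d' \<tau>))"
      using Ga by simp
    also have "\<dots> \<le> (1 / Gamma a) * (LINT \<tau>|lebesgue. 2 * L * b * (rl_kernel a (t - \<tau>) *\<^sub>R (indicator {0..T} \<tau> * exp (l * \<tau>))))"
    proof (intro mult_left_mono Bochner_Integration.integral_norm_bound_integral integrable_mult_right i2)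
      show "integrable lebesgue (\<lambda>\<tau>. rl_kernel a (t - \<tau>) *\<^sub>R (X d \<tau> - X d' \<tau>))"
        using Xi[OF g(1), of t] Xi[OF g(2), of t] by (simp add: scaleR_diff_right)
      show "norm (rl_kernel a (t - \<tau>) *\<^sub>R (X d \<tau> - X d' \<tau>))
         \<le> 2 * L * b * (rl_kernel a (t - \<tau>) *\<^sub>R (indicator {0..T} \<tau> * exp (l * \<tau>)))" for \<tau>
        using mult_left_mono[OF Xd[of \<tau>] rl_kernel_nonneg[of a "t - \<tau>"]] by (simp add: mult_ac)
    qed (use Ga in simp)
    also have "\<dots> = (1 / Gamma a) * (2 * L * b) * (LINT \<tau>|lebesgue. rl_kernel a (t - \<tau>) * (indicator {0..T} \<tau> * exp (l * \<tau>)))"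
      by simp
    also have "\<dots> \<le> (1 / Gamma a) * (2 * L * b) * (Gamma a / (4 * L) * exp (l * t))"
      using Ga L b0 by (intro mult_left_mono weight t) auto
    also have "\<dots> = b / 2 * exp (l * t)" using Ga L by (simp add: field_simps)
    finally show ?thesis .
  qed
  have good0: "good (\<lambda>_. 0)" using M0 by (simp add: good_def)
  have N0: "norm (N (\<lambda>_. 0) t) \<le> M / 2 * exp (l * t)" if t: "t \<le> T" for t
  proof (cases "t \<le> 0")
    case True
    then have "N (\<lambda>_. 0) t = 0"
      unfolding N_def by (subst rl_convolution_nonpos) (auto simp: X_def)
    then show ?thesis using M0 by simp
  next
    case False
    have i1: "integrable lebesgue (\<lambda>\<tau>. rl_kernel a (t - \<tau>) *\<^sub>R (indicator E \<tau> :: real))"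
      using E by (intro integrable_rl_kernel_bounded[where B=1 and s=0] a) (auto simp: indicator_def)
    have "norm (N (\<lambda>_. 0) t) = (1 / Gamma a) * norm (LINT \<tau>|lebesgue. rl_kernel a (t - \<tau>) *\<^sub>R X (\<lambda>_. 0) \<tau>)"
      using Ga by (simp add: N_def)
    also have "\<dots> \<le> (1 / Gamma a) * (LINT \<tau>|lebesgue. c * (rl_kernel a (t - \<tau>) *\<^sub>R (indicator E \<tau> :: real)))"
    proof (intro mult_left_mono Bochner_Integration.integral_norm_bound_integral integrable_mult_right i1 Xi good0)
      have "norm (X (\<lambda>_. 0) \<tau>) \<le> c * indicator E \<tau>" for \<tau>
        using base[of \<tau>] c by (cases "\<tau> \<in> {0..T}") (auto simp: X_def indicator_def)
      then show "norm (rl_kernel a (t - \<tau>) *\<^sub>R X (\<lambda>_. 0) \<tau>) \<le> c * (rl_kernel a (t - \<tau>) *\<^sub>R indicator E \<tau>)" for \<tau>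
        using mult_left_mono[OF _ rl_kernel_nonneg[of a "t - \<tau>"]] by (fastforce simp: mult_ac)
    qed (use Ga in simp)
    also have "\<dots> = (1 / Gamma a) * (c * (LINT \<tau>|lebesgue. rl_kernel a (t - \<tau>) * indicator E \<tau>))" by simp
    also have "\<dots> \<le> (1 / Gamma a) * (c * K)"
      using Ga c K[OF t] by (intro mult_left_mono) auto
    also have "\<dots> = M / 2 * 1" by (simp add: M_def)
    also have "\<dots> \<le> M / 2 * exp (l * t)" using M0 False l by (intro mult_left_mono) auto
    finally show ?thesis .
  qed
  have goodN: "good (N d)" if g: "good d" for d
  proof -
    have "N d \<in> borel_measurable lebesgue"
      using rl_convolution_measurable[OF Xm[OF g], of a] unfolding N_def[abs_def] by measurable
    moreover have "norm (N d t) \<le> M * exp (l * t)" if t: "t \<le> T" for t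
    proof -
      have "norm (N d t) \<le> norm (N d t - N (\<lambda>_. 0) t) + norm (N (\<lambda>_. 0) t)"
        using norm_triangle_sub by (simp add: add.commute)
      also have "\<dots> \<le> M / 2 * exp (l * t) + M / 2 * exp (l * t)"
        by (intro add_mono N0 t contr g good0) (use g in \<open>auto simp: good_def\<close>)
      finally show ?thesis by simp
    qed
    ultimately show ?thesis by (simp add: good_def)
  qed
  define D where "D n = (N ^^ n) (\<lambda>_. 0)" for n
  have DS: "D (Suc n) = N (D n)" for n by (simp add: D_def)
  have goodD: "good (D n)" for n
    by (induction n) (auto simp: D_def good0 intro: goodN)
  have diffD: "norm (D (Suc n) t - D n t) \<le> M * (1/2) ^ n * exp (l * t)" if "t \<le> T" for n t
    using that
  proof (induction n arbitrary: t)
    case 0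
    then show ?case using goodD[of "Suc 0"] by (simp add: good_def D_def)
  next
    case (Suc n)
    show ?case
      unfolding DS[of "Suc n"] DS[of n] using contr[OF goodN[OF goodD[of n]] goodD[of n] _ Suc.prems, of "M * (1/2) ^ n"]
        Suc.IH by (simp add: DS)
  qed
  have conv: "convergent (\<lambda>n. D n t)" if t: "t \<le> T" for t
  proof -
    have "summable (\<lambda>n. D (Suc n) t - D n t)"
    proof (rule summable_comparison_test)
      show "\<exists>N. \<forall>n\<ge>N. norm (D (Suc n) t - D n t) \<le> M * exp (l * t) * (1/2) ^ n"
        using diffD[OF t] by (auto simp: mult_ac)
      show "summable (\<lambda>n. M * exp (l * t) * (1/2) ^ n)"
        by (intro summable_mult summable_geometric) auto
    qed
    then have "convergent (\<lambda>n. \<Sum>i<n. D (Suc i) t - D i t)"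
      by (simp add: summable_iff_convergent)
    moreover have "(\<Sum>i<n. D (Suc i) t - D i t) = D n t" for n
      using sum_lessThan_telescope[of "\<lambda>n. D n t" n] by (simp add: D_def[of 0])
    ultimately show ?thesis by simp
  qed
  \<comment> \<open>The iterates are controlled only up to \<open>T\<close>; the value 0 beyond
    makes \<open>d\<close> a limit of truncated measurable functions on the whole line.\<close>
  define d where "d t = (if t \<le> T then lim (\<lambda>n. D n t) else 0)" for t
  have limD: "(\<lambda>n. D n t) \<longlonglongrightarrow> d t" if "t \<le> T" for t
    using conv[OF that] that by (simp add: d_def convergent_LIMSEQ_iff)
  have dm: "d \<in> borel_measurable lebesgue"
  proof (rule borel_measurable_LIMSEQ_metric)
    show "(\<lambda>t. indicator {..T} t *\<^sub>R D n t) \<in> borel_measurable lebesgue" for n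
      using goodD[of n] by (intro borel_measurable_scaleR borel_measurable_indicator) (auto simp: good_def)
    show "(\<lambda>n. indicator {..T} t *\<^sub>R D n t) \<longlonglongrightarrow> d t" for t
      using limD[of t] by (cases "t \<le> T") (auto simp: d_def)
  qed
  have gd: "good d"
    unfolding good_def
  proof (intro conjI allI impI dm)
    fix t assume t: "t \<le> T"
    show "norm (d t) \<le> M * exp (l * t)"
      by (rule LIMSEQ_le_const2[OF tendsto_norm[OF limD[OF t]]])
         (use goodD t in \<open>auto simp: good_def\<close>)
  qed
  have Nlim: "(\<lambda>n. N (D n) t) \<longlonglongrightarrow> N d t" for t
    unfolding N_def
  proof (intro tendsto_intros integral_dominated_convergence[where w="\<lambda>\<tau>. rl_kernel a (t - \<tau>) *\<^sub>R (B * indicator {0..} \<tau>)"])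
    show "(\<lambda>\<tau>. rl_kernel a (t - \<tau>) *\<^sub>R X d \<tau>) \<in> borel_measurable lebesgue"
      using Xi[OF gd] by auto
    show "(\<lambda>\<tau>. rl_kernel a (t - \<tau>) *\<^sub>R X (D n) \<tau>) \<in> borel_measurable lebesgue" for n
      using Xi[OF goodD] by auto
    have B0: "0 \<le> B" using L M0 c by (simp add: B_def)
    show "integrable lebesgue (\<lambda>\<tau>. rl_kernel a (t - \<tau>) *\<^sub>R (B * indicator {0..} \<tau>))"
    proof (rule integrable_rl_kernel_bounded[OF a])
      show "(\<lambda>\<tau>::real. B * indicator {0..} \<tau>) \<in> borel_measurable lebesgue"
        by (rule measurable_completion) measurable
    qed (use B0 in \<open>auto simp: abs_mult\<close>)
    show "AE \<tau> in lebesgue. norm (rl_kernel a (t - \<tau>) *\<^sub>R X (D n) \<tau>) \<le> rl_kernel a (t - \<tau>) *\<^sub>R (B * indicator {0..} \<tau>)" for n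
      using Xb[OF goodD, of n] by (intro always_eventually allI) (simp add: mult_left_mono)
    show "AE \<tau> in lebesgue. (\<lambda>n. rl_kernel a (t - \<tau>) *\<^sub>R X (D n) \<tau>) \<longlonglongrightarrow> rl_kernel a (t - \<tau>) *\<^sub>R X d \<tau>"
    proof (intro always_eventually allI tendsto_intros)
      fix \<tau> show "(\<lambda>n. X (D n) \<tau>) \<longlonglongrightarrow> X d \<tau>"
      proof (cases "\<tau> \<in> {0..T}")
        case True
        have "(\<lambda>n. G \<tau> (D n \<tau>) (D n (\<tau> - h))) \<longlonglongrightarrow> G \<tau> (d \<tau>) (d (\<tau> - h))"
        proof (rule LIM_zero_cancel, rule Lim_null_comparison)
          show "\<forall>\<^sub>F n in sequentially. norm (G \<tau> (D n \<tau>) (D n (\<tau> - h)) - G \<tau> (d \<tau>) (d (\<tau> - h)))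
             \<le> L * (norm (D n \<tau> - d \<tau>) + norm (D n (\<tau> - h) - d (\<tau> - h)))"
            using lip[OF True] by simp
          have "(\<lambda>n. L * (norm (D n \<tau> - d \<tau>) + norm (D n (\<tau> - h) - d (\<tau> - h)))) \<longlonglongrightarrow> L * (norm (d \<tau> - d \<tau>) + norm (d (\<tau> - h) - d (\<tau> - h)))"
            using True h by (intro tendsto_intros limD) auto
          then show "(\<lambda>n. L * (norm (D n \<tau> - d \<tau>) + norm (D n (\<tau> - h) - d (\<tau> - h)))) \<longlonglongrightarrow> 0" by simp
        qed
        then show ?thesis using True by (simp add: X_def)
      qed (simp add: X_def)
    qed
  qed
  have fix_d: "d t = N d t" if "t \<le> T" for t
  proof (rule LIMSEQ_unique)
    show "(\<lambda>n. N (D n) t) \<longlonglongrightarrow> d t"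
      using LIMSEQ_Suc[OF limD[OF that]] by (simp add: DS)
  qed (rule Nlim)
  show ?thesis
  proof (intro exI[of _ d] conjI allI impI dm)
    fix t assume t: "t \<le> T"
    show "d t = (1 / Gamma a) *\<^sub>R
        (LINT \<tau>|lebesgue. rl_kernel a (t - \<tau>) *\<^sub>R (indicator {0..T} \<tau> *\<^sub>R G \<tau> (d \<tau>) (d (\<tau> - h))))"
      using fix_d[OF t] by (simp add: N_def X_def)
    have "norm (d t) \<le> M * exp (l * t)" using gd t by (simp add: good_def)
    also have "\<dots> \<le> M * exp (l * T)" using t l M0 by (intro mult_left_mono) auto
    finally show "norm (d t) \<le> 2 * c * K / Gamma a * exp (l * T)" by (simp add: M_def)
  qed
qed

section \<open>Fractional integration by parts\<close>

text \<open>For \<tau> \<le> T the kernel integrates in \<open>t\<close> over the interval to at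
  most \<open>T powr a / a\<close>, uniformly in \<tau>, so by Tonelli integrability of
  \<open>q\<close> alone is enough. The shift \<open>s\<close> will be 0 or the delay.\<close>

lemma integrable_rl_kernel_prod:
  fixes q :: "real \<Rightarrow> 'a::euclidean_space"
  assumes a: "0 < a" and T: "0 \<le> T" and s: "0 \<le> s" and q: "integrable lebesgue q" "\<And>\<tau>. T < \<tau> \<Longrightarrow> q \<tau> = 0"
  shows "integrable (lebesgue \<Otimes>\<^sub>M lebesgue)
     (\<lambda>(\<tau>, t). (rl_kernel a (\<tau> - s - t) * indicator {0..T} t) *\<^sub>R q \<tau>)" (is "integrable _ ?f")
proof (rule leb_pair.Fubini_integrable)
  have [measurable]: "fst \<in> borel_measurable (lebesgue \<Otimes>\<^sub>M (lebesgue :: real measure))"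
     "snd \<in> borel_measurable ((lebesgue :: real measure) \<Otimes>\<^sub>M lebesgue)"
    using measurable_compose[OF measurable_fst measurable_completion[of "\<lambda>x. x" lborel borel]]
      measurable_compose[OF measurable_snd measurable_completion[of "\<lambda>x. x" lborel borel]] by auto
  have [measurable]: "q \<in> borel_measurable lebesgue" using q(1) by auto
  show fm: "?f \<in> borel_measurable (lebesgue \<Otimes>\<^sub>M lebesgue)"
    unfolding split_beta' by measurable
  have ki: "integrable lebesgue (\<lambda>t. rl_kernel a (\<tau> - s - t) *\<^sub>R (indicator {0..T} t :: real))" for \<tau>
    by (rule integrable_rl_kernel_bounded[OF a borel_measurable_indicator, where B=1 and s=0])
      (auto simp: indicator_def)
  have kb: "(LINT t|lebesgue. rl_kernel a (\<tau> - s - t) * indicator {0..T} t) \<le> T powr a / a" if "\<tau> \<le> T" for \<tau>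
  proof -
    have "(LINT t|lebesgue. rl_kernel a (\<tau> - s - t) * indicator {0..T} t)
       \<le> (LINT t|lebesgue. rl_kernel a (\<tau> - s - t) * indicator {0..} t)"
      using ki has_bochner_integral_rl_kernel_reflect[OF a, of "\<tau> - s" 0]
      by (intro integral_mono) (auto simp: has_bochner_integral_iff indicator_def)
    also have "\<dots> = max 0 (\<tau> - s) powr a / a"
      using has_bochner_integral_rl_kernel_reflect[OF a, of "\<tau> - s" 0] by (simp add: has_bochner_integral_iff)
    also have "\<dots> \<le> T powr a / a"
      using that s a T by (intro divide_right_mono powr_mono2) auto
    finally show ?thesis .
  qed
  show "AE \<tau> in lebesgue. integrable lebesgue (\<lambda>t. ?f (\<tau>, t))"
    using ki by (intro always_eventually allI) (simp add: integrable_scaleR_left)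
  have eq: "(LINT t|lebesgue. norm (?f (\<tau>, t))) = (LINT t|lebesgue. rl_kernel a (\<tau> - s - t) * indicator {0..T} t) * norm (q \<tau>)" for \<tau>
    by simp
  show "integrable lebesgue (\<lambda>\<tau>. LINT t|lebesgue. norm (?f (\<tau>, t)))"
  proof (rule Bochner_Integration.integrable_bound)
    show "integrable lebesgue (\<lambda>\<tau>. T powr a / a * norm (q \<tau>))"
      using q(1) by simp
    show "(\<lambda>\<tau>. LINT t|lebesgue. norm (?f (\<tau>, t))) \<in> borel_measurable lebesgue"
      by (rule leb.borel_measurable_lebesgue_integral) (use fm in measurable)
    have "norm (LINT t|lebesgue. norm (?f (\<tau>, t))) \<le> norm (T powr a / a * norm (q \<tau>))" for \<tau>
    proof (cases "\<tau> \<le> T")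
      case True
      have "0 \<le> (LINT t|lebesgue. rl_kernel a (\<tau> - s - t) * indicator {0..T} t)"
        by (intro Bochner_Integration.integral_nonneg) auto
      moreover have "(LINT t|lebesgue. rl_kernel a (\<tau> - s - t) * indicator {0..T} t) * norm (q \<tau>) \<le> T powr a / a * norm (q \<tau>)"
        using kb[OF True] by (rule mult_right_mono) simp
      ultimately show ?thesis unfolding eq using a by simp
    qed (simp add: q)
    then show "AE \<tau> in lebesgue. norm (LINT t|lebesgue. norm (?f (\<tau>, t))) \<le> norm (T powr a / a * norm (q \<tau>))"
      by simp
  qed
qed

text \<open>The right-sided fractional integral of a merely integrable function is again integrable,
  but its defining integral is obtained only for almost every \<open>t\<close>.\<close>

lemma integrable_rl_adjoint:
  fixes q :: "real \<Rightarrow> 'a::euclidean_space"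
  assumes "0 < a" "0 \<le> T" "0 \<le> s" "integrable lebesgue q" "\<And>\<tau>. T < \<tau> \<Longrightarrow> q \<tau> = 0"
  shows "integrable lebesgue (\<lambda>t. indicator {0..T} t *\<^sub>R (LINT \<tau>|lebesgue. rl_kernel a (\<tau> - s - t) *\<^sub>R q \<tau>))"
    and "AE t in lebesgue. t \<in> {0..T} \<longrightarrow> integrable lebesgue (\<lambda>\<tau>. rl_kernel a (\<tau> - s - t) *\<^sub>R q \<tau>)"
proof -
  let ?g = "\<lambda>(t, \<tau>). (rl_kernel a (\<tau> - s - t) * indicator {0..T} t) *\<^sub>R q \<tau>"
  have g: "integrable (lebesgue \<Otimes>\<^sub>M lebesgue) ?g"
    using leb_pair.integrable_product_swap[OF integrable_rl_kernel_prod[OF assms]]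
    by (simp add: split_beta')
  have "(LINT \<tau>|lebesgue. ?g (t, \<tau>)) = indicator {0..T} t *\<^sub>R (LINT \<tau>|lebesgue. rl_kernel a (\<tau> - s - t) *\<^sub>R q \<tau>)" for t
    by (cases "t \<in> {0..T}") auto
  with leb_pair.integrable_fst'[OF g]
  show "integrable lebesgue (\<lambda>t. indicator {0..T} t *\<^sub>R (LINT \<tau>|lebesgue. rl_kernel a (\<tau> - s - t) *\<^sub>R q \<tau>))"
    by simp
  show "AE t in lebesgue. t \<in> {0..T} \<longrightarrow> integrable lebesgue (\<lambda>\<tau>. rl_kernel a (\<tau> - s - t) *\<^sub>R q \<tau>)"
    using leb_pair.AE_integrable_fst'[OF g] by eventually_elim auto
qed

text \<open>Fubini for a bounded \<open>X\<close> against an integrable \<open>q\<close>. The two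
  sides are not symmetric: the inner integral on the left exists almost everywhere, the one on the
  right for every \<tau>.\<close>

lemma rl_integration_by_parts:
  fixes q X :: "real \<Rightarrow> 'a::euclidean_space"
  assumes a: "0 < a" "0 \<le> T" "0 \<le> s" and q: "integrable lebesgue q" "\<And>\<tau>. T < \<tau> \<Longrightarrow> q \<tau> = 0"
    and X: "X \<in> borel_measurable lebesgue" "\<And>t. norm (X t) \<le> B * indicator {0..T} t"
  shows "integrable lebesgue (\<lambda>t. X t \<bullet> (LINT \<tau>|lebesgue. rl_kernel a (\<tau> - s - t) *\<^sub>R q \<tau>))" (is ?I)
    and "(LINT t|lebesgue. X t \<bullet> (LINT \<tau>|lebesgue. rl_kernel a (\<tau> - s - t) *\<^sub>R q \<tau>)) =
      (LINT \<tau>|lebesgue. q \<tau> \<bullet> (LINT t|lebesgue. rl_kernel a (\<tau> - s - t) *\<^sub>R X t))" (is ?E)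
proof -
  note [measurable] = X(1)
  have [measurable]: "q \<in> borel_measurable lebesgue" using q(1) by auto
  have [measurable]: "fst \<in> borel_measurable (lebesgue \<Otimes>\<^sub>M (lebesgue :: real measure))"
     "snd \<in> borel_measurable ((lebesgue :: real measure) \<Otimes>\<^sub>M lebesgue)"
    using measurable_compose[OF measurable_fst measurable_completion[of "\<lambda>x. x" lborel borel]]
      measurable_compose[OF measurable_snd measurable_completion[of "\<lambda>x. x" lborel borel]] by auto
  let ?F = "\<lambda>\<tau> t. rl_kernel a (\<tau> - s - t) * (X t \<bullet> q \<tau>)"
  have F: "integrable (lebesgue \<Otimes>\<^sub>M lebesgue) (case_prod ?F)"
  proof (rule Bochner_Integration.integrable_bound)
    show "integrable (lebesgue \<Otimes>\<^sub>M lebesgue)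
        (\<lambda>p. B *\<^sub>R (case p of (\<tau>, t) \<Rightarrow> (rl_kernel a (\<tau> - s - t) * indicator {0..T} t) *\<^sub>R q \<tau>))"
      by (intro integrable_scaleR_right integrable_rl_kernel_prod a q)
    show "case_prod ?F \<in> borel_measurable (lebesgue \<Otimes>\<^sub>M lebesgue)"
      unfolding split_beta' by measurable
    have "norm (?F \<tau> t) \<le> norm (B *\<^sub>R ((rl_kernel a (\<tau> - s - t) * indicator {0..T} t) *\<^sub>R q \<tau>))" for \<tau> t
    proof -
      have "norm (?F \<tau> t) \<le> rl_kernel a (\<tau> - s - t) * (norm (X t) * norm (q \<tau>))"
        unfolding norm_mult using Cauchy_Schwarz_ineq2[of "X t" "q \<tau>"] by (simp add: mult_left_mono)
      also have "\<dots> \<le> rl_kernel a (\<tau> - s - t) * ((\<bar>B\<bar> * indicator {0..T} t) * norm (q \<tau>))"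
        using X(2)[of t] by (intro mult_left_mono mult_right_mono)
          (auto simp: indicator_def split: if_splits intro: order_trans abs_ge_self)
      finally show ?thesis by (simp add: mult_ac abs_mult)
    qed
    then show "AE p in lebesgue \<Otimes>\<^sub>M lebesgue. norm (case_prod ?F p) \<le> norm (B *\<^sub>R (case p of (\<tau>, t) \<Rightarrow> (rl_kernel a (\<tau> - s - t) * indicator {0..T} t) *\<^sub>R q \<tau>))"
      by (intro always_eventually allI) (auto simp only: split_paired_all prod.case)
  qed
  have "AE t in lebesgue. X t \<bullet> (LINT \<tau>|lebesgue. rl_kernel a (\<tau> - s - t) *\<^sub>R q \<tau>) = (LINT \<tau>|lebesgue. ?F \<tau> t)"
  proof (rule AE_mp[OF integrable_rl_adjoint(2)[OF a q]], assumption, intro AE_I2 impI)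
    fix t assume elim: "t \<in> {0..T} \<longrightarrow> integrable lebesgue (\<lambda>\<tau>. rl_kernel a (\<tau> - s - t) *\<^sub>R q \<tau>)"
    show "X t \<bullet> (LINT \<tau>|lebesgue. rl_kernel a (\<tau> - s - t) *\<^sub>R q \<tau>) = (LINT \<tau>|lebesgue. ?F \<tau> t)"
    proof (cases "t \<in> {0..T}")
      case True
      have "(LINT \<tau>|lebesgue. ?F \<tau> t) = (LINT \<tau>|lebesgue. X t \<bullet> (rl_kernel a (\<tau> - s - t) *\<^sub>R q \<tau>))" by simp
      also have "\<dots> = X t \<bullet> (LINT \<tau>|lebesgue. rl_kernel a (\<tau> - s - t) *\<^sub>R q \<tau>)"
        using elim True by (intro integral_inner_right) auto
      finally show ?thesis by simp
    next
      case False
      then have "X t = 0" using X(2)[of t] by simp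
      then show ?thesis by simp
    qed
  qed
  moreover have "(\<lambda>t. X t \<bullet> (LINT \<tau>|lebesgue. rl_kernel a (\<tau> - s - t) *\<^sub>R q \<tau>)) \<in> borel_measurable lebesgue"
  proof -
    have [measurable]: "(\<lambda>t. LINT \<tau>|lebesgue. rl_kernel a (\<tau> - s - t) *\<^sub>R q \<tau>) \<in> borel_measurable lebesgue"
      by (rule leb.borel_measurable_lebesgue_integral) (unfold split_beta', measurable)
    show ?thesis by measurable
  qed
  ultimately show ?I ?E
    using leb_pair.integrable_snd[OF F] leb_pair.Fubini_integral[OF F]
  proof -
    assume ae: "AE t in lebesgue. X t \<bullet> (LINT \<tau>|lebesgue. rl_kernel a (\<tau> - s - t) *\<^sub>R q \<tau>) = (LINT \<tau>|lebesgue. ?F \<tau> t)"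
      and m: "(\<lambda>t. X t \<bullet> (LINT \<tau>|lebesgue. rl_kernel a (\<tau> - s - t) *\<^sub>R q \<tau>)) \<in> borel_measurable lebesgue"
    show ?I
      using integrable_cong_AE[OF m _ ae] leb_pair.integrable_snd[OF F] by auto
    have "(LINT t|lebesgue. X t \<bullet> (LINT \<tau>|lebesgue. rl_kernel a (\<tau> - s - t) *\<^sub>R q \<tau>)) = (LINT t|lebesgue. LINT \<tau>|lebesgue. ?F \<tau> t)"
      using leb_pair.integrable_snd[OF F] by (intro integral_cong_AE m ae) auto
    also have "\<dots> = (LINT \<tau>|lebesgue. LINT t|lebesgue. ?F \<tau> t)"
      by (rule leb_pair.Fubini_integral[OF F])
    also have "\<dots> = (LINT \<tau>|lebesgue. q \<tau> \<bullet> (LINT t|lebesgue. rl_kernel a (\<tau> - s - t) *\<^sub>R X t))"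
    proof (rule Bochner_Integration.integral_cong[OF refl])
      fix \<tau>
      have "norm (X t) \<le> \<bar>B\<bar> * indicator {0..} t" for t
        using X(2)[of t] by (cases "t \<in> {0..T}") auto
      then have "integrable lebesgue (\<lambda>t. rl_kernel a (\<tau> - s - t) *\<^sub>R X t)"
        by (rule integrable_rl_kernel_bounded[OF a(1) X(1)])
      then have "q \<tau> \<bullet> (LINT t|lebesgue. rl_kernel a (\<tau> - s - t) *\<^sub>R X t) = (LINT t|lebesgue. q \<tau> \<bullet> (rl_kernel a (\<tau> - s - t) *\<^sub>R X t))"
        by (intro integral_inner_right[symmetric]) auto
      then show "(LINT t|lebesgue. ?F \<tau> t) = q \<tau> \<bullet> (LINT t|lebesgue. rl_kernel a (\<tau> - s - t) *\<^sub>R X t)"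
        by (simp add: inner_commute)
    qed
    finally show ?E .
  qed
qed

section \<open>Regularity of the data\<close>

text \<open>For a simple \<open>g\<close> the composition is measurable by cases on its values;
  continuity in the second argument passes this to the pointwise limit.\<close>

lemma borel_measurable_caratheodory:
  fixes F :: "'c \<Rightarrow> 'a::{second_countable_topology, metric_space} \<Rightarrow> 'b::metric_space"
  assumes F: "\<And>x. (\<lambda>t. F t x) \<in> borel_measurable M" "\<And>t. t \<in> space M \<Longrightarrow> continuous_on UNIV (F t)"
    and g: "g \<in> borel_measurable M"
  shows "(\<lambda>t. F t (g t)) \<in> borel_measurable M"
proof -
  obtain s where s: "\<And>i. simple_function M (s i)" "\<And>t. t \<in> space M \<Longrightarrow> (\<lambda>i. s i t) \<longlonglongrightarrow> g t"
    using borel_measurable_implies_sequence_metric[OF g, of undefined] by blast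
  show ?thesis
  proof (rule borel_measurable_LIMSEQ_metric)
    fix i
    have fin: "finite (s i ` space M)" using s(1)[of i] by (simp add: simple_function_def)
    have "s i \<in> M \<rightarrow>\<^sub>M count_space (s i ` space M)"
      using s(1)[of i] by (simp add: measurable_count_space_eq2[OF fin] simple_function_def)
    then show "(\<lambda>t. F t (s i t)) \<in> borel_measurable M"
      by (rule measurable_compose_countable'[of "s i ` space M" "\<lambda>x t. F t x", rotated])
         (use F(1) fin in \<open>auto intro: countable_finite\<close>)
  next
    fix t assume t: "t \<in> space M"
    have "isCont (F t) (g t)" using F(2)[OF t] by (simp add: continuous_on_eq_continuous_at)
    then show "(\<lambda>i. F t (s i t)) \<longlonglongrightarrow> F t (g t)"
      using s(2)[OF t] by (rule isCont_tendsto_compose)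
  qed
qed

text \<open>The partial derivatives are introduced by a choice operator. Joint differentiability,
  composed with the inclusions of the slices, shows that the chosen maps really are
  derivatives.\<close>

lemma smooth_data_has_derivative:
  fixes d :: "real \<Rightarrow> real^'n \<Rightarrow> real^'n \<Rightarrow> real^'r \<Rightarrow> 'c::real_normed_vector"
  assumes "smooth_data T L d" "t \<in> {0..T}"
  shows "((\<lambda>x. d t x x' v) has_derivative deriv_state d t x x' v) (at x)"
    and "((\<lambda>x'. d t x x' v) has_derivative deriv_delayed d t x x' v) (at x')"
proof -
  obtain g' where g': "\<And>p. ((\<lambda>(y, y', u). d t y y' u) has_derivative blinfun_apply (g' p)) (at p)"
    using assms unfolding smooth_data_def continuously_differentiable_def by blast
  have "((\<lambda>x. (x, x', v)) has_derivative (\<lambda>k. (k, 0, 0))) (at x)"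
    "((\<lambda>x'. (x, x', v)) has_derivative (\<lambda>k. (0, k, 0))) (at x')"
    by (auto intro!: derivative_eq_intros simp: zero_prod_def)
  from this[THEN has_derivative_compose, OF g']
  have "(\<lambda>x. d t x x' v) differentiable at x" "(\<lambda>x'. d t x x' v) differentiable at x'"
    by (auto simp: differentiable_def)
  then show "((\<lambda>x. d t x x' v) has_derivative deriv_state d t x x' v) (at x)"
    "((\<lambda>x'. d t x x' v) has_derivative deriv_delayed d t x x' v) (at x')"
    unfolding deriv_state_def deriv_delayed_def by (simp_all add: frechet_derivative_works)
qed

text \<open>The mean value inequality for \<open>f\<close> minus the linear map \<open>D0\<close>,
  which need not be the derivative of \<open>f\<close> at \<open>y\<close>.\<close>

lemma increment_minus_linear_bound:
  fixes f :: "'a::real_normed_vector \<Rightarrow> 'b::real_normed_vector"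
  assumes f: "\<And>x. (f has_derivative D x) (at x)" and D0: "bounded_linear D0"
    and B: "\<And>x. norm (x - y) \<le> norm a \<Longrightarrow> onorm (\<lambda>k. D x k - D0 k) \<le> B"
  shows "norm (f (y + a) - f y - D0 a) \<le> B * norm a"
proof -
  have "norm ((f (y + a) - D0 (y + a)) - (f y - D0 y)) \<le> B * norm ((y + a) - y)"
  proof (rule differentiable_bound[where S="closed_segment y (y + a)" and f'="\<lambda>x k. D x k - D0 k"])
    fix x assume x: "x \<in> closed_segment y (y + a)"
    show "((\<lambda>x. f x - D0 x) has_derivative (\<lambda>k. D x k - D0 k)) (at x within closed_segment y (y + a))"
      by (intro has_derivative_diff has_derivative_at_withinI[OF f]
          bounded_linear.has_derivative[OF D0] has_derivative_ident)
    show "onorm (\<lambda>k. D x k - D0 k) \<le> B"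
      using segment_bound1[OF x] by (intro B) simp
  qed auto
  then show ?thesis using linear_add[OF bounded_linear.linear[OF D0]] by (simp add: algebra_simps)
qed

text \<open>The increment is taken at the new control \<open>v\<close>, the derivatives at the old
  control \<open>u\<close>. The price is the term \<open>norm (v - u)\<close>, which will be nonzero
  only on the switching set. The state is moved first, then the delayed state.\<close>

lemma smooth_data_remainder:
  fixes d :: "real \<Rightarrow> real^'n \<Rightarrow> real^'n \<Rightarrow> real^'r \<Rightarrow> 'c::real_normed_vector"
  assumes d: "smooth_data T L d" and t: "t \<in> {0..T}" and L: "0 \<le> L"
  shows "norm (d t (y + a) (y' + b) v - d t y y' v - (deriv_state d t y y' u a + deriv_delayed d t y y' u b))
     \<le> L * (norm a + norm b + norm (v - u)) * (norm a + norm b)"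
proof -
  note D = smooth_data_has_derivative[OF d t]
  have lip: "onorm (\<lambda>k. deriv_state d t y1 y1' u1 k - deriv_state d t y2 y2' u2 k)
            \<le> L * (norm (y1 - y2) + norm (y1' - y2') + norm (u1 - u2))"
    "onorm (\<lambda>k. deriv_delayed d t y1 y1' u1 k - deriv_delayed d t y2 y2' u2 k)
            \<le> L * (norm (y1 - y2) + norm (y1' - y2') + norm (u1 - u2))" for y1 y1' u1 y2 y2' u2
    using d t by (auto simp: smooth_data_def partial_lipschitz_with_growth_def)
  let ?B = "L * (norm a + norm b + norm (v - u))"
  have 1: "norm (d t (y + a) (y' + b) v - d t y (y' + b) v - deriv_state d t y y' u a) \<le> ?B * norm a"
  proof (rule increment_minus_linear_bound[OF D(1)[where x'="y' + b" and v=v] has_derivative_bounded_linear[OF D(1)]])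
    fix x assume "norm (x - y) \<le> norm a"
    then show "onorm (\<lambda>k. deriv_state d t x (y' + b) v k - deriv_state d t y y' u k) \<le> ?B"
      using L by (intro order_trans[OF lip(1)] mult_left_mono) auto
  qed
  have 2: "norm (d t y (y' + b) v - d t y y' v - deriv_delayed d t y y' u b) \<le> ?B * norm b"
  proof (rule increment_minus_linear_bound[OF D(2)[where x=y and v=v] has_derivative_bounded_linear[OF D(2)]])
    fix x assume "norm (x - y') \<le> norm b"
    then show "onorm (\<lambda>k. deriv_delayed d t y x v k - deriv_delayed d t y y' u k) \<le> ?B"
      using L by (intro order_trans[OF lip(2)] mult_left_mono) (auto intro: add_increasing)
  qed
  have "d t (y + a) (y' + b) v - d t y y' v - (deriv_state d t y y' u a + deriv_delayed d t y y' u b)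
    = (d t (y + a) (y' + b) v - d t y (y' + b) v - deriv_state d t y y' u a)
      + (d t y (y' + b) v - d t y y' v - deriv_delayed d t y y' u b)" by simp
  also have "norm \<dots> \<le> ?B * norm a + ?B * norm b"
    by (rule order_trans[OF norm_triangle_ineq add_mono[OF 1 2]])
  finally show ?thesis by (simp add: distrib_left)
qed

text \<open>A Caratheodory composition: the Lipschitz condition supplies continuity in the last
  three arguments. The indicator is there because nothing is assumed of \<open>d\<close> outside the
  time interval.\<close>

lemma data_composition_measurable:
  fixes d :: "real \<Rightarrow> real^'n \<Rightarrow> real^'n \<Rightarrow> real^'r \<Rightarrow> 'c::euclidean_space"
  assumes lip: "lipschitz_with_growth T L d"
    and meas: "\<And>y y' v. (\<lambda>t. d t y y' v) \<in> borel_measurable (lebesgue_on {0..T})"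
    and [measurable]: "x \<in> borel_measurable lebesgue" "x' \<in> borel_measurable lebesgue" "w \<in> borel_measurable lebesgue"
  shows "(\<lambda>t. indicator {0..T} t *\<^sub>R d t (x t) (x' t) (w t)) \<in> borel_measurable lebesgue"
proof -
  let ?F = "\<lambda>t p. indicator {0..T} t *\<^sub>R (case p of (y, y', v) \<Rightarrow> d t y y' v)"
  have "(\<lambda>t. ?F t (x t, x' t, w t)) \<in> borel_measurable lebesgue"
  proof (rule borel_measurable_caratheodory[of ?F])
    fix p :: "(real^'n) \<times> (real^'n) \<times> (real^'r)"
    obtain y y' v where p: "p = (y, y', v)" by (cases p) auto
    show "(\<lambda>t. ?F t p) \<in> borel_measurable lebesgue"
      using meas[of y y' v] borel_measurable_restrict_space_iff[of "{0..T}" lebesgue "\<lambda>t. d t y y' v"]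
      by (simp add: p)
  next
    fix t :: real
    show "continuous_on UNIV (?F t)"
    proof (cases "t \<in> {0..T}")
      case True
      have "isCont (\<lambda>(y, y', v). d t y y' v) p" for p
      proof -
        obtain y y' v where p: "p = (y, y', v)" by (cases p) auto
        have "((\<lambda>q. case q of (z, z', w) \<Rightarrow> d t z z' w) \<longlongrightarrow> d t y y' v) (at p)"
        proof (rule LIM_zero_cancel, rule Lim_null_comparison)
          show "\<forall>\<^sub>F q in at p. norm ((case q of (z, z', w) \<Rightarrow> d t z z' w) - d t y y' v)
              \<le> L * (norm (fst q - y) + norm (fst (snd q) - y') + norm (snd (snd q) - v))"
            using lip True by (intro always_eventually allI) (auto simp: lipschitz_with_growth_def)
          have "((\<lambda>q. L * (norm (fst q - y) + norm (fst (snd q) - y') + norm (snd (snd q) - v))) \<longlongrightarrow>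
              L * (norm (fst p - y) + norm (fst (snd p) - y') + norm (snd (snd p) - v))) (at p)"
            by (intro tendsto_intros)
          then show "((\<lambda>q. L * (norm (fst q - y) + norm (fst (snd q) - y') + norm (snd (snd q) - v))) \<longlongrightarrow> 0) (at p)"
            by (simp add: p)
        qed
        then show ?thesis by (simp add: isCont_def p)
      qed
      then show ?thesis using True by (simp add: continuous_on_eq_continuous_at)
    qed simp
  next
    show "(\<lambda>t. (x t, x' t, w t)) \<in> borel_measurable lebesgue"
      by (intro borel_measurable_Pair assms)
  qed
  then show ?thesis by simp
qed

text \<open>The gradient is a definite description, so existence (Riesz representation in
  coordinates) and uniqueness are both required before it can be used.\<close>

lemma gradient_inner:
  fixes g :: "'a::euclidean_space \<Rightarrow> real"
  assumes g: "(g has_derivative G) (at x)"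
  shows "gradient g x \<bullet> k = G k"
proof -
  have lin: "linear G" using g by (rule has_derivative_linear)
  define D where "D = (\<Sum>b\<in>Basis. G b *\<^sub>R b)"
  have GD: "G k = k \<bullet> D" for k
  proof -
    have "G k = G (\<Sum>b\<in>Basis. (k \<bullet> b) *\<^sub>R b)" by (simp add: euclidean_representation)
    also have "\<dots> = (\<Sum>b\<in>Basis. (k \<bullet> b) * G b)"
      using lin by (simp add: linear_sum linear_cmul)
    also have "\<dots> = k \<bullet> D" by (simp add: D_def inner_sum_right mult.commute)
    finally show ?thesis .
  qed
  have "G = (\<lambda>k. k \<bullet> D)" using GD by (rule ext)
  then have gd: "GDERIV g x :> D" using g by (simp add: gderiv_def)
  have "gradient g x = D"
    unfolding gradient_def
  proof (rule the_equality, rule gd)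
    fix D' assume "GDERIV g x :> D'"
    then have "(\<lambda>k. k \<bullet> D') = (\<lambda>k. k \<bullet> D)"
      using gd unfolding gderiv_def by (rule has_derivative_unique)
    then have "(D' - D) \<bullet> D' = (D' - D) \<bullet> D" by meson
    then have "(D' - D) \<bullet> (D' - D) = 0" by (simp add: inner_diff_right)
    then show "D' = D" by simp
  qed
  then show ?thesis by (simp add: GD inner_commute)
qed

section \<open>Measurable selections\<close>

text \<open>The Kuratowski--Ryll-Nardzewski construction, started at \<open>c\<close>. Step
  \<open>n\<close> moves by less than \<open>r / 2 ^ n\<close> to a point of a dense sequence within
  \<open>r / 2 ^ Suc n\<close> of \<open>U t\<close>. The moves sum to at most \<open>2 * r\<close>,
  and closedness puts the limit in \<open>U t\<close>.\<close>

lemma measurable_selection_near: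
  fixes U :: "'a \<Rightarrow> 'b::euclidean_space set"
  assumes A: "A \<in> sets M" and closed: "\<And>t. t \<in> A \<Longrightarrow> closed (U t)"
    and meas: "\<And>V. open V \<Longrightarrow> {t\<in>A. U t \<inter> V \<noteq> {}} \<in> sets M"
    and r: "0 < r" and c: "\<And>t. t \<in> A \<Longrightarrow> U t \<inter> ball c r \<noteq> {}"
  shows "\<exists>v\<in>borel_measurable M. \<forall>t\<in>A. v t \<in> U t \<and> dist (v t) c \<le> 2 * r"
proof -
  obtain D :: "'b set" where D: "countable D" "\<And>X. open X \<Longrightarrow> X \<noteq> {} \<Longrightarrow> \<exists>d\<in>D. d \<in> X"
    by (rule countable_dense_setE) blast
  have Dne: "D \<noteq> {}" using D(2)[of UNIV] by auto
  define e where "e = from_nat_into D"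
  have e: "\<exists>k. e k \<in> X" if "open X" "X \<noteq> {}" for X
    using D(2)[OF that] from_nat_into_surj[OF D(1)] by (auto simp: e_def)
  define Q where "Q n k x t \<longleftrightarrow> dist (e k) x < r / 2 ^ n \<and> t \<in> {t\<in>A. U t \<inter> ball (e k) (r / 2 ^ Suc n) \<noteq> {}}"
    for n k x t
  have QD: "U t \<inter> ball (e k) (r / 2 ^ Suc n) \<noteq> {} \<and> dist (e k) x < r / 2 ^ n" if "Q n k x t" for n k x t
    using that by (simp add: Q_def)
  \<comment> \<open>Taking the least admissible index keeps the choice measurable, since each
    \<open>Q n k\<close> is a measurable condition along the current approximation.\<close>
  define v where "v = rec_nat (\<lambda>t::'a. c) (\<lambda>n w t. e (LEAST k. Q n k (w t) t))"
  have v0: "v 0 = (\<lambda>t. c)" and vS: "v (Suc n) = (\<lambda>t. e (LEAST k. Q n k (v n t) t))" for n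
    by (simp_all add: v_def)
  have vm: "v n \<in> borel_measurable M" for n
  proof (induction n)
    case (Suc n)
    note [measurable] = Suc.IH
    have [measurable]: "{t\<in>A. U t \<inter> ball (e k) (r / 2 ^ Suc n) \<noteq> {}} \<in> sets M" for k
      by (rule meas) simp
    have [measurable]: "Measurable.pred M (\<lambda>t. Q n k (v n t) t)" for k
      unfolding Q_def by measurable
    have "(\<lambda>t. LEAST k. Q n k (v n t) t) \<in> M \<rightarrow>\<^sub>M count_space UNIV"
      by measurable
    then show ?case unfolding vS
      by (rule measurable_compose) simp
  qed (simp add: v0)
  have inv: "U t \<inter> ball (v n t) (r / 2 ^ n) \<noteq> {} \<and> Q n (LEAST k. Q n k (v n t) t) (v n t) t" if t: "t \<in> A" for n t
  proof -
    have step: "Q n (LEAST k. Q n k (v n t) t) (v n t) t" if ne: "U t \<inter> ball (v n t) (r / 2 ^ n) \<noteq> {}" for n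
    proof -
      obtain x where x: "x \<in> U t" "dist (v n t) x < r / 2 ^ n" using ne by auto
      obtain k where "e k \<in> ball (v n t) (r / 2 ^ n) \<inter> ball x (r / 2 ^ Suc n)"
        using e[of "ball (v n t) (r / 2 ^ n) \<inter> ball x (r / 2 ^ Suc n)"] x r
        by (metis IntI centre_in_ball divide_pos_pos emptyE mem_ball open_Int open_ball zero_less_numeral zero_less_power)
      then have "Q n k (v n t) t"
        using x t by (auto simp: Q_def dist_commute)
      then show ?thesis by (rule LeastI)
    qed
    have "U t \<inter> ball (v n t) (r / 2 ^ n) \<noteq> {}"
    proof (induction n)
      case 0 then show ?case using c[OF t] by (simp add: v0)
    next
      case (Suc n)
      show ?case using QD[OF step[OF Suc.IH]] unfolding vS by blast
    qed
    then show ?thesis using step by blast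
  qed
  have diff: "norm (v (Suc n) t - v n t) \<le> r * (1/2) ^ n" if "t \<in> A" for n t
    using QD[OF conjunct2[OF inv[OF that, of n]]] unfolding vS
    by (simp add: dist_norm power_one_over)
  have conv: "convergent (\<lambda>n. v n t)" if t: "t \<in> A" for t
  proof -
    have "summable (\<lambda>n. v (Suc n) t - v n t)"
      by (rule summable_comparison_test[of _ "\<lambda>n. r * (1/2) ^ n"])
         (use diff[OF t] in \<open>auto intro!: summable_mult summable_geometric\<close>)
    then have "convergent (\<lambda>n. \<Sum>i<n. v (Suc i) t - v i t)"
      by (simp add: summable_iff_convergent)
    then have "convergent (\<lambda>n. c + (\<Sum>i<n. v (Suc i) t - v i t))"
      by (simp only: convergent_add_const_iff)
    moreover have "c + (\<Sum>i<n. v (Suc i) t - v i t) = v n t" for n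
      using sum_lessThan_telescope[of "\<lambda>n. v n t" n] by (simp add: v0)
    ultimately show ?thesis by simp
  qed
  have vc: "norm (v n t - c) \<le> 2 * r * (1 - (1/2) ^ n)" if t: "t \<in> A" for n t
  proof (induction n)
    case (Suc n)
    have "norm (v (Suc n) t - c) \<le> norm (v (Suc n) t - v n t) + norm (v n t - c)"
      using norm_triangle_ineq[of "v (Suc n) t - v n t" "v n t - c"] by simp
    also have "\<dots> \<le> r * (1/2) ^ n + 2 * r * (1 - (1/2) ^ n)"
      by (intro add_mono diff t Suc.IH)
    finally show ?case by (simp add: algebra_simps)
  qed (simp add: v0)
  define w where "w t = (if t \<in> A then lim (\<lambda>n. v n t) else c)" for t
  have lim: "(\<lambda>n. v n t) \<longlonglongrightarrow> w t" if "t \<in> A" for t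
    using conv[OF that] that by (simp add: w_def convergent_LIMSEQ_iff)
  have "w \<in> borel_measurable M"
  proof (rule borel_measurable_LIMSEQ_metric)
    show "(\<lambda>t. if t \<in> A then v n t else c) \<in> borel_measurable M" for n
      using vm[of n] A by measurable
    show "(\<lambda>n. if t \<in> A then v n t else c) \<longlonglongrightarrow> w t" for t
      using lim[of t] by (cases "t \<in> A") (auto simp: w_def)
  qed
  moreover have "w t \<in> U t \<and> dist (w t) c \<le> 2 * r" if t: "t \<in> A" for t
  proof
    have "\<exists>x. x \<in> U t \<and> dist (v n t) x < r / 2 ^ n" for n
      using conjunct1[OF inv[OF t, of n]] by auto
    then obtain x where x: "\<And>n. x n \<in> U t" "\<And>n. dist (v n t) (x n) < r / 2 ^ n" by metis
    have "(\<lambda>n. x n - v n t) \<longlonglongrightarrow> 0"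
    proof (rule Lim_null_comparison)
      show "\<forall>\<^sub>F n in sequentially. norm (x n - v n t) \<le> r * (1/2) ^ n"
        using x(2) by (auto simp: dist_norm norm_minus_commute power_one_over less_imp_le)
      show "(\<lambda>n. r * (1/2) ^ n) \<longlonglongrightarrow> 0"
        by (intro tendsto_mult_right_zero LIMSEQ_realpow_zero) auto
    qed
    from tendsto_add[OF this lim[OF t]] have "x \<longlonglongrightarrow> w t" by simp
    then show "w t \<in> U t" using closed_sequentially[OF closed[OF t]] x(1) by blast
    have "norm (v n t - c) \<le> 2 * r" for n
    proof (rule order_trans[OF vc[OF t]])
      show "2 * r * (1 - (1/2) ^ n) \<le> 2 * r" using r by (simp add: algebra_simps)
    qed
    then show "dist (w t) c \<le> 2 * r"
      using LIMSEQ_le_const2[OF tendsto_norm[OF tendsto_diff[OF lim[OF t] tendsto_const[of c]]]]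
      by (auto simp: dist_norm)
  qed
  ultimately show ?thesis by blast
qed

lemma borel_measurable_lebesgue_on_iff:
  fixes g :: "real \<Rightarrow> 'b::euclidean_space"
  assumes "S \<in> sets lebesgue"
  shows "g \<in> borel_measurable (lebesgue_on S) \<longleftrightarrow> (\<lambda>t. indicator S t *\<^sub>R g t) \<in> borel_measurable lebesgue"
  using borel_measurable_restrict_space_iff[of S lebesgue g] assms by simp

text \<open>\<open>v\<close> is constrained on \<open>E\<close> only, because the selections used
  later lie in \<open>U t\<close> on part of the interval only.\<close>

lemma control_switch:
  assumes "is_control T U u" "v \<in> borel_measurable (lebesgue_on {0..T})" "E \<in> sets lebesgue"
    "\<And>t. t \<in> E \<inter> {0..T} \<Longrightarrow> v t \<in> U t" "bounded (v ` (E \<inter> {0..T}))"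
  shows "is_control T U (\<lambda>t. if t \<in> E then v t else u t)"
  unfolding is_control_def
proof (intro conjI ballI)
  have [measurable]: "E \<inter> {0..T} \<in> sets (lebesgue_on {0..T})"
    using assms(3) by (auto simp: sets_restrict_space)
  have "(\<lambda>t. if t \<in> E \<inter> {0..T} then v t else u t) \<in> borel_measurable (lebesgue_on {0..T})"
    using assms by (intro measurable_If_set) (auto simp: is_control_def sets_restrict_space)
  then show "(\<lambda>t. if t \<in> E then v t else u t) \<in> borel_measurable (lebesgue_on {0..T})"
    by (rule measurable_cong[THEN iffD1, rotated]) auto
  have "(\<lambda>t. if t \<in> E then v t else u t) ` {0..T} \<subseteq> v ` (E \<inter> {0..T}) \<union> u ` {0..T}" by auto
  then show "bounded ((\<lambda>t. if t \<in> E then v t else u t) ` {0..T})"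
    using assms(1,5) by (auto simp: is_control_def intro: bounded_subset[OF bounded_Un[THEN iffD2]])
  show "(if t \<in> E then v t else u t) \<in> U t" if "t \<in> {0..T}" for t
    using assms(1,4) that by (auto simp: is_control_def)
qed

text \<open>A selection that beats \<open>u\<close> on a set of positive measure would, used exactly
  there, give a control with positive integral. Countably many selections come arbitrarily close to
  every point of \<open>U t\<close>, so one null set serves all points, by continuity of
  \<open>Q t\<close>.\<close>

lemma AE_maximum_of_integral_maximum:
  fixes Q :: "real \<Rightarrow> real^'r \<Rightarrow> real"
  assumes u: "is_control T U u" and U: "measurable_multifunction T U" "\<And>t. t \<in> {0..T} \<Longrightarrow> closed (U t)"
    and cont: "\<And>t. t \<in> {0..T} \<Longrightarrow> continuous_on UNIV (Q t)"
    and int: "\<And>v. is_control T U v \<Longrightarrow> integrable lebesgue (\<lambda>t. indicator {0..T} t * (Q t (v t) - Q t (u t)))"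
    and max: "\<And>v. is_control T U v \<Longrightarrow> (LINT t|lebesgue. indicator {0..T} t * (Q t (v t) - Q t (u t))) \<le> 0"
  shows "AE t in lebesgue. t \<in> {0..T} \<longrightarrow> (\<forall>x\<in>U t. Q t x \<le> Q t (u t))"
proof -
  obtain D :: "(real^'r) set" where D: "countable D" "\<And>X. open X \<Longrightarrow> X \<noteq> {} \<Longrightarrow> \<exists>d\<in>D. d \<in> X"
    by (rule countable_dense_setE) blast
  define A where "A c m = {t\<in>{0..T}. U t \<inter> ball c ((1/2) ^ m) \<noteq> {}}" for c and m :: nat
  have Am: "A c m \<in> sets lebesgue" for c m
    using U(1) by (simp add: A_def measurable_multifunction_def)
  have "\<forall>c m. \<exists>v\<in>borel_measurable lebesgue. \<forall>t\<in>A c m. v t \<in> U t \<and> dist (v t) c \<le> 2 * (1/2) ^ m"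
  proof (intro allI measurable_selection_near Am)
    fix c m V assume "open (V :: (real^'r) set)"
    then have "A c m \<inter> {t\<in>{0..T}. U t \<inter> V \<noteq> {}} \<in> sets lebesgue"
      using Am U(1) by (auto simp: measurable_multifunction_def)
    also have "A c m \<inter> {t\<in>{0..T}. U t \<inter> V \<noteq> {}} = {t\<in>A c m. U t \<inter> V \<noteq> {}}" by (auto simp: A_def)
    finally show "{t\<in>A c m. U t \<inter> V \<noteq> {}} \<in> sets lebesgue" .
  qed (use U(2) in \<open>auto simp: A_def\<close>)
  then obtain s where s: "\<And>c m. s c m \<in> borel_measurable lebesgue"
    "\<And>c m t. t \<in> A c m \<Longrightarrow> s c m t \<in> U t \<and> dist (s c m t) c \<le> 2 * (1/2) ^ m" by metis
  have ctrl: "is_control T U (\<lambda>t. if t \<in> B then s c m t else u t)"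
    if B: "B \<in> sets lebesgue" "B \<subseteq> A c m" for B c m
  proof (rule control_switch[OF u _ B(1)])
    show "s c m \<in> borel_measurable (lebesgue_on {0..T})"
      using s(1) by (rule measurable_restrict_space1)
    have "s c m ` (B \<inter> {0..T}) \<subseteq> cball c (2 * (1/2) ^ m)"
      using s(2) B by (fastforce simp: dist_commute)
    then show "bounded (s c m ` (B \<inter> {0..T}))" using bounded_cball bounded_subset by blast
  qed (use s B in auto)
  have "AE t in lebesgue. t \<in> A c m \<longrightarrow> Q t (s c m t) \<le> Q t (u t)" for c m
  proof -
    define g where "g t = indicator {0..T} t * (Q t (if t \<in> A c m then s c m t else u t) - Q t (u t))" for t
    have gi: "integrable lebesgue g"
      using int[OF ctrl[OF Am order_refl]] by (simp add: g_def[abs_def])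
    text \<open>Switching only where the selection beats \<open>u\<close> makes the integrand nonnegative.\<close>
    define B where "B = {t. 0 < g t}"
    have gm: "g \<in> borel_measurable lebesgue" using gi by auto
    have Bm: "B \<in> sets lebesgue"
      using borel_measurable_less[OF borel_measurable_const gm, of 0] by (simp add: B_def)
    have BA: "B \<subseteq> A c m" by (auto simp: B_def g_def split: if_splits)
    have eq: "indicator {0..T} t * (Q t (if t \<in> B then s c m t else u t) - Q t (u t)) = max 0 (g t)" for t
      using BA by (auto simp: g_def B_def indicator_def split: if_splits)
    have "integrable lebesgue (\<lambda>t. max 0 (g t))" using gi by auto
    moreover have "(LINT t|lebesgue. max 0 (g t)) = 0"
      using max[OF ctrl[OF Bm BA]] by (intro antisym) (auto simp: eq)
    ultimately have "AE t in lebesgue. max 0 (g t) = 0"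
      by (subst integral_nonneg_eq_0_iff_AE[symmetric]) auto
    then show ?thesis
      by eventually_elim (auto simp: g_def A_def max_def split: if_splits)
  qed
  then have "AE t in lebesgue. \<forall>c\<in>D. \<forall>m. t \<in> A c m \<longrightarrow> Q t (s c m t) \<le> Q t (u t)"
    using D(1) by (simp add: AE_ball_countable AE_all_countable)
  then show ?thesis
  proof eventually_elim
    case (elim t)
    show ?case
    proof (intro impI ballI)
      fix x assume t: "t \<in> {0..T}" and x: "x \<in> U t"
      have "\<forall>m. \<exists>c\<in>D. dist x c < (1/2) ^ m"
      proof
        fix m :: nat
        show "\<exists>c\<in>D. dist x c < (1/2) ^ m"
        proof -
          have "x \<in> ball x ((1/2) ^ m)" by (simp del: power_one_over)
          then have "ball x ((1/2) ^ m) \<noteq> {}" by blast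
          then show ?thesis using D(2)[OF open_ball] by (auto simp del: power_one_over)
        qed
      qed
      then obtain c where c: "\<And>m. c m \<in> D" "\<And>m. dist x (c m) < (1/2) ^ m" by metis
      have tA: "t \<in> A (c m) m" for m using t x c(2)[of m] by (auto simp: A_def dist_commute)
      have "(\<lambda>m. s (c m) m t - x) \<longlonglongrightarrow> 0"
      proof (rule Lim_null_comparison)
        \<comment> \<open>The selection is within two units of (1/2)^m of the centre, and the centre
          within one unit of \<open>x\<close>.\<close>
        show "\<forall>\<^sub>F m in sequentially. norm (s (c m) m t - x) \<le> 3 * (1/2) ^ m"
        proof (intro always_eventually allI)
          fix m show "norm (s (c m) m t - x) \<le> 3 * (1/2) ^ m"
            using s(2)[OF tA[of m]] c(2)[of m] dist_triangle[of "s (c m) m t" x "c m"]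
            by (auto simp: dist_norm norm_minus_commute)
        qed
        show "(\<lambda>m. 3 * (1/2) ^ m :: real) \<longlonglongrightarrow> 0"
          by (intro tendsto_mult_right_zero LIMSEQ_realpow_zero) auto
      qed
      then have "(\<lambda>m. s (c m) m t) \<longlonglongrightarrow> x" by (rule LIM_zero_cancel)
      moreover have "isCont (Q t) x" using cont[OF t] by (simp add: continuous_on_eq_continuous_at)
      ultimately have "(\<lambda>m. Q t (s (c m) m t)) \<longlonglongrightarrow> Q t x" by (rule isCont_tendsto_compose[rotated])
      moreover have "Q t (s (c m) m t) \<le> Q t (u t)" for m using elim c(1) tA by blast
      ultimately show "Q t x \<le> Q t (u t)" by (intro LIMSEQ_le_const2) auto
    qed
  qed
qed

section \<open>Perturbations of an optimal process\<close>

locale optimal_delay_process =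
  fixes \<alpha> \<beta> T h L L1 :: real
    and f :: "real \<Rightarrow> real^'n \<Rightarrow> real^'n \<Rightarrow> real^'r \<Rightarrow> real^'n"
    and f0 :: "real \<Rightarrow> real^'n \<Rightarrow> real^'n \<Rightarrow> real^'r \<Rightarrow> real"
    and \<Phi> :: "real^'n \<Rightarrow> real"
    and U :: "real \<Rightarrow> (real^'r) set"
    and y0 :: "real^'n"
    and \<phi> :: "real \<Rightarrow> real^'n"
    and u :: "real \<Rightarrow> real^'r"
    and y \<Psi> :: "real \<Rightarrow> real^'n"
  assumes a: "0 < \<alpha>" "\<alpha> < 1" and ab: "\<alpha> \<le> \<beta>" and T: "0 < T" and h: "0 < h"
    and L: "0 < L" "lipschitz_with_growth T L f" "lipschitz_with_growth T L f0"
    and L1: "0 < L1" "smooth_data T L1 f" "smooth_data T L1 f0"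
    and \<Phi>: "continuously_differentiable \<Phi>"
    and \<phi>: "\<phi> \<in> borel_measurable (lebesgue_on {-h..<0})"
    and opt: "optimal_process \<alpha> \<beta> T h f f0 \<Phi> U y0 \<phi> u y"
    and conj: "conjugate_solution \<alpha> \<beta> T h f f0 \<Phi> u y \<Psi>"
begin

section \<open>Measurability along the optimal process\<close>

lemma beta_pos: "0 < \<beta>" using a ab by simp
lemma Gamma_alpha_pos: "0 < Gamma \<alpha>" using a by (simp add: Gamma_real_pos)
lemma Gamma_beta_pos: "0 < Gamma \<beta>" using beta_pos by (simp add: Gamma_real_pos)

lemma costed: "(u, y) \<in> costed_processes \<alpha> \<beta> T h f f0 U y0 \<phi>"
  using opt by (simp add: optimal_process_def)

lemma admissible: "admissible_process \<alpha> T h f U y0 \<phi> u y"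
  using costed by (simp add: costed_processes_def)

lemma control_u: "is_control T U u" using admissible by (simp add: admissible_process_def)

text \<open>A cut-off state that is Lebesgue measurable on the whole line; \<open>y\<close> itself
  is arbitrary outside the interval from \<open>- h\<close> to \<open>T\<close>.\<close>

definition ybar :: "real \<Rightarrow> real^'n" where "ybar t = indicator {-h..T} t *\<^sub>R y t"

lemma control_measurable:
  "is_control T U v \<Longrightarrow> (\<lambda>t. indicator {0..T} t *\<^sub>R v t) \<in> borel_measurable lebesgue"
  by (subst borel_measurable_lebesgue_on_iff[symmetric]) (auto simp: is_control_def)

text \<open>From time 0 on, the state is a constant plus the fractional integral of a measurable
  function; before 0 it is \<phi>, whose measurability is a hypothesis.\<close>

lemma ybar_measurable: "ybar \<in> borel_measurable lebesgue"
proof -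
  obtain g where g: "has_caputo_derivative \<alpha> T y g" using admissible by (auto simp: admissible_process_def)
  have gm: "(\<lambda>t. indicator {0..T} t *\<^sub>R g t) \<in> borel_measurable lebesgue"
    by (subst borel_measurable_lebesgue_on_iff[symmetric])
       (use g in \<open>auto simp: has_caputo_derivative_def Linfty_def\<close>)
  have \<phi>m: "(\<lambda>t. indicator {-h..<0} t *\<^sub>R \<phi> t) \<in> borel_measurable lebesgue"
    by (subst borel_measurable_lebesgue_on_iff[symmetric]) (use \<phi> in auto)
  define c where "c t = (LINT \<tau>|lebesgue. rl_kernel \<alpha> (t - \<tau>) *\<^sub>R (indicator {0..T} \<tau> *\<^sub>R g \<tau>))" for t
  have cm: "c \<in> borel_measurable lebesgue"
    using rl_convolution_measurable[OF gm, of \<alpha>] by (simp only: c_def[abs_def])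
  have y0: "y 0 = y0" using admissible by (simp add: admissible_process_def)
  have yt: "y t = y0 + (1 / Gamma \<alpha>) *\<^sub>R c t" if "t \<in> {0..T}" for t
  proof -
    have "y t = y 0 + (1 / Gamma \<alpha>) *\<^sub>R
        set_lebesgue_integral lebesgue {0..t} (\<lambda>\<tau>. (t - \<tau>) powr (\<alpha> - 1) *\<^sub>R g \<tau>)"
      using g that unfolding has_caputo_derivative_def by blast
    then show ?thesis
      using that by (simp only: y0 c_def set_integral_eq_rl_convolution[of t T] atLeastAtMost_iff)
  qed
  have y\<phi>: "y t = \<phi> t" if "t \<in> {-h..<0}" for t
    using admissible that by (simp add: admissible_process_def)
  have "ybar = (\<lambda>t. indicator {-h..<0} t *\<^sub>R \<phi> t + indicator {0..T} t *\<^sub>R (y0 + (1 / Gamma \<alpha>) *\<^sub>R c t))"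
  proof
    fix t
    show "ybar t = indicator {-h..<0} t *\<^sub>R \<phi> t + indicator {0..T} t *\<^sub>R (y0 + (1 / Gamma \<alpha>) *\<^sub>R c t)"
    proof -
      consider "t \<in> {-h..<0}" | "t \<in> {0..T}" | "t \<notin> {-h..T}" using h T unfolding atLeastAtMost_iff atLeastLessThan_iff by linarith
      then show ?thesis
      proof cases
        case 1
        then have "t \<in> {-h..T}" "t \<notin> {0..T}" using T by auto
        then show ?thesis using y\<phi>[OF 1] 1 by (simp only: ybar_def indicator_simps) simp
      next
        case 2
        then have "t \<in> {-h..T}" "t \<notin> {-h..<0}" using h by auto
        then show ?thesis using yt[OF 2] 2 by (simp only: ybar_def indicator_simps) simp
      next
        case 3
        then have "t \<notin> {0..T}" "t \<notin> {-h..<0}" using h T by auto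
        then show ?thesis using 3 by (simp only: ybar_def indicator_simps) simp
      qed
    qed
  qed
  also have "\<dots> \<in> borel_measurable lebesgue"
    by (intro borel_measurable_add[OF \<phi>m] borel_measurable_scaleR borel_measurable_indicator borel_measurable_const_scaleR
        borel_measurable_const borel_measurable_add cm) auto
  finally show ?thesis .
qed

lemma ybar_eq: "t \<in> {0..T} \<Longrightarrow> ybar t = y t" "t \<in> {0..T} \<Longrightarrow> ybar (t - h) = y (t - h)"
  using h T by (auto simp: ybar_def indicator_def)

lemma composition_measurable:
  fixes d :: "real \<Rightarrow> real^'n \<Rightarrow> real^'n \<Rightarrow> real^'r \<Rightarrow> 'c::euclidean_space"
  assumes "lipschitz_with_growth T L d" "smooth_data T L1 d" "is_control T U v"
    and d: "d1 \<in> borel_measurable lebesgue" "d2 \<in> borel_measurable lebesgue"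
  shows "(\<lambda>t. indicator {0..T} t *\<^sub>R d t (y t + d1 t) (y (t - h) + d2 t) (v t)) \<in> borel_measurable lebesgue"
proof -
  have "(\<lambda>t. indicator {0..T} t *\<^sub>R d t (ybar t + d1 t) (ybar (t - h) + d2 t) (indicator {0..T} t *\<^sub>R v t)) \<in> borel_measurable lebesgue"
    using assms(2) by (intro data_composition_measurable[OF assms(1)] borel_measurable_add d ybar_measurable
       measurable_shift_lebesgue control_measurable assms(3)) (auto simp: smooth_data_def)
  also have "(\<lambda>t. indicator {0..T} t *\<^sub>R d t (ybar t + d1 t) (ybar (t - h) + d2 t) (indicator {0..T} t *\<^sub>R v t))
    = (\<lambda>t. indicator {0..T} t *\<^sub>R d t (y t + d1 t) (y (t - h) + d2 t) (v t))"
    by (auto simp: fun_eq_iff indicator_def ybar_eq)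
  finally show ?thesis .
qed

section \<open>Perturbed processes and their cost\<close>

lemma lipschitz_increment:
  assumes "lipschitz_with_growth T L d" "t \<in> {0..T}"
  shows "norm (d t z z' w - d t x x' v) \<le> L * (norm (z - x) + norm (z' - x') + norm (w - v))"
  using assms by (auto simp: lipschitz_with_growth_def)

text \<open>Used for both \<open>f\<close> and \<open>f0\<close>. With \<open>f\<close>, the
  requirement that \<delta> be the fractional integral of this function is the state equation of the
  perturbed state minus that of \<open>y\<close>.\<close>

definition increment :: "(real \<Rightarrow> real^'n \<Rightarrow> real^'n \<Rightarrow> real^'r \<Rightarrow> 'c) \<Rightarrow> (real \<Rightarrow> real^'r) \<Rightarrow> (real \<Rightarrow> real^'n) \<Rightarrow> real \<Rightarrow> 'c::real_normed_vector" where
  "increment d v \<delta> t = indicator {0..T} t *\<^sub>R (d t (y t + \<delta> t) (y (t - h) + \<delta> (t - h)) (v t) - d t (y t) (y (t - h)) (u t))"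

lemma increment_measurable:
  fixes d :: "real \<Rightarrow> real^'n \<Rightarrow> real^'n \<Rightarrow> real^'r \<Rightarrow> 'c::euclidean_space"
  assumes "lipschitz_with_growth T L d" "smooth_data T L1 d" "is_control T U v"
    and "\<delta> \<in> borel_measurable lebesgue"
  shows "increment d v \<delta> \<in> borel_measurable lebesgue"
proof -
  have "(\<lambda>t. indicator {0..T} t *\<^sub>R d t (y t + \<delta> t) (y (t - h) + \<delta> (t - h)) (v t)
     - indicator {0..T} t *\<^sub>R d t (y t + 0) (y (t - h) + 0) (u t)) \<in> borel_measurable lebesgue"
    by (rule borel_measurable_diff[OF
          composition_measurable[OF assms(1-4) measurable_shift_lebesgue[OF assms(4)]]
          composition_measurable[OF assms(1,2) control_u]]) simp_all
  then show ?thesis by (simp add: increment_def[abs_def] scaleR_diff_right)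
qed

lemma increment_bound:
  assumes "lipschitz_with_growth T L d" "\<And>t. t \<le> T \<Longrightarrow> norm (\<delta> t) \<le> M"
    and "\<And>t. t \<in> {0..T} \<Longrightarrow> norm (v t - u t) \<le> R"
  shows "norm (increment d v \<delta> t) \<le> L * (2 * M + R) * indicator {0..T} t"
proof (cases "t \<in> {0..T}")
  case True
  have "norm (increment d v \<delta> t) \<le> L * (norm (\<delta> t) + norm (\<delta> (t - h)) + norm (v t - u t))"
    using lipschitz_increment[OF assms(1) True, of "y t + \<delta> t" "y (t - h) + \<delta> (t - h)" "v t" "y t" "y (t - h)" "u t"] True
    by (simp add: increment_def)
  also have "\<dots> \<le> L * (M + M + R)"
    using L assms(2)[of t] assms(2)[of "t - h"] assms(3)[OF True] True h
    by (intro mult_left_mono add_mono) auto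
  finally show ?thesis using True by simp
qed (simp add: increment_def)

text \<open>By linearity, a Caputo derivative of \<open>y\<close> plus the increment is one of the
  perturbed state. The perturbed cost integral exists because its integrand differs from the optimal
  one by a bounded function times an integrable kernel.\<close>

lemma perturbed_costed:
  assumes v: "is_control T U v" and \<delta>m: "\<delta> \<in> borel_measurable lebesgue"
    and \<delta>: "\<And>t. t \<le> T \<Longrightarrow> \<delta> t = (1 / Gamma \<alpha>) *\<^sub>R (LINT \<tau>|lebesgue. rl_kernel \<alpha> (t - \<tau>) *\<^sub>R increment f v \<delta> \<tau>)"
    and M: "\<And>t. t \<le> T \<Longrightarrow> norm (\<delta> t) \<le> M"
    and R: "\<And>t. t \<in> {0..T} \<Longrightarrow> norm (v t - u t) \<le> R"
  shows "(v, \<lambda>t. y t + \<delta> t) \<in> costed_processes \<alpha> \<beta> T h f f0 U y0 \<phi>"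
    and "integrable lebesgue (\<lambda>t. rl_kernel \<beta> (T - t) * increment f0 v \<delta> t)"
    and "cost \<beta> T h f0 \<Phi> v (\<lambda>t. y t + \<delta> t) - cost \<beta> T h f0 \<Phi> u y =
      \<Phi> (y T + \<delta> T) - \<Phi> (y T) + 1 / Gamma \<beta> * (LINT t|lebesgue. rl_kernel \<beta> (T - t) * increment f0 v \<delta> t)"
proof -
  let ?z = "\<lambda>t. y t + \<delta> t"
  let ?X = "increment f v \<delta>"
  have \<delta>0: "\<delta> t = 0" if "t \<le> 0" for t
    using that T by (subst \<delta>, simp, subst rl_convolution_nonpos) (auto simp: increment_def)
  have Xm: "?X \<in> borel_measurable lebesgue" and X0m: "increment f0 v \<delta> \<in> borel_measurable lebesgue"
    by (intro increment_measurable L L1 v \<delta>m)+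
  note Xb = increment_bound[where \<delta>=\<delta> and M=M and v=v and R=R, OF L(2) M R]
  note X0b = increment_bound[where \<delta>=\<delta> and M=M and v=v and R=R, OF L(3) M R]
  have M0: "0 \<le> M" using order_trans[OF norm_ge_zero M[of 0]] T by simp
  have R0: "0 \<le> R" using order_trans[OF norm_ge_zero R[of 0]] T by simp
  have C0: "0 \<le> L * (2 * M + R)" using L M0 R0 by simp
  have Xi: "integrable lebesgue (\<lambda>\<tau>. rl_kernel \<alpha> (t - \<tau>) *\<^sub>R ?X \<tau>)" for t
  proof (rule integrable_rl_kernel_bounded[OF a(1) Xm])
    show "norm (?X \<tau>) \<le> L * (2 * M + R) * indicator {0..} \<tau>" for \<tau>
      using Xb[of \<tau>] C0 by (cases "\<tau> \<in> {0..T}") (auto simp: indicator_def split: if_splits)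
  qed
  obtain g where g: "has_caputo_derivative \<alpha> T y g"
      "AE t in lebesgue_on {0..T}. g t = f t (y t) (y (t - h)) (u t)"
    using admissible by (auto simp: admissible_process_def)
  then obtain C where C: "AE t in lebesgue_on {0..T}. norm (g t) \<le> C"
    and gm: "g \<in> borel_measurable (lebesgue_on {0..T})"
    by (auto simp: has_caputo_derivative_def Linfty_def)
  have gm': "(\<lambda>t. indicator {0..T} t *\<^sub>R g t) \<in> borel_measurable lebesgue"
    by (subst borel_measurable_lebesgue_on_iff[symmetric]) (use gm in auto)
  have "AE t in lebesgue. t \<in> {0..T} \<longrightarrow> norm (g t) \<le> C"
    using C by (subst (asm) AE_restrict_space_iff) auto
  then have "AE t in lebesgue. norm (indicator {0..T} t *\<^sub>R g t) \<le> \<bar>C\<bar> * indicator {0..} t"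
    by eventually_elim (auto simp: indicator_def)
  then have gi: "integrable lebesgue (\<lambda>\<tau>. rl_kernel \<alpha> (t - \<tau>) *\<^sub>R (indicator {0..T} \<tau> *\<^sub>R g \<tau>))" for t
    by (rule integrable_rl_kernel_AE_bounded[OF a(1) gm'])
  have cap: "has_caputo_derivative \<alpha> T ?z (\<lambda>t. g t + ?X t)"
    unfolding has_caputo_derivative_def Linfty_def
  proof (intro conjI ballI)
    show "(\<lambda>t. g t + ?X t) \<in> borel_measurable (lebesgue_on {0..T})"
      by (rule borel_measurable_add[OF gm measurable_restrict_space1[OF Xm]])
    show "\<exists>C. AE t in lebesgue_on {0..T}. norm (g t + ?X t) \<le> C"
    proof (rule exI, use C in eventually_elim)
      case (elim t)
      have "norm (?X t) \<le> L * (2 * M + R)"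
        using Xb[of t] C0 by (cases "t \<in> {0..T}") auto
      then show "norm (g t + ?X t) \<le> C + L * (2 * M + R)"
        by (intro order_trans[OF norm_triangle_ineq] add_mono elim)
    qed
    fix t assume t: "t \<in> {0..T}"
    have "set_lebesgue_integral lebesgue {0..t} (\<lambda>\<tau>. (t - \<tau>) powr (\<alpha> - 1) *\<^sub>R (g \<tau> + ?X \<tau>))
      = (LINT \<tau>|lebesgue. rl_kernel \<alpha> (t - \<tau>) *\<^sub>R (indicator {0..T} \<tau> *\<^sub>R (g \<tau> + ?X \<tau>)))"
      using t by (intro set_integral_eq_rl_convolution) auto
    also have "\<dots> = (LINT \<tau>|lebesgue. rl_kernel \<alpha> (t - \<tau>) *\<^sub>R (indicator {0..T} \<tau> *\<^sub>R g \<tau>) + rl_kernel \<alpha> (t - \<tau>) *\<^sub>R ?X \<tau>)"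
      by (rule Bochner_Integration.integral_cong[OF refl])
         (auto simp: increment_def indicator_def scaleR_add_right)
    also have "\<dots> = (LINT \<tau>|lebesgue. rl_kernel \<alpha> (t - \<tau>) *\<^sub>R (indicator {0..T} \<tau> *\<^sub>R g \<tau>))
       + (LINT \<tau>|lebesgue. rl_kernel \<alpha> (t - \<tau>) *\<^sub>R ?X \<tau>)"
      by (rule Bochner_Integration.integral_add[OF gi Xi])
    finally have "(1 / Gamma \<alpha>) *\<^sub>R set_lebesgue_integral lebesgue {0..t} (\<lambda>\<tau>. (t - \<tau>) powr (\<alpha> - 1) *\<^sub>R (g \<tau> + ?X \<tau>))
      = (1 / Gamma \<alpha>) *\<^sub>R set_lebesgue_integral lebesgue {0..t} (\<lambda>\<tau>. (t - \<tau>) powr (\<alpha> - 1) *\<^sub>R g \<tau>) + \<delta> t"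
      using t \<delta>[of t] set_integral_eq_rl_convolution[of t T \<alpha> g] by (simp add: scaleR_add_right)
    moreover have "y t = y 0 + (1 / Gamma \<alpha>) *\<^sub>R set_lebesgue_integral lebesgue {0..t} (\<lambda>\<tau>. (t - \<tau>) powr (\<alpha> - 1) *\<^sub>R g \<tau>)"
      using g(1) t unfolding has_caputo_derivative_def by blast
    ultimately show "y t + \<delta> t = y 0 + \<delta> 0 + (1 / Gamma \<alpha>) *\<^sub>R
        set_lebesgue_integral lebesgue {0..t} (\<lambda>\<tau>. (t - \<tau>) powr (\<alpha> - 1) *\<^sub>R (g \<tau> + ?X \<tau>))"
      using \<delta>0[of 0] by simp
  qed
  have "AE t in lebesgue_on {0..T}. g t + ?X t = f t (?z t) (?z (t - h)) (v t)"
    using g(2) AE_space by eventually_elim (auto simp: increment_def)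
  then have adm: "admissible_process \<alpha> T h f U y0 \<phi> v ?z"
    using cap v admissible \<delta>0 by (auto simp: admissible_process_def AC_infty_def)
  \<comment> \<open>At \<open>t = T\<close> the powers and the kernel all vanish, whatever \<beta>
    is, so the identity holds at every point.\<close>
  have rc: "indicator {0..T} t *\<^sub>R running_cost \<beta> T h f0 v ?z t =
      indicator {0..T} t *\<^sub>R running_cost \<beta> T h f0 u y t + rl_kernel \<beta> (T - t) * increment f0 v \<delta> t" for t
    by (cases "t = T") (auto simp: running_cost_def increment_def rl_kernel_def indicator_def algebra_simps)
  show i0: "integrable lebesgue (\<lambda>t. rl_kernel \<beta> (T - t) * increment f0 v \<delta> t)"
  proof -
    have "integrable lebesgue (\<lambda>\<tau>. rl_kernel \<beta> (T - \<tau>) *\<^sub>R increment f0 v \<delta> \<tau>)"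
    proof (rule integrable_rl_kernel_bounded[OF beta_pos X0m])
      show "norm (increment f0 v \<delta> \<tau>) \<le> L * (2 * M + R) * indicator {0..} \<tau>" for \<tau>
        using X0b[of \<tau>] C0 by (cases "\<tau> \<in> {0..T}") (auto simp: indicator_def split: if_splits)
    qed
    then show ?thesis by simp
  qed
  have iy: "integrable lebesgue (\<lambda>t. indicator {0..T} t *\<^sub>R running_cost \<beta> T h f0 u y t)"
    using costed by (simp add: costed_processes_def set_integrable_def)
  show "(v, ?z) \<in> costed_processes \<alpha> \<beta> T h f f0 U y0 \<phi>"
    using adm Bochner_Integration.integrable_add[OF iy i0]
    unfolding costed_processes_def set_integrable_def by (simp add: rc del: real_scaleR_def)
  show "cost \<beta> T h f0 \<Phi> v ?z - cost \<beta> T h f0 \<Phi> u y =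
      \<Phi> (y T + \<delta> T) - \<Phi> (y T) + 1 / Gamma \<beta> * (LINT t|lebesgue. rl_kernel \<beta> (T - t) * increment f0 v \<delta> t)"
    unfolding cost_def set_lebesgue_integral_def rc Bochner_Integration.integral_add[OF iy i0]
    by (simp add: algebra_simps)
qed

text \<open>The order of quantifiers matters: \<open>\<Lambda>\<close> is fixed before
  \<open>E\<close>, so the state moves in proportion to \<open>K\<close> while \<open>E\<close>
  varies. This is possible because the weight exponent \<open>l\<close> depends on the Lipschitz
  constant and the kernel, not on \<open>E\<close>.\<close>

lemma exists_perturbation:
  assumes v: "is_control T U v" and R: "\<And>t. t \<in> {0..T} \<Longrightarrow> norm (v t - u t) \<le> R"
  shows "\<exists>\<Lambda>>0. \<forall>E\<in>sets lebesgue. \<forall>K. E \<subseteq> {0..T} \<longrightarrow>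
     (\<forall>t\<le>T. (LINT \<tau>|lebesgue. rl_kernel \<alpha> (t - \<tau>) * indicator E \<tau>) \<le> K) \<longrightarrow>
     (\<exists>\<delta>. \<delta> \<in> borel_measurable lebesgue \<and> (\<forall>t\<le>T. norm (\<delta> t) \<le> \<Lambda> * K) \<and>
       (\<forall>t\<le>T. \<delta> t = (1 / Gamma \<alpha>) *\<^sub>R
         (LINT \<tau>|lebesgue. rl_kernel \<alpha> (t - \<tau>) *\<^sub>R increment f (\<lambda>t. if t \<in> E then v t else u t) \<delta> \<tau>)))"
proof -
  have R0: "0 \<le> R" using order_trans[OF norm_ge_zero R[of 0]] T by simp
  obtain l where l: "0 < l" "\<And>t. t \<le> T \<Longrightarrow> (LINT \<tau>|lebesgue. rl_kernel \<alpha> (t - \<tau>) * (indicator {0..T} \<tau> * exp (l * \<tau>)))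
            \<le> Gamma \<alpha> / (4 * L) * exp (l * t)"
    using rl_kernel_exp_weight[OF a(1) T, of "Gamma \<alpha> / (4 * L)"] Gamma_alpha_pos L by auto
  \<comment> \<open>The summand 1 keeps \<open>\<Lambda>\<close> positive when
    \<open>R = 0\<close>.\<close>
  define \<Lambda> where "\<Lambda> = 2 * (L * R) / Gamma \<alpha> * exp (l * T) + 1"
  have \<Lambda>: "0 < \<Lambda>" using L R0 Gamma_alpha_pos by (auto simp: \<Lambda>_def intro!: add_nonneg_pos)
  show ?thesis
  proof (intro exI[of _ \<Lambda>] conjI \<Lambda> ballI allI impI)
    fix E K
    assume E: "E \<in> sets lebesgue" "E \<subseteq> {0..T}"
      and K: "\<forall>t\<le>T. (LINT \<tau>|lebesgue. rl_kernel \<alpha> (t - \<tau>) * indicator E \<tau>) \<le> K"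
    have K0: "0 \<le> K"
      by (rule order_trans[OF _ K[rule_format, of 0]]) (use T in \<open>auto intro!: Bochner_Integration.integral_nonneg\<close>)
    let ?v = "\<lambda>t. if t \<in> E then v t else u t"
    have vE: "is_control T U ?v"
      using v E by (intro control_switch[OF control_u])
        (auto simp: is_control_def intro: bounded_subset)
    let ?G = "\<lambda>t x x'. f t (y t + x) (y (t - h) + x') (?v t) - f t (y t) (y (t - h)) (u t)"
    have "\<exists>d. d \<in> borel_measurable lebesgue \<and>
     (\<forall>t\<le>T. d t = (1 / Gamma \<alpha>) *\<^sub>R
        (LINT \<tau>|lebesgue. rl_kernel \<alpha> (t - \<tau>) *\<^sub>R (indicator {0..T} \<tau> *\<^sub>R ?G \<tau> (d \<tau>) (d (\<tau> - h))))) \<and>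
     (\<forall>t\<le>T. norm (d t) \<le> 2 * (L * R) * K / Gamma \<alpha> * exp (l * T))"
    proof (rule fractional_delay_equation[OF a(1) T h L(1) l(1) _ l(2) _ _ E])
      show "0 \<le> L * R" using L R0 by simp
      show "norm (?G t x x' - ?G t z z') \<le> L * (norm (x - z) + norm (x' - z'))" if "t \<in> {0..T}" for t x x' z z'
        using lipschitz_increment[OF L(2) that, of "y t + x" "y (t - h) + x'" "?v t" "y t + z" "y (t - h) + z'" "?v t"] by simp
      show "(\<lambda>t. indicator {0..T} t *\<^sub>R ?G t (d1 t) (d2 t)) \<in> borel_measurable lebesgue"
        if d: "d1 \<in> borel_measurable lebesgue" "d2 \<in> borel_measurable lebesgue" for d1 d2
      proof -
        have "(\<lambda>t. indicator {0..T} t *\<^sub>R f t (y t + d1 t) (y (t - h) + d2 t) (?v t)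
            - indicator {0..T} t *\<^sub>R f t (y t + 0) (y (t - h) + 0) (u t)) \<in> borel_measurable lebesgue"
          by (rule borel_measurable_diff[OF composition_measurable[OF L(2) L1(2) vE d]
                composition_measurable[OF L(2) L1(2) control_u]]) simp_all
        then show ?thesis by (simp only: scaleR_diff_right add_0_right)
      qed
      \<comment> \<open>At zero perturbation only the change of control drives the equation, and it
        happens on \<open>E\<close>.\<close>
      show "norm (?G t 0 0) \<le> L * R * indicator E t" if "t \<in> {0..T}" for t
      proof (cases "t \<in> E")
        case True
        have "norm (?G t 0 0) \<le> L * norm (v t - u t)"
          using lipschitz_increment[OF L(2) that, of "y t" "y (t - h)" "v t" "y t" "y (t - h)" "u t"] True by simp
        also have "\<dots> \<le> L * R" using L R[OF that] by (intro mult_left_mono) auto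
        finally show ?thesis using True by simp
      qed simp
      show "(LINT \<tau>|lebesgue. rl_kernel \<alpha> (t - \<tau>) * indicator E \<tau>) \<le> K" if "t \<le> T" for t
        using K that by blast
    qed
    then obtain d where d: "d \<in> borel_measurable lebesgue"
     "\<And>t. t \<le> T \<Longrightarrow> d t = (1 / Gamma \<alpha>) *\<^sub>R
        (LINT \<tau>|lebesgue. rl_kernel \<alpha> (t - \<tau>) *\<^sub>R (indicator {0..T} \<tau> *\<^sub>R ?G \<tau> (d \<tau>) (d (\<tau> - h))))"
     "\<And>t. t \<le> T \<Longrightarrow> norm (d t) \<le> 2 * (L * R) * K / Gamma \<alpha> * exp (l * T)" by blast
    have "2 * (L * R) * K / Gamma \<alpha> * exp (l * T) \<le> \<Lambda> * K"
      using K0 by (simp add: \<Lambda>_def algebra_simps)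
    then show "\<exists>\<delta>. \<delta> \<in> borel_measurable lebesgue \<and> (\<forall>t\<le>T. norm (\<delta> t) \<le> \<Lambda> * K) \<and>
       (\<forall>t\<le>T. \<delta> t = (1 / Gamma \<alpha>) *\<^sub>R
         (LINT \<tau>|lebesgue. rl_kernel \<alpha> (t - \<tau>) *\<^sub>R increment f (\<lambda>t. if t \<in> E then v t else u t) \<delta> \<tau>))"
      using d by (intro exI[of _ d]) (auto simp: increment_def[abs_def] intro: order_trans)
  qed
qed

section \<open>The costate and the adjoint identity\<close>

definition terminal_gradient :: "real^'n" where "terminal_gradient = gradient \<Phi> (y T)"

text \<open>The adjoint equation integrates this against the kernel. The open interval drops the
  endpoints, so that \<open>costate_form\<close> applies on the whole support.\<close>

definition state_source :: "real \<Rightarrow> real^'n" where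
  "state_source \<tau> = indicator {0<..<T} \<tau> *\<^sub>R (rl_kernel \<alpha> (T - \<tau>) *\<^sub>R H_y \<alpha> \<beta> T f f0 \<tau> (y \<tau>) (y (\<tau> - h)) (u \<tau>) (\<Psi> \<tau>))"

text \<open>The support starts at \<open>h\<close>: before that time the delayed state belongs to
  the fixed initial function and is not perturbed.\<close>

definition delayed_source :: "real \<Rightarrow> real^'n" where
  "delayed_source \<tau> = indicator {h<..<T} \<tau> *\<^sub>R (rl_kernel \<alpha> (T - \<tau>) *\<^sub>R H_yh \<alpha> \<beta> T f f0 \<tau> (y \<tau>) (y (\<tau> - h)) (u \<tau>) (\<Psi> \<tau>))"

text \<open>On \<open>[0,T)\<close> this is \<open>(T - t) powr (\<alpha> - 1) * \<Psi> t / \<Gamma>(\<alpha>)\<close> (see \<open>costate_eq\<close>); the form through the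
  adjoint integrals is the one that Fubini applies to.\<close>

definition costate :: "real \<Rightarrow> real^'n" where
  "costate t = (1 / Gamma \<alpha>) *\<^sub>R (- (rl_kernel \<alpha> (T - t) *\<^sub>R terminal_gradient)
     + (1 / Gamma \<alpha>) *\<^sub>R (LINT \<tau>|lebesgue. rl_kernel \<alpha> (\<tau> - 0 - t) *\<^sub>R state_source \<tau>)
     + (1 / Gamma \<alpha>) *\<^sub>R (LINT \<tau>|lebesgue. rl_kernel \<alpha> (\<tau> - h - t) *\<^sub>R delayed_source \<tau>))"

definition cost_weight :: "real \<Rightarrow> real" where "cost_weight t = rl_kernel \<beta> (T - t) / Gamma \<beta>"

lemma cost_weight_nonneg: "0 \<le> cost_weight t" using Gamma_beta_pos by (simp add: cost_weight_def)

lemma conjugate_at: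
  assumes t: "t \<in> {0..T}"
  shows "set_integrable lebesgue {t..T} (\<lambda>\<tau>. ((T - \<tau>) powr (\<alpha> - 1) * (\<tau> - t) powr (\<alpha> - 1)) *\<^sub>R
                    H_y \<alpha> \<beta> T f f0 \<tau> (y \<tau>) (y (\<tau> - h)) (u \<tau>) (\<Psi> \<tau>))" (is "set_integrable _ _ ?K1")
    and "set_integrable lebesgue {t+h..T} (\<lambda>\<tau>. ((T - \<tau>) powr (\<alpha> - 1) * (\<tau> - t - h) powr (\<alpha> - 1)) *\<^sub>R
                    H_yh \<alpha> \<beta> T f f0 \<tau> (y \<tau>) (y (\<tau> - h)) (u \<tau>) (\<Psi> \<tau>))" (is "set_integrable _ _ ?K2")
    and "\<Psi> t = - terminal_gradient
             + ((T - t) powr (1 - \<alpha>) / Gamma \<alpha>) *\<^sub>R (LINT \<tau>|lebesgue. rl_kernel \<alpha> (\<tau> - 0 - t) *\<^sub>R state_source \<tau>)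
             + ((T - t) powr (1 - \<alpha>) / Gamma \<alpha>) *\<^sub>R (LINT \<tau>|lebesgue. rl_kernel \<alpha> (\<tau> - h - t) *\<^sub>R delayed_source \<tau>)"
proof -
  have c: "set_integrable lebesgue {t..T} ?K1 \<and> set_integrable lebesgue {t+h..T} ?K2 \<and>
     \<Psi> t = - gradient \<Phi> (y T)
             + ((T - t) powr (1 - \<alpha>) / Gamma \<alpha>) *\<^sub>R set_lebesgue_integral lebesgue {t..T} ?K1
             + ((T - t) powr (1 - \<alpha>) / Gamma \<alpha>) *\<^sub>R set_lebesgue_integral lebesgue {t+h..T} ?K2"
    using conj t unfolding conjugate_solution_def Let_def by blast
  then show "set_integrable lebesgue {t..T} ?K1" "set_integrable lebesgue {t+h..T} ?K2" by blast+
  \<comment> \<open>The closed intervals of the conjugate problem and the open ones of the sources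
    agree at every \<tau>, since at the endpoints \<open>0 powr (\<alpha> - 1) = 0\<close>.\<close>
  have k: "indicator {t..T} \<tau> * ((T - \<tau>) powr (\<alpha> - 1) * (\<tau> - t) powr (\<alpha> - 1))
      = rl_kernel \<alpha> (\<tau> - 0 - t) * (indicator {0<..<T} \<tau> * rl_kernel \<alpha> (T - \<tau>))"
    "indicator {t+h..T} \<tau> * ((T - \<tau>) powr (\<alpha> - 1) * (\<tau> - t - h) powr (\<alpha> - 1))
      = rl_kernel \<alpha> (\<tau> - h - t) * (indicator {h<..<T} \<tau> * rl_kernel \<alpha> (T - \<tau>))" for \<tau>
  proof -
    show "indicator {t..T} \<tau> * ((T - \<tau>) powr (\<alpha> - 1) * (\<tau> - t) powr (\<alpha> - 1))
      = rl_kernel \<alpha> (\<tau> - 0 - t) * (indicator {0<..<T} \<tau> * rl_kernel \<alpha> (T - \<tau>))"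
      using t by (cases "\<tau> = t"; cases "\<tau> = T") (auto simp: rl_kernel_def indicator_def)
    show "indicator {t+h..T} \<tau> * ((T - \<tau>) powr (\<alpha> - 1) * (\<tau> - t - h) powr (\<alpha> - 1))
      = rl_kernel \<alpha> (\<tau> - h - t) * (indicator {h<..<T} \<tau> * rl_kernel \<alpha> (T - \<tau>))"
      using t by (cases "\<tau> = t + h"; cases "\<tau> = T") (auto simp: rl_kernel_def indicator_def algebra_simps)
  qed
  have "set_lebesgue_integral lebesgue {t..T} ?K1 = (LINT \<tau>|lebesgue. rl_kernel \<alpha> (\<tau> - 0 - t) *\<^sub>R state_source \<tau>)"
    "set_lebesgue_integral lebesgue {t+h..T} ?K2 = (LINT \<tau>|lebesgue. rl_kernel \<alpha> (\<tau> - h - t) *\<^sub>R delayed_source \<tau>)"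
    unfolding set_lebesgue_integral_def state_source_def delayed_source_def scaleR_scaleR k by (rule refl)+
  with c show "\<Psi> t = - terminal_gradient
             + ((T - t) powr (1 - \<alpha>) / Gamma \<alpha>) *\<^sub>R (LINT \<tau>|lebesgue. rl_kernel \<alpha> (\<tau> - 0 - t) *\<^sub>R state_source \<tau>)
             + ((T - t) powr (1 - \<alpha>) / Gamma \<alpha>) *\<^sub>R (LINT \<tau>|lebesgue. rl_kernel \<alpha> (\<tau> - h - t) *\<^sub>R delayed_source \<tau>)"
    by (simp only: terminal_gradient_def)
qed

text \<open>Cancels the singular factor (\<tau> - s)^(\<alpha> - 1) by its reciprocal, which is
  bounded on the support. Applied to the conjugate problem at t = 0, with \<open>s\<close> equal to
  0 and to \<open>h\<close>, it makes the two sources integrable.\<close>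

lemma integrable_unweighted:
  assumes K: "integrable lebesgue K" and s: "0 \<le> s" and supp: "\<And>\<tau>. \<tau> \<notin> {s..T} \<Longrightarrow> K \<tau> = (0 :: real^'n)"
  shows "integrable lebesgue (\<lambda>\<tau>. (\<tau> - s) powr (1 - \<alpha>) *\<^sub>R K \<tau>)"
proof (rule Bochner_Integration.integrable_bound)
  show "integrable lebesgue (\<lambda>\<tau>. T powr (1 - \<alpha>) *\<^sub>R K \<tau>)" using K by simp
  have "(\<lambda>\<tau>. (\<tau> - s) powr (1 - \<alpha>)) \<in> borel_measurable lebesgue"
    by (rule measurable_completion) measurable
  then show "(\<lambda>\<tau>. (\<tau> - s) powr (1 - \<alpha>) *\<^sub>R K \<tau>) \<in> borel_measurable lebesgue"
    using K by (intro borel_measurable_scaleR) auto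
  have "norm ((\<tau> - s) powr (1 - \<alpha>) *\<^sub>R K \<tau>) \<le> norm (T powr (1 - \<alpha>) *\<^sub>R K \<tau>)" for \<tau>
  proof (cases "\<tau> \<in> {s..T}")
    case True
    then have "(\<tau> - s) powr (1 - \<alpha>) \<le> T powr (1 - \<alpha>)"
      using s a by (intro powr_mono2) auto
    then show ?thesis by (simp add: mult_right_mono)
  qed (simp add: supp)
  then show "AE \<tau> in lebesgue. norm ((\<tau> - s) powr (1 - \<alpha>) *\<^sub>R K \<tau>) \<le> norm (T powr (1 - \<alpha>) *\<^sub>R K \<tau>)" by simp
qed

lemma state_source_integrable: "integrable lebesgue state_source"
proof -
  let ?H = "\<lambda>\<tau>. H_y \<alpha> \<beta> T f f0 \<tau> (y \<tau>) (y (\<tau> - h)) (u \<tau>) (\<Psi> \<tau>)"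
  have 0: "(0::real) \<in> {0..T}" using T by simp
  have "integrable lebesgue (\<lambda>\<tau>. indicator {0..T} \<tau> *\<^sub>R (((T - \<tau>) powr (\<alpha> - 1) * (\<tau> - 0) powr (\<alpha> - 1)) *\<^sub>R ?H \<tau>))"
    using conjugate_at(1)[OF 0] by (simp only: set_integrable_def)
  from integrable_unweighted[OF this, of 0]
  have "integrable lebesgue (\<lambda>\<tau>. (\<tau> - 0) powr (1 - \<alpha>) *\<^sub>R (indicator {0..T} \<tau> *\<^sub>R (((T - \<tau>) powr (\<alpha> - 1) * (\<tau> - 0) powr (\<alpha> - 1)) *\<^sub>R ?H \<tau>)))"
    by simp
  moreover have "(\<tau> - 0) powr (1 - \<alpha>) * (indicator {0..T} \<tau> * ((T - \<tau>) powr (\<alpha> - 1) * (\<tau> - 0) powr (\<alpha> - 1)))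
      = indicator {0<..<T} \<tau> * rl_kernel \<alpha> (T - \<tau>)" for \<tau>
    by (cases "\<tau> = 0"; cases "\<tau> = T") (auto simp: rl_kernel_def indicator_def powr_add[symmetric])
  ultimately show ?thesis unfolding state_source_def[abs_def] scaleR_scaleR by simp
qed

lemma delayed_source_integrable: "integrable lebesgue delayed_source"
proof -
  let ?H = "\<lambda>\<tau>. H_yh \<alpha> \<beta> T f f0 \<tau> (y \<tau>) (y (\<tau> - h)) (u \<tau>) (\<Psi> \<tau>)"
  have 0: "(0::real) \<in> {0..T}" using T by simp
  have "integrable lebesgue (\<lambda>\<tau>. indicator {h..T} \<tau> *\<^sub>R (((T - \<tau>) powr (\<alpha> - 1) * (\<tau> - h) powr (\<alpha> - 1)) *\<^sub>R ?H \<tau>))"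
    using conjugate_at(2)[OF 0] by (simp only: set_integrable_def add_0_left diff_0_right)
  from integrable_unweighted[OF this, of h]
  have "integrable lebesgue (\<lambda>\<tau>. (\<tau> - h) powr (1 - \<alpha>) *\<^sub>R (indicator {h..T} \<tau> *\<^sub>R (((T - \<tau>) powr (\<alpha> - 1) * (\<tau> - h) powr (\<alpha> - 1)) *\<^sub>R ?H \<tau>)))"
    using h by simp
  moreover have "(\<tau> - h) powr (1 - \<alpha>) * (indicator {h..T} \<tau> * ((T - \<tau>) powr (\<alpha> - 1) * (\<tau> - h) powr (\<alpha> - 1)))
      = indicator {h<..<T} \<tau> * rl_kernel \<alpha> (T - \<tau>)" for \<tau>
    by (cases "\<tau> = h"; cases "\<tau> = T") (auto simp: rl_kernel_def indicator_def powr_add[symmetric])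
  ultimately show ?thesis unfolding delayed_source_def[abs_def] scaleR_scaleR by simp
qed

lemma source_zero: "T < \<tau> \<Longrightarrow> state_source \<tau> = 0" "T < \<tau> \<Longrightarrow> delayed_source \<tau> = 0"
  by (auto simp: state_source_def delayed_source_def)

text \<open>For t < T the weight (T - t)^(\<alpha> - 1) cancels the prefactor (T - t)^(1 - \<alpha>)
  of the adjoint integrals.\<close>

lemma costate_eq:
  assumes t: "t \<in> {0..<T}"
  shows "costate t = (rl_kernel \<alpha> (T - t) / Gamma \<alpha>) *\<^sub>R \<Psi> t"
proof -
  have "t \<in> {0..T}" using t by simp
  note c = conjugate_at(3)[OF this]
  have k: "rl_kernel \<alpha> (T - t) * (T - t) powr (1 - \<alpha>) = 1"
    using t by (simp add: rl_kernel_def powr_add[symmetric])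
  have "(rl_kernel \<alpha> (T - t) / Gamma \<alpha>) * ((T - t) powr (1 - \<alpha>) / Gamma \<alpha>) = (1 / Gamma \<alpha>) * (1 / Gamma \<alpha>)"
    using k by simp
  then show ?thesis
    unfolding c costate_def scaleR_add_right scaleR_scaleR using Gamma_alpha_pos by simp
qed

lemma costate_integrable: "integrable lebesgue (\<lambda>t. indicator {0..T} t *\<^sub>R costate t)"
proof -
  have "integrable lebesgue (\<lambda>t. rl_kernel \<alpha> (T - t) *\<^sub>R (indicator {0..T} t *\<^sub>R terminal_gradient))"
  proof (rule integrable_rl_kernel_bounded[OF a(1), where B="norm terminal_gradient" and s=0])
    show "(\<lambda>t. indicator {0..T} t *\<^sub>R terminal_gradient) \<in> borel_measurable lebesgue"
      by (intro borel_measurable_scaleR borel_measurable_indicator) auto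
  qed (auto simp: indicator_def)
  moreover note integrable_rl_adjoint(1)[OF a(1) less_imp_le[OF T] order_refl state_source_integrable source_zero(1)]
    integrable_rl_adjoint(1)[OF a(1) less_imp_le[OF T] less_imp_le[OF h] delayed_source_integrable source_zero(2)]
  ultimately have "integrable lebesgue (\<lambda>t. (1 / Gamma \<alpha>) *\<^sub>R
      (- (rl_kernel \<alpha> (T - t) *\<^sub>R (indicator {0..T} t *\<^sub>R terminal_gradient))
       + (1 / Gamma \<alpha>) *\<^sub>R (indicator {0..T} t *\<^sub>R (LINT \<tau>|lebesgue. rl_kernel \<alpha> (\<tau> - 0 - t) *\<^sub>R state_source \<tau>))
       + (1 / Gamma \<alpha>) *\<^sub>R (indicator {0..T} t *\<^sub>R (LINT \<tau>|lebesgue. rl_kernel \<alpha> (\<tau> - h - t) *\<^sub>R delayed_source \<tau>))))"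
    by (intro integrable_scaleR_right Bochner_Integration.integrable_add Bochner_Integration.integrable_minus) auto
  then show ?thesis
    by (rule Bochner_Integration.integrable_cong[THEN iffD1, rotated 2])
       (auto simp: costate_def indicator_def)
qed

lemma cost_weight_integrable: "integrable lebesgue (\<lambda>t. indicator {0..T} t * cost_weight t)"
proof -
  have "integrable lebesgue (\<lambda>t. rl_kernel \<beta> (T - t) *\<^sub>R (indicator {0..T} t :: real))"
    by (rule integrable_rl_kernel_bounded[OF beta_pos borel_measurable_indicator, where B=1 and s=0])
       (auto simp: indicator_def)
  then have "integrable lebesgue (\<lambda>t. (1 / Gamma \<beta>) * (rl_kernel \<beta> (T - t) *\<^sub>R (indicator {0..T} t :: real)))"
    by (rule integrable_mult_right)
  then show ?thesis by (simp add: cost_weight_def mult.commute)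
qed

lemma H_has_derivative:
  assumes t: "t \<in> {0..T}"
  shows "H_y \<alpha> \<beta> T f f0 t z z' w p \<bullet> k = p \<bullet> deriv_state f t z z' w k
      - Gamma \<alpha> / Gamma \<beta> * (T - t) powr (\<beta> - \<alpha>) * deriv_state f0 t z z' w k"
    and "H_yh \<alpha> \<beta> T f f0 t z z' w p \<bullet> k = p \<bullet> deriv_delayed f t z z' w k
      - Gamma \<alpha> / Gamma \<beta> * (T - t) powr (\<beta> - \<alpha>) * deriv_delayed f0 t z z' w k"
proof -
  note D = smooth_data_has_derivative[OF L1(2) t] and D0 = smooth_data_has_derivative[OF L1(3) t]
  show "H_y \<alpha> \<beta> T f f0 t z z' w p \<bullet> k = p \<bullet> deriv_state f t z z' w k
      - Gamma \<alpha> / Gamma \<beta> * (T - t) powr (\<beta> - \<alpha>) * deriv_state f0 t z z' w k"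
    unfolding H_y_def Hamiltonian_def
    by (rule gradient_inner) (intro has_derivative_diff has_derivative_inner_right has_derivative_mult_right D D0)
  show "H_yh \<alpha> \<beta> T f f0 t z z' w p \<bullet> k = p \<bullet> deriv_delayed f t z z' w k
      - Gamma \<alpha> / Gamma \<beta> * (T - t) powr (\<beta> - \<alpha>) * deriv_delayed f0 t z z' w k"
    unfolding H_yh_def Hamiltonian_def
    by (rule gradient_inner) (intro has_derivative_diff has_derivative_inner_right has_derivative_mult_right D D0)
qed

text \<open>The factor (T - t)^(\<beta> - \<alpha>) in the Hamiltonian is made for this: times (T -
  t)^(\<alpha> - 1) it becomes the kernel of the cost. The identity is used for the Hamiltonian and
  for both of its gradients.\<close>

lemma costate_form:
  assumes t: "t \<in> {0..<T}"
  shows "rl_kernel \<alpha> (T - t) / Gamma \<alpha> * (\<Psi> t \<bullet> x - Gamma \<alpha> / Gamma \<beta> * (T - t) powr (\<beta> - \<alpha>) * r) = costate t \<bullet> x - cost_weight t * r"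
proof -
  have "rl_kernel \<alpha> (T - t) * (T - t) powr (\<beta> - \<alpha>) = rl_kernel \<beta> (T - t)"
    using t by (simp add: rl_kernel_def powr_add[symmetric])
  then have "rl_kernel \<alpha> (T - t) / Gamma \<alpha> * (Gamma \<alpha> / Gamma \<beta> * (T - t) powr (\<beta> - \<alpha>) * r) = cost_weight t * r"
    using Gamma_alpha_pos Gamma_beta_pos by (simp add: cost_weight_def field_simps)
  then show ?thesis by (simp add: costate_eq[OF t] right_diff_distrib)
qed

lemma state_source_inner:
  assumes t: "t \<in> {0<..<T}"
  shows "1 / Gamma \<alpha> * (state_source t \<bullet> k) = costate t \<bullet> deriv_state f t (y t) (y (t - h)) (u t) k - cost_weight t * deriv_state f0 t (y t) (y (t - h)) (u t) k"
proof -
  have t': "t \<in> {0..T}" "t \<in> {0..<T}" using t by auto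
  show ?thesis
  proof -
    have "1 / Gamma \<alpha> * (state_source t \<bullet> k) = rl_kernel \<alpha> (T - t) / Gamma \<alpha> * (H_y \<alpha> \<beta> T f f0 t (y t) (y (t - h)) (u t) (\<Psi> t) \<bullet> k)"
      using t by (simp add: state_source_def)
    then show ?thesis
      by (simp only: H_has_derivative(1)[OF t'(1)] costate_form[OF t'(2)])
  qed
qed

lemma delayed_source_inner:
  assumes t: "t \<in> {h<..<T}"
  shows "1 / Gamma \<alpha> * (delayed_source t \<bullet> k) = costate t \<bullet> deriv_delayed f t (y t) (y (t - h)) (u t) k - cost_weight t * deriv_delayed f0 t (y t) (y (t - h)) (u t) k"
proof -
  have t': "t \<in> {0..T}" "t \<in> {0..<T}" using t h by auto
  show ?thesis
  proof -
    have "1 / Gamma \<alpha> * (delayed_source t \<bullet> k) = rl_kernel \<alpha> (T - t) / Gamma \<alpha> * (H_yh \<alpha> \<beta> T f f0 t (y t) (y (t - h)) (u t) (\<Psi> t) \<bullet> k)"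
      using t by (simp add: delayed_source_def)
    then show ?thesis
      by (simp only: H_has_derivative(2)[OF t'(1)] costate_form[OF t'(2)])
  qed
qed

text \<open>Fubini moves the fractional integral from the sources to \<open>X\<close>, where it
  becomes \<delta>, shifted by \<open>h\<close> for the delayed source. It expresses the pairing of
  the costate with the dynamics through the linear terms in \<delta>.\<close>

lemma adjoint_identity:
  assumes X: "X \<in> borel_measurable lebesgue" "\<And>t. norm (X t) \<le> B * indicator {0..T} t"
    and \<delta>: "\<And>t. t \<le> T \<Longrightarrow> \<delta> t = (1 / Gamma \<alpha>) *\<^sub>R (LINT \<tau>|lebesgue. rl_kernel \<alpha> (t - \<tau>) *\<^sub>R X \<tau>)"
  shows "integrable lebesgue (\<lambda>t. costate t \<bullet> X t)"
    and "(LINT t|lebesgue. costate t \<bullet> X t) = - (terminal_gradient \<bullet> \<delta> T)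
      + 1 / Gamma \<alpha> * (LINT t|lebesgue. state_source t \<bullet> \<delta> t) + 1 / Gamma \<alpha> * (LINT t|lebesgue. delayed_source t \<bullet> \<delta> (t - h))"
proof -
  note A1 = rl_integration_by_parts[OF a(1) less_imp_le[OF T] order_refl state_source_integrable source_zero(1) X]
  note A2 = rl_integration_by_parts[OF a(1) less_imp_le[OF T] less_imp_le[OF h] delayed_source_integrable source_zero(2) X]
  have Xb: "norm (X t) \<le> \<bar>B\<bar> * indicator {0..} t" for t
    using X(2)[of t] by (cases "t \<in> {0..T}") auto
  have kX: "integrable lebesgue (\<lambda>t. rl_kernel \<alpha> (T - t) *\<^sub>R X t)"
    by (rule integrable_rl_kernel_bounded[OF a(1) X(1) Xb])
  \<comment> \<open>The terminal term requires no exchange of integrals: the kernel at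
    \<open>T\<close> against \<open>X\<close> is already the terminal value of \<delta>, up to
    \<open>Gamma \<alpha>\<close>.\<close>
  have kX': "(LINT t|lebesgue. terminal_gradient \<bullet> (rl_kernel \<alpha> (T - t) *\<^sub>R X t)) = Gamma \<alpha> * (terminal_gradient \<bullet> \<delta> T)"
    using kX Gamma_alpha_pos by (subst integral_inner_right) (auto simp: \<delta>)
  have kXi: "integrable lebesgue (\<lambda>t. terminal_gradient \<bullet> (rl_kernel \<alpha> (T - t) *\<^sub>R X t))"
    using kX by (intro integrable_inner_right) auto
  \<comment> \<open>The equation for \<delta> is available up to \<open>T\<close> only; beyond it
    the sources vanish.\<close>
  have qz: "state_source \<tau> \<bullet> (LINT t|lebesgue. rl_kernel \<alpha> (\<tau> - 0 - t) *\<^sub>R X t) = Gamma \<alpha> * (state_source \<tau> \<bullet> \<delta> \<tau>)"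
     "delayed_source \<tau> \<bullet> (LINT t|lebesgue. rl_kernel \<alpha> (\<tau> - h - t) *\<^sub>R X t) = Gamma \<alpha> * (delayed_source \<tau> \<bullet> \<delta> (\<tau> - h))" for \<tau>
    using Gamma_alpha_pos source_zero[of \<tau>] h by (cases "\<tau> \<le> T"; simp add: \<delta>)+
  have Peq: "costate t \<bullet> X t = 1 / Gamma \<alpha> * (- (terminal_gradient \<bullet> (rl_kernel \<alpha> (T - t) *\<^sub>R X t))
      + 1 / Gamma \<alpha> * (X t \<bullet> (LINT \<tau>|lebesgue. rl_kernel \<alpha> (\<tau> - 0 - t) *\<^sub>R state_source \<tau>))
      + 1 / Gamma \<alpha> * (X t \<bullet> (LINT \<tau>|lebesgue. rl_kernel \<alpha> (\<tau> - h - t) *\<^sub>R delayed_source \<tau>)))" for t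
    unfolding costate_def inner_scaleR_left inner_add_left inner_minus_left inner_scaleR_right
    by (simp only: inner_commute[of "X t"])
  show "integrable lebesgue (\<lambda>t. costate t \<bullet> X t)"
    unfolding Peq using kXi A1(1) A2(1)
    by (intro integrable_mult_right Bochner_Integration.integrable_add Bochner_Integration.integrable_minus) auto
  have "(LINT t|lebesgue. costate t \<bullet> X t) = 1 / Gamma \<alpha> * (- (Gamma \<alpha> * (terminal_gradient \<bullet> \<delta> T))
      + 1 / Gamma \<alpha> * (LINT t|lebesgue. Gamma \<alpha> * (state_source t \<bullet> \<delta> t))
      + 1 / Gamma \<alpha> * (LINT t|lebesgue. Gamma \<alpha> * (delayed_source t \<bullet> \<delta> (t - h))))"
  proof -
    have "(LINT t|lebesgue. costate t \<bullet> X t) = 1 / Gamma \<alpha> * (- (LINT t|lebesgue. terminal_gradient \<bullet> (rl_kernel \<alpha> (T - t) *\<^sub>R X t))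
      + 1 / Gamma \<alpha> * (LINT t|lebesgue. X t \<bullet> (LINT \<tau>|lebesgue. rl_kernel \<alpha> (\<tau> - 0 - t) *\<^sub>R state_source \<tau>))
      + 1 / Gamma \<alpha> * (LINT t|lebesgue. X t \<bullet> (LINT \<tau>|lebesgue. rl_kernel \<alpha> (\<tau> - h - t) *\<^sub>R delayed_source \<tau>)))"
      unfolding Peq
      by (rule has_bochner_integral_integral_eq)
         (intro has_bochner_integral_mult_right has_bochner_integral_add has_bochner_integral_minus
            has_bochner_integral_integrable kXi A1(1) A2(1))
    then show ?thesis by (simp only: A1(2) A2(2) qz kX')
  qed
  then show "(LINT t|lebesgue. costate t \<bullet> X t) = - (terminal_gradient \<bullet> \<delta> T)
      + 1 / Gamma \<alpha> * (LINT t|lebesgue. state_source t \<bullet> \<delta> t) + 1 / Gamma \<alpha> * (LINT t|lebesgue. delayed_source t \<bullet> \<delta> (t - h))"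
    using Gamma_alpha_pos by (simp add: distrib_left diff_divide_distrib)
qed

section \<open>The gain and its first-order estimate\<close>

text \<open>For t in [0,T) this is the Hamiltonian times the positive weight (T - t)^(\<alpha> - 1)
  / \<Gamma>(\<alpha>), so it has the same maximisers; the weight comes from the costate.\<close>

definition weighted_Hamiltonian :: "real \<Rightarrow> real^'r \<Rightarrow> real" where
  "weighted_Hamiltonian t x = costate t \<bullet> f t (y t) (y (t - h)) x - cost_weight t * f0 t (y t) (y (t - h)) x"

definition gain :: "(real \<Rightarrow> real^'r) \<Rightarrow> real \<Rightarrow> real" where
  "gain v t = indicator {0..T} t * (weighted_Hamiltonian t (v t) - weighted_Hamiltonian t (u t))"

text \<open>The integrable coefficient that multiplies every Taylor remainder of \<open>f\<close>
  and \<open>f0\<close>.\<close>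

definition majorant :: "real \<Rightarrow> real" where
  "majorant t = indicator {0..T} t * (norm (costate t) + cost_weight t)"

lemma majorant_integrable: "integrable lebesgue majorant"
proof -
  have "integrable lebesgue (\<lambda>t. norm (indicator {0..T} t *\<^sub>R costate t) + indicator {0..T} t * cost_weight t)"
    by (intro Bochner_Integration.integrable_add integrable_norm costate_integrable cost_weight_integrable)
  then show ?thesis by (simp add: majorant_def[abs_def] distrib_left)
qed

lemma majorant_nonneg: "0 \<le> majorant t" by (simp add: majorant_def cost_weight_nonneg)

lemma weighted_bound:
  assumes "norm x \<le> C" "\<bar>r\<bar> \<le> C" "t \<in> {0..T}"
  shows "\<bar>costate t \<bullet> x - cost_weight t * r\<bar> \<le> C * majorant t"
proof -
  have "\<bar>costate t \<bullet> x - cost_weight t * r\<bar> \<le> \<bar>costate t \<bullet> x\<bar> + \<bar>cost_weight t * r\<bar>" by (rule abs_triangle_ineq4)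
  also have "\<dots> \<le> norm (costate t) * norm x + cost_weight t * \<bar>r\<bar>"
    using Cauchy_Schwarz_ineq2[of "costate t" x] cost_weight_nonneg[of t] by (simp add: abs_mult)
  also have "\<dots> \<le> norm (costate t) * C + cost_weight t * C"
    using assms cost_weight_nonneg[of t] by (intro add_mono mult_left_mono) auto
  finally show ?thesis using assms(3) by (simp add: majorant_def algebra_simps)
qed

lemma gain_increment:
  "gain v t = (indicator {0..T} t *\<^sub>R costate t) \<bullet> increment f v (\<lambda>_. 0) t - (indicator {0..T} t * cost_weight t) * increment f0 v (\<lambda>_. 0) t"
  by (auto simp: gain_def weighted_Hamiltonian_def increment_def indicator_def inner_diff_right algebra_simps)

lemma control_difference_bounded:
  assumes "is_control T U v"
  shows "\<exists>R. \<forall>t\<in>{0..T}. norm (v t - u t) \<le> R"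
proof -
  have "bounded (v ` {0..T})" "bounded (u ` {0..T})" using assms control_u by (auto simp: is_control_def)
  then obtain R1 R2 where R: "\<forall>x\<in>v ` {0..T}. norm x \<le> R1" "\<forall>x\<in>u ` {0..T}. norm x \<le> R2"
    unfolding bounded_iff by blast
  have "norm (v t - u t) \<le> R1 + R2" if "t \<in> {0..T}" for t
    by (rule order_trans[OF norm_triangle_ineq4 add_mono]) (use R that in auto)
  then show ?thesis by blast
qed

lemma gain_integrable:
  assumes v: "is_control T U v"
  shows "integrable lebesgue (gain v)"
proof -
  obtain R where R: "\<And>t. t \<in> {0..T} \<Longrightarrow> norm (v t - u t) \<le> R"
    using control_difference_bounded[OF v] by blast
  have z: "(\<lambda>_::real. 0 :: real^'n) \<in> borel_measurable lebesgue" by simp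
  have im: "increment f v (\<lambda>_. 0) \<in> borel_measurable lebesgue"
    "increment f0 v (\<lambda>_. 0) \<in> borel_measurable lebesgue"
    by (rule increment_measurable[OF L(2) L1(2) v z] increment_measurable[OF L(3) L1(3) v z])+
  have wm: "(\<lambda>t. indicator {0..T} t *\<^sub>R costate t) \<in> borel_measurable lebesgue"
    "(\<lambda>t. indicator {0..T} t * cost_weight t) \<in> borel_measurable lebesgue"
    using costate_integrable cost_weight_integrable by auto
  show ?thesis
  proof (rule Bochner_Integration.integrable_bound)
    show "integrable lebesgue (\<lambda>t. L * R * majorant t)" using majorant_integrable by simp
    have "(\<lambda>t. (indicator {0..T} t *\<^sub>R costate t) \<bullet> increment f v (\<lambda>_. 0) t - (indicator {0..T} t * cost_weight t) * increment f0 v (\<lambda>_. 0) t) \<in> borel_measurable lebesgue"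
      by (rule borel_measurable_diff[OF borel_measurable_inner[OF wm(1) im(1)] borel_measurable_times[OF wm(2) im(2)]])
    then show "gain v \<in> borel_measurable lebesgue"
      by (simp only: gain_increment[symmetric, abs_def])
    have "norm (gain v t) \<le> norm (L * R * majorant t)" for t
    proof (cases "t \<in> {0..T}")
      case True
      have b: "norm (d t (y t) (y (t - h)) (v t) - d t (y t) (y (t - h)) (u t)) \<le> L * R"
        if "lipschitz_with_growth T L d" for d :: "real \<Rightarrow> real^'n \<Rightarrow> real^'n \<Rightarrow> real^'r \<Rightarrow> 'c::real_normed_vector"
      proof -
        have "norm (d t (y t) (y (t - h)) (v t) - d t (y t) (y (t - h)) (u t)) \<le> L * norm (v t - u t)"
          using lipschitz_increment[OF that True, of "y t" "y (t - h)" "v t" "y t" "y (t - h)" "u t"] by simp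
        also have "\<dots> \<le> L * R" using R[OF True] L by (intro mult_left_mono) auto
        finally show ?thesis .
      qed
      have "\<bar>costate t \<bullet> (f t (y t) (y (t - h)) (v t) - f t (y t) (y (t - h)) (u t))
         - cost_weight t * (f0 t (y t) (y (t - h)) (v t) - f0 t (y t) (y (t - h)) (u t))\<bar> \<le> L * R * majorant t"
        using b[OF L(2)] b[OF L(3)] by (intro weighted_bound True) auto
      moreover have "gain v t = costate t \<bullet> (f t (y t) (y (t - h)) (v t) - f t (y t) (y (t - h)) (u t))
         - cost_weight t * (f0 t (y t) (y (t - h)) (v t) - f0 t (y t) (y (t - h)) (u t))"
        using True by (simp add: gain_def weighted_Hamiltonian_def inner_diff_right algebra_simps)
      ultimately show ?thesis by simp
    qed (simp add: gain_def)
    then show "AE t in lebesgue. norm (gain v t) \<le> norm (L * R * majorant t)" by simp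
  qed
qed

text \<open>The source terms are exactly the linear parts of the weighted increments and cancel
  against them. There remain minus the gain on \<open>E\<close> and the Taylor remainders, of which
  only the cross term with \<open>R\<close> is confined to \<open>E\<close>. The endpoints are
  excluded because the sources live on open intervals.\<close>

lemma perturbation_pointwise:
  assumes \<delta>0: "\<And>t. t \<le> 0 \<Longrightarrow> \<delta> t = 0"
    and M: "\<And>t. t \<le> T \<Longrightarrow> norm (\<delta> t) \<le> M"
    and R: "\<And>t. t \<in> {0..T} \<Longrightarrow> norm (v t - u t) \<le> R"
    and t: "t \<noteq> 0" "t \<noteq> T"
  shows "1 / Gamma \<alpha> * (state_source t \<bullet> \<delta> t) + 1 / Gamma \<alpha> * (delayed_source t \<bullet> \<delta> (t - h))
      - costate t \<bullet> increment f (\<lambda>t. if t \<in> E then v t else u t) \<delta> t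
      + cost_weight t * increment f0 (\<lambda>t. if t \<in> E then v t else u t) \<delta> t
    \<le> - (indicator E t * gain v t) + L1 * (2 * M) * (2 * M * majorant t + R * (indicator E t * majorant t))"
proof (cases "t \<in> {0..T}")
  case False
  then have "state_source t = 0" "delayed_source t = 0" using h by (auto simp: state_source_def delayed_source_def)
  then show ?thesis using False by (simp add: increment_def gain_def majorant_def)
next
  case True
  then have tT: "t \<in> {0<..<T}" using t by auto
  let ?w = "if t \<in> E then v t else u t"
  let ?yh = "y (t - h)"
  let ?a = "\<delta> t" and ?b = "\<delta> (t - h)"
  have M0: "0 \<le> M" using order_trans[OF norm_ge_zero M[of 0]] T by simp
  have R0: "0 \<le> R" using order_trans[OF norm_ge_zero R[of 0]] T by simp
  define C where "C = L1 * (2 * M + R * indicator E t) * (2 * M)"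
  define \<rho> where "\<rho> = f t (y t + ?a) (?yh + ?b) ?w - f t (y t) ?yh ?w
      - (deriv_state f t (y t) ?yh (u t) ?a + deriv_delayed f t (y t) ?yh (u t) ?b)"
  define \<rho>0 where "\<rho>0 = f0 t (y t + ?a) (?yh + ?b) ?w - f0 t (y t) ?yh ?w
      - (deriv_state f0 t (y t) ?yh (u t) ?a + deriv_delayed f0 t (y t) ?yh (u t) ?b)"
  have ab: "norm ?a \<le> M" "norm ?b \<le> M" using M[of t] M[of "t - h"] True h by auto
  have w: "norm (?w - u t) \<le> R * indicator E t" using R[OF True] by simp
  have rem: "L1 * (norm ?a + norm ?b + norm (?w - u t)) * (norm ?a + norm ?b) \<le> C"
    unfolding C_def using ab w L1 M0 R0 by (intro mult_mono) auto
  have \<rho>: "norm \<rho> \<le> C" "\<bar>\<rho>0\<bar> \<le> C"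
    using smooth_data_remainder[OF L1(2) True, of "y t" ?a ?yh ?b ?w "u t"]
      smooth_data_remainder[OF L1(3) True, of "y t" ?a ?yh ?b ?w "u t"] L1 rem
    unfolding \<rho>_def \<rho>0_def real_norm_def by linarith+
  have q2b: "1 / Gamma \<alpha> * (delayed_source t \<bullet> ?b) = costate t \<bullet> deriv_delayed f t (y t) ?yh (u t) ?b - cost_weight t * deriv_delayed f0 t (y t) ?yh (u t) ?b"
  proof (cases "h < t")
    case True
    then show ?thesis using tT by (intro delayed_source_inner) auto
  next
    case False
    then have "?b = 0" by (intro \<delta>0) auto
    moreover have "linear (deriv_delayed f t (y t) ?yh (u t))" "linear (deriv_delayed f0 t (y t) ?yh (u t))"
      using smooth_data_has_derivative(2)[OF L1(2) True] smooth_data_has_derivative(2)[OF L1(3) True]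
      by (blast intro: has_derivative_linear)+
    ultimately show ?thesis by (simp add: linear_0)
  qed
  have g: "indicator E t * gain v t = costate t \<bullet> (f t (y t) ?yh ?w - f t (y t) ?yh (u t)) - cost_weight t * (f0 t (y t) ?yh ?w - f0 t (y t) ?yh (u t))"
    using True by (simp add: gain_def weighted_Hamiltonian_def inner_diff_right algebra_simps)
  have X: "costate t \<bullet> increment f (\<lambda>t. if t \<in> E then v t else u t) \<delta> t
    = costate t \<bullet> (\<rho> + (deriv_state f t (y t) ?yh (u t) ?a + deriv_delayed f t (y t) ?yh (u t) ?b) + (f t (y t) ?yh ?w - f t (y t) ?yh (u t)))"
    using True by (simp add: increment_def \<rho>_def)
  have X0: "cost_weight t * increment f0 (\<lambda>t. if t \<in> E then v t else u t) \<delta> t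
    = cost_weight t * (\<rho>0 + (deriv_state f0 t (y t) ?yh (u t) ?a + deriv_delayed f0 t (y t) ?yh (u t) ?b) + (f0 t (y t) ?yh ?w - f0 t (y t) ?yh (u t)))"
    using True by (simp add: increment_def \<rho>0_def)
  have "1 / Gamma \<alpha> * (state_source t \<bullet> \<delta> t) + 1 / Gamma \<alpha> * (delayed_source t \<bullet> \<delta> (t - h))
      - costate t \<bullet> increment f (\<lambda>t. if t \<in> E then v t else u t) \<delta> t
      + cost_weight t * increment f0 (\<lambda>t. if t \<in> E then v t else u t) \<delta> t
    = - (indicator E t * gain v t) - (costate t \<bullet> \<rho> - cost_weight t * \<rho>0)"
    unfolding state_source_inner[OF tT] q2b X X0 g inner_add_right distrib_left right_diff_distrib by simp
  also have "\<dots> \<le> - (indicator E t * gain v t) + C * majorant t"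
    using weighted_bound[OF \<rho> True] by (simp add: abs_le_iff)
  also have "C * majorant t = L1 * (2 * M) * (2 * M * majorant t + R * (indicator E t * majorant t))"
    by (simp add: C_def algebra_simps)
  finally show ?thesis .
qed

text \<open>The integrated pointwise estimate, combined with the adjoint identity and the
  nonnegative cost difference. All terms linear in \<delta> drop out except the gradient at
  \<open>T\<close>, which leaves the first-order remainder of \<Phi>.\<close>

lemma perturbation_inequality:
  assumes v: "is_control T U v" and R: "\<And>t. t \<in> {0..T} \<Longrightarrow> norm (v t - u t) \<le> R"
    and E: "E \<in> sets lebesgue" and \<delta>m: "\<delta> \<in> borel_measurable lebesgue"
    and \<delta>: "\<And>t. t \<le> T \<Longrightarrow> \<delta> t = (1 / Gamma \<alpha>) *\<^sub>R
         (LINT \<tau>|lebesgue. rl_kernel \<alpha> (t - \<tau>) *\<^sub>R increment f (\<lambda>t. if t \<in> E then v t else u t) \<delta> \<tau>)"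
    and M: "\<And>t. t \<le> T \<Longrightarrow> norm (\<delta> t) \<le> M"
  shows "(LINT t|lebesgue. indicator E t * gain v t) \<le> \<Phi> (y T + \<delta> T) - \<Phi> (y T) - terminal_gradient \<bullet> \<delta> T
     + L1 * (2 * M) * (2 * M * (LINT t|lebesgue. majorant t) + R * (LINT t|lebesgue. indicator E t * majorant t))"
proof -
  let ?v = "\<lambda>t. if t \<in> E then v t else u t"
  let ?X = "increment f ?v \<delta>" and ?Z = "increment f0 ?v \<delta>"
  have vE: "is_control T U ?v"
    using v E by (intro control_switch[OF control_u]) (auto simp: is_control_def intro: bounded_subset)
  have R0: "0 \<le> R" using order_trans[OF norm_ge_zero R[of 0]] T by simp
  have R': "norm (?v t - u t) \<le> R" if "t \<in> {0..T}" for t using R[OF that] R0 by simp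
  have Xm: "?X \<in> borel_measurable lebesgue" by (rule increment_measurable[OF L(2) L1(2) vE \<delta>m])
  note Xb = increment_bound[where \<delta>=\<delta> and M=M and v="?v" and R=R, OF L(2) M R']
  note pc = perturbed_costed[OF vE \<delta>m \<delta> M R']
  note ai = adjoint_identity[OF Xm Xb \<delta>]
  have \<delta>0: "\<delta> t = 0" if "t \<le> 0" for t
    using that T by (subst \<delta>, simp, subst rl_convolution_nonpos) (auto simp: increment_def)
  have "ereal (cost \<beta> T h f0 \<Phi> u y) \<le> ereal (cost \<beta> T h f0 \<Phi> ?v (\<lambda>t. y t + \<delta> t))"
    using opt unfolding optimal_process_def by (metis (no_types, lifting) INF_lower pc(1) case_prod_conv)
  then have J: "0 \<le> \<Phi> (y T + \<delta> T) - \<Phi> (y T) + 1 / Gamma \<beta> * (LINT t|lebesgue. rl_kernel \<beta> (T - t) * ?Z t)"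
    using pc(3) by simp
  have bX: "integrable lebesgue (\<lambda>t. cost_weight t * ?Z t)" "1 / Gamma \<beta> * (LINT t|lebesgue. rl_kernel \<beta> (T - t) * ?Z t) = (LINT t|lebesgue. cost_weight t * ?Z t)"
    using integrable_mult_right[OF pc(2), of "1 / Gamma \<beta>"] by (simp_all add: cost_weight_def)
  have qi: "integrable lebesgue (\<lambda>t. state_source t \<bullet> \<delta> t)" "integrable lebesgue (\<lambda>t. delayed_source t \<bullet> \<delta> (t - h))"
  proof -
    have i: "integrable lebesgue (\<lambda>t. q t \<bullet> \<delta> (t - s))"
      if q: "integrable lebesgue q" "\<And>\<tau>. T < \<tau> \<Longrightarrow> q \<tau> = 0" and s: "0 \<le> s" for q s
    proof (rule Bochner_Integration.integrable_bound)
      show "integrable lebesgue (\<lambda>t. M * norm (q t))" using q(1) by simp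
      show "(\<lambda>t. q t \<bullet> \<delta> (t - s)) \<in> borel_measurable lebesgue"
        using q(1) measurable_shift_lebesgue[OF \<delta>m] by (intro borel_measurable_inner) auto
      have "norm (q t \<bullet> \<delta> (t - s)) \<le> norm (M * norm (q t))" for t
      proof (cases "t \<le> T")
        case True
        have "\<bar>q t \<bullet> \<delta> (t - s)\<bar> \<le> norm (q t) * norm (\<delta> (t - s))" by (rule Cauchy_Schwarz_ineq2)
        also have "\<dots> \<le> norm (q t) * M" using M[of "t - s"] True s by (intro mult_left_mono) auto
        also have "\<dots> \<le> \<bar>M * norm (q t)\<bar>" by (simp add: mult.commute)
        finally show ?thesis by simp
      qed (simp add: q)
      then show "AE t in lebesgue. norm (q t \<bullet> \<delta> (t - s)) \<le> norm (M * norm (q t))" by simp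
    qed
    show "integrable lebesgue (\<lambda>t. state_source t \<bullet> \<delta> t)" using i[OF state_source_integrable source_zero(1), of 0] by simp
    show "integrable lebesgue (\<lambda>t. delayed_source t \<bullet> \<delta> (t - h))" using i[OF delayed_source_integrable source_zero(2), of h] h by simp
  qed
  have Ei: "integrable lebesgue (\<lambda>t. indicator E t * gain v t)" "integrable lebesgue (\<lambda>t. indicator E t * majorant t)"
    using integrable_mult_indicator[OF E gain_integrable[OF v]] integrable_mult_indicator[OF E majorant_integrable] by simp_all
  have l: "has_bochner_integral lebesgue (\<lambda>t. 1 / Gamma \<alpha> * (state_source t \<bullet> \<delta> t) + 1 / Gamma \<alpha> * (delayed_source t \<bullet> \<delta> (t - h)) - costate t \<bullet> ?X t + cost_weight t * ?Z t)
     (1 / Gamma \<alpha> * (LINT t|lebesgue. state_source t \<bullet> \<delta> t) + 1 / Gamma \<alpha> * (LINT t|lebesgue. delayed_source t \<bullet> \<delta> (t - h)) - (LINT t|lebesgue. costate t \<bullet> ?X t)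
       + (LINT t|lebesgue. cost_weight t * ?Z t))"
    by (intro has_bochner_integral_add has_bochner_integral_diff has_bochner_integral_mult_right has_bochner_integral_integrable qi ai(1) bX(1))
  have r: "has_bochner_integral lebesgue (\<lambda>t. - (indicator E t * gain v t) + L1 * (2 * M) * (2 * M * majorant t + R * (indicator E t * majorant t)))
     (- (LINT t|lebesgue. indicator E t * gain v t) + L1 * (2 * M) * (2 * M * (LINT t|lebesgue. majorant t) + R * (LINT t|lebesgue. indicator E t * majorant t)))"
    by (intro has_bochner_integral_add has_bochner_integral_minus has_bochner_integral_mult_right has_bochner_integral_integrable Ei majorant_integrable)
  have ae: "AE t in lebesgue. t \<noteq> c" for c :: real
    by (rule AE_completion) (rule AE_lborel_singleton)
  have "AE t in lebesgue. 1 / Gamma \<alpha> * (state_source t \<bullet> \<delta> t) + 1 / Gamma \<alpha> * (delayed_source t \<bullet> \<delta> (t - h)) - costate t \<bullet> ?X t + cost_weight t * ?Z t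
     \<le> - (indicator E t * gain v t) + L1 * (2 * M) * (2 * M * majorant t + R * (indicator E t * majorant t))"
    using ae[of 0] ae[of T] by eventually_elim (rule perturbation_pointwise[OF \<delta>0 M R])
  then have "(LINT t|lebesgue. 1 / Gamma \<alpha> * (state_source t \<bullet> \<delta> t) + 1 / Gamma \<alpha> * (delayed_source t \<bullet> \<delta> (t - h)) - costate t \<bullet> ?X t + cost_weight t * ?Z t)
     \<le> (LINT t|lebesgue. - (indicator E t * gain v t) + L1 * (2 * M) * (2 * M * majorant t + R * (indicator E t * majorant t)))"
    by (intro integral_mono_AE has_bochner_integral_iff[THEN iffD1, OF l, THEN conjunct1]
          has_bochner_integral_iff[THEN iffD1, OF r, THEN conjunct1])
  then show ?thesis
    using J bX(2) ai(2)
    unfolding has_bochner_integral_integral_eq[OF l] has_bochner_integral_integral_eq[OF r] by linarith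
qed

text \<open>If the integrated gain \<open>A\<close> were positive, dividing the perturbation
  inequality by \<open>e\<close> would give \<open>A \<le> A / 2 + Z * e\<close>, which fails for
  small \<open>e\<close>.\<close>

lemma gain_integral_nonpos:
  assumes v: "is_control T U v"
  shows "(LINT t|lebesgue. gain v t) \<le> 0"
proof (rule ccontr)
  define A where "A = (LINT t|lebesgue. gain v t)"
  assume "\<not> (LINT t|lebesgue. gain v t) \<le> 0"
  then have A: "0 < A" by (simp add: A_def)
  define S where "S = (LINT t|lebesgue. majorant t)"
  have S: "0 \<le> S" unfolding S_def by (intro Bochner_Integration.integral_nonneg majorant_nonneg)
  obtain R where R: "\<And>t. t \<in> {0..T} \<Longrightarrow> norm (v t - u t) \<le> R"
    using control_difference_bounded[OF v] by blast
  have R0: "0 \<le> R" using order_trans[OF norm_ge_zero R[of 0]] T by simp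
  obtain \<Lambda> where \<Lambda>: "0 < \<Lambda>" and pert: "\<And>E K. E \<in> sets lebesgue \<Longrightarrow> E \<subseteq> {0..T} \<Longrightarrow>
     (\<forall>t\<le>T. (LINT \<tau>|lebesgue. rl_kernel \<alpha> (t - \<tau>) * indicator E \<tau>) \<le> K) \<Longrightarrow>
     (\<exists>\<delta>. \<delta> \<in> borel_measurable lebesgue \<and> (\<forall>t\<le>T. norm (\<delta> t) \<le> \<Lambda> * K) \<and>
       (\<forall>t\<le>T. \<delta> t = (1 / Gamma \<alpha>) *\<^sub>R
         (LINT \<tau>|lebesgue. rl_kernel \<alpha> (t - \<tau>) *\<^sub>R increment f (\<lambda>t. if t \<in> E then v t else u t) \<delta> \<tau>)))"
    by (rule exE[OF exists_perturbation[OF v]], erule R, elim conjE, rule that, assumption, drule(1) bspec, drule spec, drule(1) mp, erule(1) mp)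
  define N where "N = \<Lambda> * (T powr \<alpha> / \<alpha> + 2)"
  have N: "0 < N" using \<Lambda> a by (auto simp: N_def intro!: mult_pos_pos add_nonneg_pos)
  obtain D where D: "(\<Phi> has_derivative D) (at (y T))"
    using \<Phi> by (auto simp: continuously_differentiable_def)
  have Dg: "D = (\<lambda>k. terminal_gradient \<bullet> k)"
    using gradient_inner[OF D] by (auto simp: terminal_gradient_def)
  \<comment> \<open>The remainder of \<Phi> is allowed to consume half of the gain;
    \<open>N * e\<close> will bound \<delta>.\<close>
  define \<kappa> where "\<kappa> = A / (2 * N)"
  have \<kappa>: "0 < \<kappa>" using A N by (simp add: \<kappa>_def)
  obtain d where d: "0 < d" "\<And>z. norm (z - y T) < d \<Longrightarrow> norm (\<Phi> z - \<Phi> (y T) - D (z - y T)) \<le> \<kappa> * norm (z - y T)"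
    using D \<kappa> unfolding has_derivative_at_alt by blast
  \<comment> \<open>The coefficient of \<open>e\<^sup>2\<close>: the tolerance of the gain on
    \<open>E\<close>, the quadratic remainder, and the cross term with the integral of the majorant
    over \<open>E\<close> bounded by \<open>e * (S + 1)\<close>.\<close>
  define Z where "Z = 1 + 4 * L1 * N\<^sup>2 * S + 2 * L1 * N * R * (S + 1)"
  have Z: "0 < Z" using L1 N S R0 by (auto simp: Z_def intro!: add_pos_nonneg mult_nonneg_nonneg)
  \<comment> \<open>Small enough for \<delta> at \<open>T\<close> to stay where the
    differentiability estimate of \<Phi> holds, and for \<open>Z * e\<close> to stay below the other
    half of the gain.\<close>
  define e where "e = min 1 (min (d / (2 * N)) (A / (4 * Z)))"
  have e: "0 < e" "e \<le> 1" "N * e < d" "Z * e < A / 2"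
  proof -
    show "0 < e" "e \<le> 1" using d N A Z by (auto simp: e_def)
    have "N * e \<le> N * (d / (2 * N))" using N by (intro mult_left_mono) (auto simp: e_def)
    also have "\<dots> < d" using N d by simp
    finally show "N * e < d" .
    have "Z * e \<le> Z * (A / (4 * Z))" using Z by (intro mult_left_mono) (auto simp: e_def)
    also have "\<dots> < A / 2" using A Z by simp
    finally show "Z * e < A / 2" .
  qed
  have "\<exists>E\<in>sets lebesgue. E \<subseteq> {0..T} \<and>
     (\<forall>g\<in>{gain v, majorant}. \<bar>(LINT x|lebesgue. indicator E x * g x) - e * (LINT x|lebesgue. indicator {0..T} x * g x)\<bar> \<le> e\<^sup>2) \<and>
     (\<forall>t\<le>T. (LINT \<tau>|lebesgue. rl_kernel \<alpha> (t - \<tau>) * indicator E \<tau>) \<le> (T powr \<alpha> / \<alpha> + 2) * e)"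
    using e majorant_integrable gain_integrable[OF v] by (intro exists_spread_set a T) auto
  then obtain E where E: "E \<in> sets lebesgue" "E \<subseteq> {0..T}"
    and Eg: "\<And>g. g \<in> {gain v, majorant} \<Longrightarrow> \<bar>(LINT x|lebesgue. indicator E x * g x) - e * (LINT x|lebesgue. indicator {0..T} x * g x)\<bar> \<le> e\<^sup>2"
    and EK: "\<forall>t\<le>T. (LINT \<tau>|lebesgue. rl_kernel \<alpha> (t - \<tau>) * indicator E \<tau>) \<le> (T powr \<alpha> / \<alpha> + 2) * e"
    by blast
  \<comment> \<open>Both functions vanish off the interval, so the prescribed fractions are
    fractions of their full integrals.\<close>
  have supp: "indicator {0..T} x * gain v x = gain v x" "indicator {0..T} x * majorant x = majorant x" for x
    by (auto simp: gain_def majorant_def indicator_def)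
  have gE: "e * A - e\<^sup>2 \<le> (LINT t|lebesgue. indicator E t * gain v t)"
    using Eg[of "gain v"] by (simp add: supp A_def abs_le_iff)
  have WE: "(LINT t|lebesgue. indicator E t * majorant t) \<le> e * S + e\<^sup>2"
    using Eg[of majorant] by (simp add: supp S_def abs_le_iff)
  obtain \<delta> where \<delta>: "\<delta> \<in> borel_measurable lebesgue" "\<And>t. t \<le> T \<Longrightarrow> norm (\<delta> t) \<le> N * e"
    "\<And>t. t \<le> T \<Longrightarrow> \<delta> t = (1 / Gamma \<alpha>) *\<^sub>R
         (LINT \<tau>|lebesgue. rl_kernel \<alpha> (t - \<tau>) *\<^sub>R increment f (\<lambda>t. if t \<in> E then v t else u t) \<delta> \<tau>)"
    using pert[OF E EK] by (auto simp: N_def mult.assoc)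
  have \<Phi>\<delta>: "\<Phi> (y T + \<delta> T) - \<Phi> (y T) - terminal_gradient \<bullet> \<delta> T \<le> \<kappa> * (N * e)"
  proof -
    have n: "norm (\<delta> T) \<le> N * e" using \<delta>(2)[of T] by simp
    then have "norm (\<Phi> (y T + \<delta> T) - \<Phi> (y T) - D (\<delta> T)) \<le> \<kappa> * norm (\<delta> T)"
      using d(2)[of "y T + \<delta> T"] e by simp
    also have "\<dots> \<le> \<kappa> * (N * e)" using n \<kappa> by (intro mult_left_mono) auto
    finally show ?thesis by (simp add: Dg abs_le_iff)
  qed
  have "e * A - e\<^sup>2 \<le> \<kappa> * (N * e) + L1 * (2 * (N * e)) * (2 * (N * e) * S + R * (LINT t|lebesgue. indicator E t * majorant t))"
    using order_trans[OF gE perturbation_inequality[OF v R E(1) \<delta>(1,3,2)]] \<Phi>\<delta> unfolding S_def by linarith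
  also have "\<dots> \<le> \<kappa> * (N * e) + L1 * (2 * (N * e)) * (2 * (N * e) * S + R * (e * S + e\<^sup>2))"
    using WE L1 N e R0 by (intro add_left_mono mult_left_mono) auto
  also have "\<dots> \<le> \<kappa> * (N * e) + L1 * (2 * (N * e)) * (2 * (N * e) * S + R * (e * S + e))"
  proof -
    have "e\<^sup>2 \<le> e" using e by (simp add: power2_eq_square mult_left_le)
    then show ?thesis using L1 N e R0 by (intro add_left_mono mult_left_mono) auto
  qed
  finally have "e * A \<le> e * (\<kappa> * N + Z * e)"
    by (simp add: Z_def algebra_simps power2_eq_square)
  then have "A \<le> \<kappa> * N + Z * e" using e by simp
  also have "\<kappa> * N = A / 2" using N by (simp add: \<kappa>_def)
  finally show False using e by simp
qed

end


section \<open>The maximum principle\<close>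

theorem theorem4p1:
  fixes \<alpha> \<beta> T h :: real
    and f :: "real \<Rightarrow> real^'n \<Rightarrow> real^'n \<Rightarrow> real^'r \<Rightarrow> real^'n"
    and f0 :: "real \<Rightarrow> real^'n \<Rightarrow> real^'n \<Rightarrow> real^'r \<Rightarrow> real"
    and \<Phi> :: "real^'n \<Rightarrow> real"
    and U :: "real \<Rightarrow> (real^'r) set"
    and y0 :: "real^'n"
    and \<phi> :: "real \<Rightarrow> real^'n"
    and u :: "real \<Rightarrow> real^'r"
    and y \<Psi> :: "real \<Rightarrow> real^'n"
  assumes "0 < \<alpha>" "\<alpha> < 1" "\<alpha> \<le> \<beta>" "0 < T" "0 < h"
    and "cond_C1 T f f0"
    and "cond_C2 T f f0"
    and "cond_C3 \<Phi>"
    and "cond_C4 T U"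
    and "measurable_multifunction T U"
    and "\<phi> \<in> borel_measurable (lebesgue_on {-h..<0})"
    and "optimal_process \<alpha> \<beta> T h f f0 \<Phi> U y0 \<phi> u y"
    and "conjugate_solution \<alpha> \<beta> T h f f0 \<Phi> u y \<Psi>"
  shows "AE t in lebesgue_on {0..T}.
           is_arg_max (\<lambda>v. Hamiltonian \<alpha> \<beta> T f f0 t (y t) (y (t - h)) v (\<Psi> t))
             (\<lambda>v. v \<in> U t) (u t)"
proof -
  obtain L where L: "0 < L" "lipschitz_with_growth T L f" "lipschitz_with_growth T L f0"
    using \<open>cond_C1 T f f0\<close> by (auto simp: cond_C1_def)
  obtain L1 where L1: "0 < L1" "smooth_data T L1 f" "smooth_data T L1 f0"
    using \<open>cond_C2 T f f0\<close> by (auto simp: cond_C2_def)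
  interpret optimal_delay_process \<alpha> \<beta> T h L L1 f f0 \<Phi> U y0 \<phi> u y \<Psi>
    by unfold_locales (use assms L L1 in \<open>auto simp: cond_C3_def\<close>)
  have cont: "continuous_on UNIV (weighted_Hamiltonian t)" if t: "t \<in> {0..T}" for t
  proof -
    have c: "continuous_on UNIV (d t (y t) (y (t - h)))"
      if d: "lipschitz_with_growth T L d" for d :: "real \<Rightarrow> real^'n \<Rightarrow> real^'n \<Rightarrow> real^'r \<Rightarrow> 'c::real_normed_vector"
    proof (rule lipschitz_on_continuous_on[of L], rule lipschitz_onI)
      show "dist (d t (y t) (y (t - h)) x) (d t (y t) (y (t - h)) z) \<le> L * dist x z" for x z
        using lipschitz_increment[OF d t, of "y t" "y (t - h)" x "y t" "y (t - h)" z] by (simp add: dist_norm)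
    qed (use L in simp)
    show ?thesis unfolding weighted_Hamiltonian_def[abs_def] by (intro continuous_intros c L)
  qed
  have "AE t in lebesgue. t \<in> {0..T} \<longrightarrow> (\<forall>x\<in>U t. weighted_Hamiltonian t x \<le> weighted_Hamiltonian t (u t))"
  proof (rule AE_maximum_of_integral_maximum[OF control_u \<open>measurable_multifunction T U\<close> _ cont])
    show "closed (U t)" if "t \<in> {0..T}" for t
      using \<open>cond_C4 T U\<close> that by (auto simp: cond_C4_def compact_imp_closed)
    show "integrable lebesgue (\<lambda>t. indicator {0..T} t * (weighted_Hamiltonian t (v t) - weighted_Hamiltonian t (u t)))" if "is_control T U v" for v
      using gain_integrable[OF that] by (simp add: gain_def[abs_def])
    show "(LINT t|lebesgue. indicator {0..T} t * (weighted_Hamiltonian t (v t) - weighted_Hamiltonian t (u t))) \<le> 0" if "is_control T U v" for v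
      using gain_integral_nonpos[OF that] by (simp add: gain_def)
  qed
  \<comment> \<open>The weight relating the two Hamiltonians vanishes at \<open>T\<close>, so the
    endpoint is discarded before dividing by it.\<close>
  moreover have "AE t in lebesgue. t \<noteq> T"
    by (rule AE_completion) (rule AE_lborel_singleton)
  ultimately have "AE t in lebesgue. t \<in> {0..T} \<longrightarrow>
      is_arg_max (\<lambda>v. Hamiltonian \<alpha> \<beta> T f f0 t (y t) (y (t - h)) v (\<Psi> t)) (\<lambda>v. v \<in> U t) (u t)"
  proof eventually_elim
    case (elim t)
    show ?case
    proof
      assume t: "t \<in> {0..T}"
      then have t': "t \<in> {0..<T}" using elim by auto
      have w: "0 < rl_kernel \<alpha> (T - t) / Gamma \<alpha>" using t' Gamma_alpha_pos by (simp add: rl_kernel_def)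
      have "weighted_Hamiltonian t x = rl_kernel \<alpha> (T - t) / Gamma \<alpha> * Hamiltonian \<alpha> \<beta> T f f0 t (y t) (y (t - h)) x (\<Psi> t)" for x
        unfolding weighted_Hamiltonian_def Hamiltonian_def costate_form[OF t'] ..
      then have "\<forall>x\<in>U t. Hamiltonian \<alpha> \<beta> T f f0 t (y t) (y (t - h)) x (\<Psi> t) \<le> Hamiltonian \<alpha> \<beta> T f f0 t (y t) (y (t - h)) (u t) (\<Psi> t)"
        using elim(1) t by (simp only: mult_le_cancel_left_pos[OF w] simp_thms)
      then show "is_arg_max (\<lambda>v. Hamiltonian \<alpha> \<beta> T f f0 t (y t) (y (t - h)) v (\<Psi> t)) (\<lambda>v. v \<in> U t) (u t)"
        using control_u t by (force simp: is_arg_max_def is_control_def not_less)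
    qed
  qed
  then show ?thesis by (subst AE_restrict_space_iff) auto
qed

end
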